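(* Let $X,Y$ be Banach spaces, let the parameter-dependent operator $F:\mathbb{R}\times X\to Y$ be smooth, and let $X_{\mathrm{sym}}\subset X$ and $Y_{\mathrm{sym}}\subset Y$ be closed subspaces with $F(\mathbb{R},X_{\mathrm{sym}})\subset Y_{\mathrm{sym}}$. Assume that for every $\lambda\in\mathbb{R}$ and every $u\in X_{\mathrm{sym}}$ the Fréchet derivative $D_uF(\lambda,u)\in\mathcal{L}(X,Y)$ and its restriction $D_uF(\lambda,u)|_{X_{\mathrm{sym}}}\in\mathcal{L}(X_{\mathrm{sym}},Y_{\mathrm{sym}})$ are Fredholm operators of index zero. For a nontrivial $\ell\in X^*$ consider the extended system $$\mathcal{F}:\mathbb{R}\times X_{\mathrm{sym}}\times X\to\mathbb{R}\times Y_{\mathrm{sym}}\times Y,\qquad \mathcal{F}(\lambda,u,\varphi)=\big(\ell(\varphi)-1,\;F(\lambda,u),\;D_uF(\lambda,u)[\varphi]\big).$$ Then the following hold. (a) Suppose that all the hypotheses (SB) stated in the context hold for $(\lambda_\circ,u_\circ,\varphi_\circ)$, and choose the functional $\ell\in X^*$ in such a way that $\ell(\varphi_\circ)=1$. Then the Fréchet derivative $D\mathcal{F}(\lambda_\circ,u_\circ,\varphi_\circ)$ is invertible, i.e., the solution $(\lambda_\circ,u_\circ,\varphi_\circ)\in\mathbb{R}\times X_{\mathrm{sym}}\times X$ of the extended system $\mathcal{F}(\lambda,u,\varphi)=(0,0,0)$ is an isolated nondegenerate zero. (b) Conversely, if there exist an $\ell\in X^*$ and a $\varphi_\circ\in X\setminus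 X_{\mathrm{sym}}$ such that $(\lambda_\circ,u_\circ,\varphi_\circ)$ is a zero of the map $\mathcal{F}$, and if the Fréchet derivative $D\mathcal{F}(\lambda_\circ,u_\circ,\varphi_\circ)$ is invertible, then $F$ satisfies all the hypotheses (SB) at $(\lambda_\circ,u_\circ,\varphi_\circ)$. In other words, the nonlinear problem $F(\lambda,u)=0$ has a symmetry-breaking transcritical or pitchfork bifurcation point at $(\lambda_\circ,u_\circ)\in\mathbb{R}\times X_{\mathrm{sym}}$ if and only if the triple $(\lambda_\circ,u_\circ,\varphi_\circ)$ is a nondegenerate zero of $\mathcal{F}$ with $\varphi_\circ\notin X_{\mathrm{sym}}$.
   Context: $N(\cdot)$ and $R(\cdot)$ denote nullspace and range. A zero of $\mathcal{F}$ is called nondegenerate if the Fréchet derivative $D\mathcal{F}\in\mathcal{L}(\mathbb{R}\times X_{\mathrm{sym}}\times X,\ \mathbb{R}\times Y_{\mathrm{sym}}\times Y)$ at that zero is invertible. Hypotheses (SB) for $(\lambda_\circ,u_\circ,\varphi_\circ)$, with $L:=D_uF(\lambda_\circ,u_\circ)$: 1. $F(\lambda_\circ,u_\circ)=0$; $L\in\mathcal{L}(X,Y)$ is Fredholm of index zero with one-dimensional nullspace $N(L)=\mathrm{span}[\varphi_\circ]$, $\varphi_\circ\ne0$; and $R(L)=N(\psi_\circ^* )$ for some nonzero $\psi_\circ^*\in Y^*$. 2. $F(\mathbb{R},X_{\mathrm{sym}})\subset Y_{\mathrm{sym}}$ with $X_{\mathrm{sym}},Y_{\mathrm{sym}}$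 closed, the restriction $L|_{X_{\mathrm{sym}}}:X_{\mathrm{sym}}\to Y_{\mathrm{sym}}$ is Fredholm of index zero, $u_\circ\in X_{\mathrm{sym}}$ and $\varphi_\circ\notin X_{\mathrm{sym}}$. 3. (Nondegeneracy) With $\xi_\circ$ the unique element of $X_{\mathrm{sym}}$ solving $L\xi_\circ+D_\lambda F(\lambda_\circ,u_\circ)=0$ (which exists under 1 and 2), one has $D_{\lambda u}F(\lambda_\circ,u_\circ)[\varphi_\circ]+D_{uu}F(\lambda_\circ,u_\circ)[\varphi_\circ,\xi_\circ]\notin R(L)$. Terminology of the closing sentence: under (SB) the point $(\lambda_\circ,u_\circ)$ is a symmetry-breaking bifurcation point of $F(\lambda,u)=0$, i.e., near it the solution set consists of a smooth branch $\lambda\mapsto(\lambda,p(\lambda))$ with $p(\lambda)\in X_{\mathrm{sym}}$, $p(\lambda_\circ)=u_\circ$, and a second smooth branch $\alpha\mapsto(h(\alpha),u(\alpha))$, $\alpha$ near $0$, with $h(0)=\lambda_\circ$, $u(0)=u_\circ$, which is not contained in $X_{\mathrm{sym}}$. It is called transcritical if $h'(0)\neq0$ (equivalently, under (SB), $D_{uu}F(\lambda_\circ,u_\circ)[\varphi_\circ,\varphi_\circ]\notin R(L)$) and pitchfork if $h'(0)=0$ (equivalently, under (SB), $D_{uu}F(\lambda_\circ,u_\circ)[\varphi_\circ,\varphi_\circ]\in R(L)$; the degenerate case $h''(0)=0$ is included). The closing sentence is the summary of (a) and (b), and $\varphi_\circ$ and $\ell$ in it are as in (a) and (b). *)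

theory Defs
  imports "HOL-Analysis.Analysis"
begin

section \<open>Smooth maps between normed spaces\<close>

text \<open>A bounded \<open>n\<close>-linear map is represented by a function on argument lists, of which only the
  values on lists of length \<open>n\<close> matter. The factor \<open>\<Prod>v\<leftarrow>vs. norm v\<close> is the one from the
  operator norm on bounded \<open>n\<close>-linear maps.\<close>

definition bounded_multilinear ::
  "nat \<Rightarrow> ('a::real_normed_vector list \<Rightarrow> 'b::real_normed_vector) \<Rightarrow> bool" where
  "bounded_multilinear n m \<longleftrightarrow>
     (\<forall>vs i. length vs = n \<and> i < n \<longrightarrow> linear (\<lambda>v. m (vs[i := v]))) \<and>
     (\<exists>K. \<forall>vs. length vs = n \<longrightarrow> norm (m vs) \<le> K * (\<Prod>v\<leftarrow>vs. norm v))"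

text \<open>\<open>C\<^sup>\<infinity>\<close> in the sense of Frechet, for open \<open>S\<close>: \<open>d n x\<close> is the \<open>n\<close>-th derivative of \<open>f\<close> at \<open>x\<close>,
  a bounded \<open>n\<close>-linear map, and \<open>d (Suc n)\<close> is the Frechet derivative of \<open>d n\<close> with respect to the
  operator norm on bounded \<open>n\<close>-linear maps. The derivatives are kept as multilinear maps because
  iterating through the operator spaces would change the type with each \<open>n\<close>.\<close>

definition smooth_on ::
  "'a::real_normed_vector set \<Rightarrow> ('a \<Rightarrow> 'b::real_normed_vector) \<Rightarrow> bool" where
  "smooth_on S f \<longleftrightarrow> (\<exists>d :: nat \<Rightarrow> 'a \<Rightarrow> 'a list \<Rightarrow> 'b.
     (\<forall>x\<in>S. d 0 x [] = f x) \<and>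
     (\<forall>n. \<forall>x\<in>S. bounded_multilinear n (d n x)) \<and>
     (\<forall>n. \<forall>x\<in>S. \<forall>e>0. \<exists>r>0. \<forall>h. norm h < r \<and> x + h \<in> S \<longrightarrow>
        (\<forall>vs. length vs = n \<longrightarrow>
          norm (d n (x + h) vs - d n x vs - d (Suc n) x (h # vs))
            \<le> e * norm h * (\<Prod>v\<leftarrow>vs. norm v))))"

section \<open>Operators between subspaces\<close>

definition finite_dimensional :: "'a::real_vector set \<Rightarrow> bool" where
  "finite_dimensional V \<longleftrightarrow> (\<exists>B. finite B \<and> V \<subseteq> span B)"

text \<open>\<open>C\<close> is an algebraic complement of \<open>R\<close> in \<open>W\<close>, so that \<open>dim C\<close> is the dimension of \<open>W / R\<close>.\<close>

definition complement_in :: "'a::real_vector set \<Rightarrow> 'a set \<Rightarrow> 'a set \<Rightarrow> bool" where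
  "complement_in W R C \<longleftrightarrow>
     subspace C \<and> C \<subseteq> W \<and> R \<inter> C = {0} \<and> W = {r + c |r c. r \<in> R \<and> c \<in> C}"

text \<open>The restriction of \<open>T\<close> to the closed subspace \<open>V\<close>, as an operator into the closed subspace \<open>W\<close>,
  is a Fredholm operator of index \<open>k\<close>.\<close>

definition fredholm_with_index ::
  "'a::real_normed_vector set \<Rightarrow> 'b::real_normed_vector set \<Rightarrow> ('a \<Rightarrow>\<^sub>L 'b) \<Rightarrow> int \<Rightarrow> bool" where
  "fredholm_with_index V W T k \<longleftrightarrow>
     blinfun_apply T ` V \<subseteq> W \<and>
     finite_dimensional {v \<in> V. blinfun_apply T v = 0} \<and>
     closed (blinfun_apply T ` V) \<and>
     (\<exists>C. complement_in W (blinfun_apply T ` V) C \<and> finite_dimensional C \<and>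
        k = int (dim {v \<in> V. blinfun_apply T v = 0}) - int (dim C))"

definition invertible_between ::
  "'a::real_normed_vector set \<Rightarrow> 'b::real_normed_vector set \<Rightarrow> ('a \<Rightarrow> 'b) \<Rightarrow> bool" where
  "invertible_between V W D \<longleftrightarrow>
     bij_betw D V W \<and> (\<exists>K. \<forall>w\<in>W. norm (inv_into V D w) \<le> K * norm w)"

text \<open>\<open>V\<close> and \<open>W\<close> are subspaces, and \<open>G\<close> is regarded as a map from \<open>V\<close> to \<open>W\<close>. The derivative
  \<open>at z within V\<close> is determined by \<open>G\<close> on \<open>V\<close>, and only its restriction to \<open>V\<close> is used.\<close>

definition nondegenerate_zero ::
  "'a::real_normed_vector set \<Rightarrow> 'b::real_normed_vector set \<Rightarrow> ('a \<Rightarrow> 'b) \<Rightarrow> 'a \<Rightarrow> bool" where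
  "nondegenerate_zero V W G z \<longleftrightarrow>
     z \<in> V \<and> G z = 0 \<and> (\<exists>D. (G has_derivative D) (at z within V) \<and> invertible_between V W D)"

section \<open>Partial derivatives of a parameter-dependent operator\<close>

definition D_u ::
  "(real \<times> 'x::real_normed_vector \<Rightarrow> 'y::real_normed_vector) \<Rightarrow> real \<Rightarrow> 'x \<Rightarrow> ('x \<Rightarrow>\<^sub>L 'y)" where
  "D_u F l u = Blinfun (frechet_derivative (\<lambda>v. F (l, v)) (at u))"

definition D_l ::
  "(real \<times> 'x::real_normed_vector \<Rightarrow> 'y::real_normed_vector) \<Rightarrow> real \<Rightarrow> 'x \<Rightarrow> 'y" where
  "D_l F l u = vector_derivative (\<lambda>t. F (t, u)) (at l)"

definition D_lu ::
  "(real \<times> 'x::real_normed_vector \<Rightarrow> 'y::real_normed_vector) \<Rightarrow> real \<Rightarrow> 'x \<Rightarrow> ('x \<Rightarrow>\<^sub>L 'y)" where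
  "D_lu F l u = vector_derivative (\<lambda>t. D_u F t u) (at l)"

definition D_uu ::
  "(real \<times> 'x::real_normed_vector \<Rightarrow> 'y::real_normed_vector) \<Rightarrow> real \<Rightarrow> 'x \<Rightarrow> ('x \<Rightarrow>\<^sub>L 'x \<Rightarrow>\<^sub>L 'y)" where
  "D_uu F l u = Blinfun (frechet_derivative (\<lambda>v. D_u F l v) (at u))"

section \<open>The extended system\<close>

definition extended_system ::
  "(real \<times> 'x::real_normed_vector \<Rightarrow> 'y::real_normed_vector) \<Rightarrow> ('x \<Rightarrow>\<^sub>L real) \<Rightarrow>
     real \<times> 'x \<times> 'x \<Rightarrow> real \<times> 'y \<times> 'y" where
  "extended_system F ell = (\<lambda>(l, u, \<phi>).
     (blinfun_apply ell \<phi> - 1, F (l, u), blinfun_apply (D_u F l u) \<phi>))"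

abbreviation ext_space :: "'a set \<Rightarrow> (real \<times> 'a \<times> 'a) set" where
  "ext_space S \<equiv> UNIV \<times> S \<times> UNIV"

section \<open>Symmetry-breaking bifurcation points\<close>

definition SB1 ::
  "(real \<times> 'x::banach \<Rightarrow> 'y::banach) \<Rightarrow> real \<Rightarrow> 'x \<Rightarrow> 'x \<Rightarrow> bool" where
  "SB1 F l0 u0 \<phi>0 \<longleftrightarrow>
     F (l0, u0) = 0 \<and>
     fredholm_with_index UNIV UNIV (D_u F l0 u0) 0 \<and>
     {v. blinfun_apply (D_u F l0 u0) v = 0} = span {\<phi>0} \<and> \<phi>0 \<noteq> 0 \<and>
     (\<exists>\<psi> :: 'y \<Rightarrow>\<^sub>L real. \<psi> \<noteq> 0 \<and>
        range (blinfun_apply (D_u F l0 u0)) = {y. blinfun_apply \<psi> y = 0})"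

definition SB2 ::
  "(real \<times> 'x::banach \<Rightarrow> 'y::banach) \<Rightarrow> 'x set \<Rightarrow> 'y set \<Rightarrow> real \<Rightarrow> 'x \<Rightarrow> 'x \<Rightarrow> bool" where
  "SB2 F Xsym Ysym l0 u0 \<phi>0 \<longleftrightarrow>
     subspace Xsym \<and> closed Xsym \<and> subspace Ysym \<and> closed Ysym \<and>
     (\<forall>l. \<forall>u\<in>Xsym. F (l, u) \<in> Ysym) \<and>
     fredholm_with_index Xsym Ysym (D_u F l0 u0) 0 \<and>
     u0 \<in> Xsym \<and> \<phi>0 \<notin> Xsym"

definition SB3 ::
  "(real \<times> 'x::banach \<Rightarrow> 'y::banach) \<Rightarrow> 'x set \<Rightarrow> real \<Rightarrow> 'x \<Rightarrow> 'x \<Rightarrow> bool" where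
  "SB3 F Xsym l0 u0 \<phi>0 \<longleftrightarrow>
     (\<exists>\<xi>0.
        (\<forall>\<xi>. \<xi> \<in> Xsym \<and> blinfun_apply (D_u F l0 u0) \<xi> + D_l F l0 u0 = 0 \<longleftrightarrow> \<xi> = \<xi>0) \<and>
        blinfun_apply (D_lu F l0 u0) \<phi>0
          + blinfun_apply (blinfun_apply (D_uu F l0 u0) \<phi>0) \<xi>0
          \<notin> range (blinfun_apply (D_u F l0 u0)))"

definition SB ::
  "(real \<times> 'x::banach \<Rightarrow> 'y::banach) \<Rightarrow> 'x set \<Rightarrow> 'y set \<Rightarrow> real \<Rightarrow> 'x \<Rightarrow> 'x \<Rightarrow> bool" where
  "SB F Xsym Ysym l0 u0 \<phi>0 \<longleftrightarrow>
     SB1 F l0 u0 \<phi>0 \<and> SB2 F Xsym Ysym l0 u0 \<phi>0 \<and> SB3 F Xsym l0 u0 \<phi>0"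

text \<open>Near \<open>(l0, u0)\<close> the solutions of \<open>F (l, u) = 0\<close> are exactly the points of the smooth branch
  \<open>l \<mapsto> (l, p l)\<close> in \<open>Xsym\<close> and of the smooth branch \<open>a \<mapsto> (h a, u a)\<close>. The second branch is a regular
  curve: without nonvanishing velocity, the substitution \<open>a \<mapsto> a\<^sup>3\<close> would always give \<open>h' 0 = 0\<close>.
  Since all statements are local, ``not contained in \<open>Xsym\<close>'' is required arbitrarily close to
  \<open>a = 0\<close>.\<close>

definition solution_branches ::
  "(real \<times> 'x::banach \<Rightarrow> 'y::banach) \<Rightarrow> 'x set \<Rightarrow> real \<Rightarrow> 'x \<Rightarrow>
     (real \<Rightarrow> 'x) \<Rightarrow> (real \<Rightarrow> real) \<Rightarrow> (real \<Rightarrow> 'x) \<Rightarrow> bool" where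
  "solution_branches F Xsym l0 u0 p h u \<longleftrightarrow> (\<exists>\<delta>>0.
     smooth_on {l0 - \<delta><..<l0 + \<delta>} p \<and> p l0 = u0 \<and>
     (\<forall>l\<in>{l0 - \<delta><..<l0 + \<delta>}. p l \<in> Xsym \<and> F (l, p l) = 0) \<and>
     smooth_on {-\<delta><..<\<delta>} h \<and> h 0 = l0 \<and>
     smooth_on {-\<delta><..<\<delta>} u \<and> u 0 = u0 \<and>
     (\<forall>a\<in>{-\<delta><..<\<delta>}. F (h a, u a) = 0 \<and> vector_derivative (\<lambda>a. (h a, u a)) (at a) \<noteq> 0) \<and>
     (\<exists>\<^sub>F a in at 0. u a \<notin> Xsym) \<and>
     (\<exists>U. open U \<and> (l0, u0) \<in> U \<and>
        {z \<in> U. F z = 0} =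
        U \<inter> ((\<lambda>l. (l, p l)) ` {l0 - \<delta><..<l0 + \<delta>} \<union> (\<lambda>a. (h a, u a)) ` {-\<delta><..<\<delta>})))"

definition transcritical_bifurcation ::
  "(real \<times> 'x::banach \<Rightarrow> 'y::banach) \<Rightarrow> 'x set \<Rightarrow> 'y set \<Rightarrow> real \<Rightarrow> 'x \<Rightarrow> 'x \<Rightarrow> bool" where
  "transcritical_bifurcation F Xsym Ysym l0 u0 \<phi>0 \<longleftrightarrow>
     SB F Xsym Ysym l0 u0 \<phi>0 \<and>
     (\<exists>p h u. solution_branches F Xsym l0 u0 p h u \<and> deriv h 0 \<noteq> 0)"

definition pitchfork_bifurcation ::
  "(real \<times> 'x::banach \<Rightarrow> 'y::banach) \<Rightarrow> 'x set \<Rightarrow> 'y set \<Rightarrow> real \<Rightarrow> 'x \<Rightarrow> 'x \<Rightarrow> bool" where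
  "pitchfork_bifurcation F Xsym Ysym l0 u0 \<phi>0 \<longleftrightarrow>
     SB F Xsym Ysym l0 u0 \<phi>0 \<and>
     (\<exists>p h u. solution_branches F Xsym l0 u0 p h u \<and> deriv h 0 = 0)"

end

theory Submission
  imports Defs
begin

text \<open>Let \<open>ell \<phi>\<^sub>0 = 1\<close>. The linearised extended system at \<open>(\<lambda>\<^sub>0, u\<^sub>0, \<phi>\<^sub>0)\<close> maps \<open>(\<mu>, v, \<eta>)\<close> to
  \<open>(ell \<eta>, \<mu> D\<^sub>\<lambda>F + L v, \<mu> D\<^sub>\<lambda>\<^sub>uF \<phi>\<^sub>0 + D\<^sub>u\<^sub>uF[\<phi>\<^sub>0, v] + L \<eta>)\<close>. Since \<open>L\<close> is bijective between the
  symmetric subspaces, one may substitute \<open>v = v' + \<mu> \<xi>\<^sub>0\<close>, which makes the system triangular: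
  \<open>L v'\<close> determines \<open>v'\<close>, the functional \<open>\<psi>\<^sub>0\<close> applied to the third component determines \<open>\<mu>\<close>
  precisely because of the nondegeneracy condition, and then \<open>\<eta>\<close> is determined by \<open>L \<eta>\<close> up to a
  multiple of \<open>\<phi>\<^sub>0\<close>, which \<open>ell \<eta>\<close> fixes.

  The branches come from two applications of the implicit function theorem. The symmetric branch
  solves \<open>F = 0\<close> in \<open>Xsym\<close>. For the other one, replace \<open>D\<^sub>uF(\<lambda>, u)[\<phi>]\<close> in the extended system by
  the difference quotient \<open>(F(\<lambda>, u + \<alpha> \<phi>) - F(\<lambda>, u)) / \<alpha>\<close>, which is smooth up to \<open>\<alpha> = 0\<close> where it
  gives back the extended system. The nondegenerate zero at \<open>\<alpha> = 0\<close> continues to a curve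
  \<open>(\<lambda>, u, \<phi>)(\<alpha>)\<close>, along which both \<open>u\<close> and \<open>u + \<alpha> \<phi>\<close> are solutions. Conversely the difference of
  two solutions near \<open>(\<lambda>\<^sub>0, u\<^sub>0)\<close> for the same parameter is nearly parallel to \<open>\<phi>\<^sub>0\<close>, so that the
  uniqueness part of the implicit function theorem shows that there are no further solutions.\<close>
section \<open>Isomorphisms between closed subspaces\<close>

text \<open>\<open>Xsym\<close> and \<open>Ysym\<close> are closed subspaces without an assumed
  complement, so no projection onto them is available and an inverse lives on the subspace only.
  Isomorphisms are therefore handled through surjectivity onto \<open>W\<close> and a lower bound on
  \<open>V\<close>, and implicit curves are constructed inside a subspace. Both branches depend on
  one real variable, so their smoothness can be obtained by calculus along curves: the velocity of
  an implicit curve solves a linear equation whose coefficients are as regular as the curve, and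
  regularity rises order by order.

  Off \<open>Xsym\<close> the implicit function theorem does not apply to \<open>F\<close> itself,
  since the linearisation annihilates \<open>\<phi>0\<close>. Pairing a symmetric solution with a
  second one for the same parameter, normalising the direction by \<open>ell\<close> and dividing by
  \<alpha> removes the trivial coincidence of the two. At \<alpha> = 0 the partial derivative in the
  remaining unknowns is that of the extended system, so its invertibility is exactly what
  continuation requires. Since the symmetric partner has a velocity in \<open>Xsym\<close> and
  \<open>\<phi>0\<close> lies outside, the second branch is regular and leaves
  \<open>Xsym\<close>.\<close>

lemma closed_cover_interior:
  fixes V :: "'a::metric_space set" and A :: "nat \<Rightarrow> 'a set"
  assumes "complete V" "V \<noteq> {}" "\<And>n. closed (A n)" "V \<subseteq> (\<Union>n. A n)"
  obtains n x r where "x \<in> V" "0 < r" "V \<inter> ball x r \<subseteq> A n"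
proof -
  \<comment> \<open>Baire's theorem is applied to \<open>V\<close> as a metric space of its own: a
    proper closed subspace has empty interior in the surrounding space, so only relative interiors
    are of use.\<close>
  interpret S: Submetric UNIV dist V
    by unfold_locales simp
  have top: "S.sub.mtopology = top_of_set V"
    using S.mtopology_submetric by simp
  have mc: "S.sub.mcomplete"
    unfolding S.sub.mcomplete_def
  proof (intro allI impI)
    fix \<sigma> assume "S.sub.MCauchy \<sigma>"
    then have \<sigma>: "range \<sigma> \<subseteq> V" "Cauchy \<sigma>"
      by (auto simp: S.sub.MCauchy_def Cauchy_def)
    then obtain l where "l \<in> V" "\<sigma> \<longlonglongrightarrow> l"
      using assms(1) unfolding complete_def by (metis range_subsetD)
    then have "limitin S.sub.mtopology \<sigma> l sequentially"
      using \<sigma> by (simp add: top limitin_subtopology image_subset_iff)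
    then show "\<exists>l. limitin S.sub.mtopology \<sigma> l sequentially" ..
  qed
  have "\<exists>n. S.sub.mtopology interior_of (V \<inter> A n) \<noteq> {}"
  proof (rule ccontr)
    assume *: "\<not> ?thesis"
    have "S.sub.mtopology interior_of (\<Union>(range (\<lambda>n. V \<inter> A n))) = {}"
      by (rule S.sub.metric_Baire_category_alt[OF mc])
        (use * assms(3) in \<open>auto simp: top closedin_closed\<close>)
    moreover have "\<Union>(range (\<lambda>n. V \<inter> A n)) = V"
      using assms(4) by auto
    ultimately show False
      using assms(2) interior_of_topspace[of "S.sub.mtopology"] by simp
  qed
  then obtain n x where "x \<in> top_of_set V interior_of (V \<inter> A n)"
    unfolding top by auto
  then obtain T where T: "openin (top_of_set V) T" "x \<in> T" "T \<subseteq> V \<inter> A n"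
    unfolding interior_of_def by auto
  then obtain r where "0 < r" "ball x r \<inter> V \<subseteq> T" "x \<in> V"
    by (metis openin_contains_ball openin_imp_subset subsetD)
  with T show thesis
    by (intro that[of x r n]) auto
qed

lemma le_half_power:
  fixes a :: "nat \<Rightarrow> real"
  assumes "\<And>n. a (Suc n) \<le> a n / 2"
  shows "a n \<le> a 0 * (1/2) ^ n"
proof (induction n)
  case (Suc n)
  then show ?case using assms[of n] by simp
qed simp

text \<open>By Baire some closure of the image of a bounded part of \<open>V\<close> contains a
  relative ball of \<open>W\<close>. Subtracting approximate preimages of \<open>w0 + w\<close> and
  of \<open>w0\<close> moves the centre of that ball to the origin, and homogeneity extends the
  bound to all of \<open>W\<close>.\<close>

lemma open_mapping_approx:
  fixes T :: "'a::real_normed_vector \<Rightarrow> 'b::banach"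
  assumes T: "bounded_linear T" and V: "subspace V"
    and W: "subspace W" "closed W" and onto: "T ` V = W"
  obtains C where "0 \<le> C"
    "\<And>w e. w \<in> W \<Longrightarrow> 0 < e \<Longrightarrow> \<exists>v\<in>V. norm (T v - w) \<le> e \<and> norm v \<le> C * norm w"
proof -
  interpret T: bounded_linear T by fact
  define A where "A n = closure (T ` (V \<inter> cball 0 (real n)))" for n
  have "W \<subseteq> (\<Union>n. A n)"
  proof
    fix w assume "w \<in> W"
    then obtain v where v: "v \<in> V" "w = T v" using onto by auto
    obtain n where "norm v \<le> real n" using real_arch_simple by blast
    then have "w \<in> A n" using v closure_subset unfolding A_def by fastforce
    then show "w \<in> (\<Union>n. A n)" by auto
  qed
  moreover have "complete W" "W \<noteq> {}"
    using W subspace_0[OF W(1)] by (auto simp: complete_eq_closed)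
  moreover have "closed (A n)" for n by (simp add: A_def)
  ultimately obtain n w0 r where w0: "w0 \<in> W" "0 < r" "W \<inter> ball w0 r \<subseteq> A n"
    by (rule_tac closed_cover_interior[of W A])
  have app: "\<exists>v\<in>V. norm (T v - w) < e \<and> norm v \<le> n" if "w \<in> A n" "0 < e" for w e
    using that unfolding A_def closure_approachable by (fastforce simp: dist_norm)
  have small: "\<exists>v\<in>V. norm (T v - w) \<le> e \<and> norm v \<le> 2 * n"
    if w: "w \<in> W" "norm w < r" and e: "0 < e" for w e
  proof -
    have "w0 + w \<in> A n" "w0 \<in> A n"
      using w0 w W by (auto simp: dist_norm subspace_add)
    then obtain a b where a: "a \<in> V" "norm (T a - (w0 + w)) < e/2" "norm a \<le> n"
      and b: "b \<in> V" "norm (T b - w0) < e/2" "norm b \<le> n"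
      using app[of _ "e/2"] e by (metis half_gt_zero)
    have "norm (T (a - b) - w) = norm ((T a - (w0 + w)) - (T b - w0))"
      by (simp add: T.diff algebra_simps)
    also have "\<dots> \<le> e" using a b norm_triangle_ineq4[of "T a - (w0 + w)" "T b - w0"] by linarith
    finally show ?thesis
      using a b norm_triangle_ineq4[of a b] V by (intro bexI[of _ "a - b"]) (auto simp: subspace_diff)
  qed
  show thesis
  proof (rule that[of "4 * n / r"])
    fix w e assume w: "w \<in> W" and e: "(0::real) < e"
    show "\<exists>v\<in>V. norm (T v - w) \<le> e \<and> norm v \<le> 4 * n / r * norm w"
    proof (cases "w = 0")
      case True
      then show ?thesis using V e T.zero by (intro bexI[of _ 0]) (auto simp: subspace_0)
    next
      case False
      \<comment> \<open>Scaling by \<open>c\<close> brings \<open>w\<close> to norm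
        \<open>r / 2\<close>, inside the ball. Scaling the preimage of norm at most
        \<open>2 * n\<close> back produces the constant \<open>4 * n / r\<close>.\<close>
      define c where "c = r / (2 * norm w)"
      have c: "c > 0" using False w0 by (simp add: c_def)
      have "norm (c *\<^sub>R w) < r" using False w0 by (simp add: c_def)
      then obtain v where v: "v \<in> V" "norm (T v - c *\<^sub>R w) \<le> c * e" "norm v \<le> 2 * n"
        using small[of "c *\<^sub>R w" "c * e"] w W c e by (auto simp: subspace_scale)
      have "T (v /\<^sub>R c) - w = (T v - c *\<^sub>R w) /\<^sub>R c"
        using c by (simp add: T.scaleR algebra_simps)
      then have "norm (T (v /\<^sub>R c) - w) = norm (T v - c *\<^sub>R w) / c"
        using c by (simp add: divide_inverse_commute)
      then have "norm (T (v /\<^sub>R c) - w) \<le> e"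
        using v c by (simp add: divide_le_eq mult.commute)
      moreover have "norm (v /\<^sub>R c) \<le> 4 * n / r * norm w"
        using v(3) c w0 False by (simp add: c_def field_simps)
      ultimately show ?thesis using v V by (intro bexI[of _ "v /\<^sub>R c"]) (auto simp: subspace_scale)
    qed
  qed (use w0 in auto)
qed

text \<open>Correcting by an approximate preimage halves the residual \<open>z n\<close> at each
  step. The corrections are dominated by a geometric series of ratio 1/2, which explains the
  constant \<open>2 * C\<close>. The sum exists by completeness, lies in \<open>V\<close> because
  \<open>V\<close> is closed, and is mapped to \<open>w\<close> because the images of its partial
  sums telescope to \<open>w - z n\<close>.\<close>

lemma open_mapping_closed_subspaces:
  fixes T :: "'a::banach \<Rightarrow> 'b::banach"
  assumes T: "bounded_linear T" and V: "subspace V" "closed V"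
    and W: "subspace W" "closed W" and onto: "T ` V = W"
  obtains K where "\<And>w. w \<in> W \<Longrightarrow> \<exists>v\<in>V. T v = w \<and> norm v \<le> K * norm w"
proof -
  interpret T: bounded_linear T by fact
  obtain C where C: "0 \<le> C"
    "\<And>w e. w \<in> W \<Longrightarrow> 0 < e \<Longrightarrow> \<exists>v\<in>V. norm (T v - w) \<le> e \<and> norm v \<le> C * norm w"
    using open_mapping_approx[OF T V(1) W onto] by blast
  have "\<exists>v\<in>V. norm (T v - w) \<le> norm w / 2 \<and> norm v \<le> C * norm w" if "w \<in> W" for w
  proof (cases "w = 0")
    case True
    then show ?thesis using V T.zero by (intro bexI[of _ 0]) (auto simp: subspace_0)
  next
    case False
    then show ?thesis using C(2)[OF that, of "norm w / 2"] by auto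
  qed
  then obtain g where g: "\<And>w. w \<in> W \<Longrightarrow> g w \<in> V"
    "\<And>w. w \<in> W \<Longrightarrow> norm (T (g w) - w) \<le> norm w / 2"
    "\<And>w. w \<in> W \<Longrightarrow> norm (g w) \<le> C * norm w"
    by metis
  show thesis
  proof (rule that[of "2 * C"])
    fix w assume w: "w \<in> W"
    define z where "z n = ((\<lambda>w. w - T (g w)) ^^ n) w" for n
    have z0: "z 0 = w" and zS: "z (Suc n) = z n - T (g (z n))" for n
      by (auto simp: z_def)
    have zW: "z n \<in> W" for n
      by (induction n) (use w g onto W in \<open>auto simp: z0 zS subspace_diff\<close>)
    have zn: "norm (z n) \<le> norm w * (1/2) ^ n" for n
      using le_half_power[of "\<lambda>n. norm (z n)" n] g(2)[OF zW]
      by (simp add: z0 zS norm_minus_commute)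
    have gn: "norm (g (z n)) \<le> C * norm w * (1/2) ^ n" for n
      using order_trans[OF g(3)[OF zW] mult_left_mono[OF zn C(1)]] by (simp add: mult.assoc)
    have sm: "summable (\<lambda>n. C * norm w * (1/2) ^ n)"
      by (intro summable_mult summable_geometric) simp
    have s: "summable (\<lambda>n. norm (g (z n)))"
      by (rule summable_comparison_test[OF _ sm]) (use gn in auto)
    then have su: "summable (\<lambda>n. g (z n))" by (rule summable_norm_cancel)
    define v where "v = (\<Sum>n. g (z n))"
    have sums: "(\<lambda>n. g (z n)) sums v"
      using su by (simp add: v_def summable_sums)
    have part: "(\<Sum>i<n. T (g (z i))) = w - z n" for n
      by (induction n) (auto simp: z0 zS)
    have "z \<longlonglongrightarrow> 0"
      by (rule Lim_null_comparison[of _ "\<lambda>n. norm w * (1/2) ^ n"])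
        (use zn in \<open>auto intro!: tendsto_mult_right_zero LIMSEQ_power_zero\<close>)
    then have "(\<lambda>n. w - z n) \<longlonglongrightarrow> w - 0" by (intro tendsto_intros)
    then have "(\<lambda>n. T (g (z n))) sums w"
      unfolding sums_def part by simp
    moreover have "(\<lambda>n. T (g (z n))) sums T v"
      by (rule T.sums[OF sums])
    ultimately have "T v = w" by (rule sums_unique2[symmetric])
    moreover have "v \<in> V"
      by (rule closed_sequentially[OF V(2) _ sums[unfolded sums_def]])
        (use V g zW in \<open>auto intro!: subspace_sum\<close>)
    moreover have "norm v \<le> 2 * C * norm w"
    proof -
      have "norm v \<le> (\<Sum>n. norm (g (z n)))"
        unfolding v_def by (rule summable_norm[OF s])
      also have "\<dots> \<le> (\<Sum>n. C * norm w * (1/2) ^ n)"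
        by (rule suminf_le[OF gn s sm])
      also have "\<dots> = 2 * C * norm w"
        by (subst suminf_mult) (simp_all add: suminf_geometric)
      finally show ?thesis .
    qed
    ultimately show "\<exists>v\<in>V. T v = w \<and> norm v \<le> 2 * C * norm w" by auto
  qed
qed

text \<open>A lower bound on \<open>V\<close> takes the place of a bound for an inverse: it can be
  tested on any vector of \<open>V\<close> and survives small perturbations. For linear
  \<open>T\<close> it contains injectivity. The sign of \<open>K\<close> permits division by it when
  radii are chosen.\<close>

definition isomorphism_between ::
  "'a::real_normed_vector set \<Rightarrow> 'b::real_normed_vector set \<Rightarrow> ('a \<Rightarrow> 'b) \<Rightarrow> real \<Rightarrow> bool" where
  "isomorphism_between V W T K \<longleftrightarrow> T ` V = W \<and> 0 < K \<and> (\<forall>v\<in>V. norm v \<le> K * norm (T v))"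

lemma isomorphism_between_inj_on:
  assumes "linear T" "subspace V" "isomorphism_between V W T K"
  shows "inj_on T V"
proof (rule inj_onI)
  fix x y assume "x \<in> V" "y \<in> V" "T x = T y"
  then have "norm (x - y) \<le> K * norm (T (x - y))"
    using assms(2,3) subspace_diff unfolding isomorphism_between_def by blast
  moreover have "T (x - y) = 0"
    using \<open>T x = T y\<close> assms(1) by (simp add: linear_diff)
  ultimately show "x = y" by simp
qed

lemma bijective_imp_isomorphism_between:
  fixes T :: "'a::banach \<Rightarrow> 'b::banach"
  assumes "bounded_linear T" "subspace V" "closed V" "subspace W" "closed W" "bij_betw T V W"
  obtains K where "isomorphism_between V W T K"
proof -
  have onto: "T ` V = W" using assms(6) by (simp add: bij_betw_def)
  obtain K where K: "\<And>w. w \<in> W \<Longrightarrow> \<exists>v\<in>V. T v = w \<and> norm v \<le> K * norm w"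
    using open_mapping_closed_subspaces[OF assms(1-5) onto] by blast
  have "norm v \<le> max K 1 * norm (T v)" if "v \<in> V" for v
  proof -
    have "T v \<in> W" using onto that by auto
    from K[OF this] obtain v' where v': "v' \<in> V" "T v' = T v" "norm v' \<le> K * norm (T v)"
      by auto
    then have "v' = v" using assms(6) that by (auto simp: bij_betw_def inj_on_def)
    with v'(3) have "norm v \<le> K * norm (T v)" by simp
    also have "\<dots> \<le> max K 1 * norm (T v)" by (rule mult_right_mono) auto
    finally show ?thesis .
  qed
  then show thesis using onto by (intro that[of "max K 1"]) (auto simp: isomorphism_between_def)
qed

lemma invertible_between_iff_isomorphism:
  assumes "linear T" "subspace V"
  shows "invertible_between V W T \<longleftrightarrow> (\<exists>K. isomorphism_between V W T K)"
proof
  assume "invertible_between V W T"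
  then obtain K where b: "bij_betw T V W" and K: "\<And>w. w \<in> W \<Longrightarrow> norm (inv_into V T w) \<le> K * norm w"
    unfolding invertible_between_def by auto
  have "norm v \<le> max K 1 * norm (T v)" if "v \<in> V" for v
  proof -
    have "norm v \<le> K * norm (T v)"
      using K[of "T v"] that b by (auto simp: bij_betw_def)
    also have "\<dots> \<le> max K 1 * norm (T v)" by (rule mult_right_mono) auto
    finally show ?thesis .
  qed
  then show "\<exists>K. isomorphism_between V W T K"
    using b by (intro exI[of _ "max K 1"]) (auto simp: isomorphism_between_def bij_betw_def)
next
  assume "\<exists>K. isomorphism_between V W T K"
  then obtain K where K: "isomorphism_between V W T K" by auto
  then have "bij_betw T V W"
    using isomorphism_between_inj_on[OF assms K] by (simp add: bij_betw_def isomorphism_between_def)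
  moreover have "norm (inv_into V T w) \<le> K * norm w" if "w \<in> W" for w
    using K that by (metis f_inv_into_f inv_into_into isomorphism_between_def)
  ultimately show "invertible_between V W T" unfolding invertible_between_def by auto
qed

text \<open>Banach's fixed point theorem for \<open>x \<mapsto> x - T\<^sup>-\<^sup>1 (G x)\<close>.\<close>

lemma near_isomorphism_zero:
  fixes T :: "'a::banach \<Rightarrow> 'b::real_normed_vector"
  assumes T: "linear T" and V: "subspace V" "closed V" and iso: "isomorphism_between V W T K"
    and e: "K * e \<le> 1/2" and x0: "x0 \<in> V"
    and GW: "\<And>x. x \<in> V \<Longrightarrow> x \<in> cball x0 \<rho> \<Longrightarrow> G x \<in> W"
    and G: "\<And>x y. x \<in> V \<Longrightarrow> y \<in> V \<Longrightarrow> x \<in> cball x0 \<rho> \<Longrightarrow> y \<in> cball x0 \<rho> \<Longrightarrow>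
       norm (G x - G y - T (x - y)) \<le> e * norm (x - y)"
    and small: "2 * K * norm (G x0) \<le> \<rho>"
  shows "\<exists>x\<in>V \<inter> cball x0 \<rho>. G x = 0"
proof -
  have K: "K > 0" and onto: "T ` V = W" and lo: "\<And>v. v \<in> V \<Longrightarrow> norm v \<le> K * norm (T v)"
    using iso by (auto simp: isomorphism_between_def)
  have "0 \<le> 2 * K * norm (G x0)" using K by simp
  then have \<rho>: "\<rho> \<ge> 0" using small by linarith
  define R where "R w = inv_into V T w" for w
  have R: "R w \<in> V" "T (R w) = w" if "w \<in> W" for w
    using that onto by (auto simp: R_def inv_into_into f_inv_into_f)
  define g where "g x = x - R (G x)" for x
  have gV: "g x \<in> V" if "x \<in> V" "x \<in> cball x0 \<rho>" for x
    using that GW R V by (simp add: g_def subspace_diff)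
  have contr: "norm (g x - g y) \<le> 1/2 * norm (x - y)"
    if "x \<in> V" "y \<in> V" "x \<in> cball x0 \<rho>" "y \<in> cball x0 \<rho>" for x y
  proof -
    have "T (g x - g y) = T (x - y) - (G x - G y)"
      using R GW that T by (simp add: g_def linear_diff)
    then have "norm (T (g x - g y)) \<le> e * norm (x - y)"
      using G[OF that] by (simp add: norm_minus_commute)
    then have "norm (g x - g y) \<le> K * (e * norm (x - y))"
      using lo[of "g x - g y"] gV that V K mult_left_mono[of "norm (T (g x - g y))" "e * norm (x - y)" K]
      by (auto simp: subspace_diff intro: order_trans)
    also have "\<dots> \<le> 1/2 * norm (x - y)"
      using mult_right_mono[OF e, of "norm (x - y)"] by (simp add: mult.assoc)
    finally show ?thesis .
  qed
  have x0c: "x0 \<in> cball x0 \<rho>" using \<rho> by simp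
  \<comment> \<open>The first iterate uses up one half of the radius and the contraction factor 1/2
    the other half, so \<open>g\<close> maps the ball into itself. This is the origin of the factor
    2 in the smallness condition.\<close>
  have g0: "norm (g x0 - x0) \<le> \<rho> / 2"
  proof -
    have "norm (R (G x0)) \<le> K * norm (G x0)"
      using lo R GW[OF x0 x0c] by metis
    then show ?thesis using small by (simp add: g_def)
  qed
  have "\<exists>!x\<in>V \<inter> cball x0 \<rho>. g x = x"
  proof (rule Banach_fix[where c="1/2"])
    show "complete (V \<inter> cball x0 \<rho>)" using V by (simp add: complete_eq_closed closed_Int)
    show "V \<inter> cball x0 \<rho> \<noteq> {}" using x0 x0c by auto
    show "g ` (V \<inter> cball x0 \<rho>) \<subseteq> V \<inter> cball x0 \<rho>"
    proof safe
      fix x assume x: "x \<in> V" "x \<in> cball x0 \<rho>"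
      show "g x \<in> V" using gV x by simp
      have "norm (g x - x0) \<le> norm (g x - g x0) + norm (g x0 - x0)"
        using norm_triangle_ineq[of "g x - g x0" "g x0 - x0"] by simp
      also have "\<dots> \<le> 1/2 * norm (x - x0) + \<rho> / 2" using contr[OF x(1) x0 x(2) x0c] g0 by linarith
      also have "\<dots> \<le> \<rho>" using x by (simp add: dist_norm norm_minus_commute)
      finally show "g x \<in> cball x0 \<rho>" by (simp add: dist_norm norm_minus_commute)
    qed
  qed (use contr in \<open>auto simp: dist_norm\<close>)
  then obtain x where x: "x \<in> V" "x \<in> cball x0 \<rho>" "g x = x" by auto
  have "R (G x) = 0" using x(3) by (simp add: g_def)
  then have "G x = 0" using R(2)[OF GW[OF x(1,2)]] T by (simp add: linear_0)
  then show ?thesis using x by auto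
qed

text \<open>Surjectivity is the preceding fixed point argument for
  \<open>x \<mapsto> S x - w\<close>, started at 0. For the lower bound, the perturbation costs at
  most \<open>K * e * norm v\<close>, hence at most half of \<open>norm v\<close>; absorbing it
  doubles the constant.\<close>

lemma isomorphism_between_perturb:
  fixes T :: "'a::banach \<Rightarrow> 'b::real_normed_vector"
  assumes T: "linear T" and V: "subspace V" "closed V" and W: "subspace W"
    and iso: "isomorphism_between V W T K"
    and S: "linear S" "\<And>v. v \<in> V \<Longrightarrow> S v \<in> W"
    and e: "K * e \<le> 1/2" and ST: "\<And>v. norm (S v - T v) \<le> e * norm v"
  shows "isomorphism_between V W S (2 * K)"
proof -
  have K: "K > 0" and lo: "\<And>v. v \<in> V \<Longrightarrow> norm v \<le> K * norm (T v)"
    using iso by (auto simp: isomorphism_between_def)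
  have "w \<in> S ` V" if w: "w \<in> W" for w
  proof -
    have "\<exists>x\<in>V \<inter> cball 0 (2 * K * norm w). S x - w = 0"
    proof (rule near_isomorphism_zero[OF T V iso e])
      show "norm (S x - w - (S y - w) - T (x - y)) \<le> e * norm (x - y)" for x y
        using ST[of "x - y"] S(1) by (simp add: linear_diff)
    qed (use V S W w in \<open>auto simp: subspace_0 subspace_diff linear_0\<close>)
    then show ?thesis by auto
  qed
  moreover have "norm v \<le> 2 * K * norm (S v)" if v: "v \<in> V" for v
  proof -
    have "norm (T v) \<le> norm (S v) + e * norm v"
      using ST[of v] norm_triangle_ineq4[of "S v" "S v - T v"] by simp
    then have "norm v \<le> K * (norm (S v) + e * norm v)"
      using lo[OF v] K by (meson mult_le_cancel_left_pos order_trans)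
    also have "\<dots> = K * norm (S v) + (K * e) * norm v" by (simp add: algebra_simps)
    also have "\<dots> \<le> K * norm (S v) + 1/2 * norm v"
      using mult_right_mono[OF e, of "norm v"] by simp
    finally show ?thesis by simp
  qed
  ultimately show ?thesis using K S(2) unfolding isomorphism_between_def by auto
qed

section \<open>Smooth maps\<close>

text \<open>Global smoothness with the sequence of derivatives as an explicit argument, so that
  further sequences can be built from a given one.\<close>

definition jets :: "(nat \<Rightarrow> 'a::real_normed_vector \<Rightarrow> 'a list \<Rightarrow> 'b::real_normed_vector) \<Rightarrow> bool" where
  "jets d \<longleftrightarrow>
     (\<forall>n x. bounded_multilinear n (d n x)) \<and>
     (\<forall>n x. \<forall>e>0. \<exists>r>0. \<forall>h. norm h < r \<longrightarrow>
        (\<forall>vs. length vs = n \<longrightarrow>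
          norm (d n (x + h) vs - d n x vs - d (Suc n) x (h # vs))
            \<le> e * norm h * (\<Prod>v\<leftarrow>vs. norm v)))"

lemma smooth_on_UNIV_iff_jets: "smooth_on UNIV f \<longleftrightarrow> (\<exists>d. jets d \<and> (\<forall>x. d 0 x [] = f x))"
  unfolding smooth_on_def jets_def by auto

lemma jets_remainder:
  assumes "jets d" "0 < e"
  obtains r where "r > 0" "\<And>h vs. norm h < r \<Longrightarrow> length vs = n \<Longrightarrow>
    norm (d n (x + h) vs - d n x vs - d (Suc n) x (h # vs)) \<le> e * norm h * (\<Prod>v\<leftarrow>vs. norm v)"
proof -
  have "\<exists>r>0. \<forall>h. norm h < r \<longrightarrow> (\<forall>vs. length vs = n \<longrightarrow>
      norm (d n (x + h) vs - d n x vs - d (Suc n) x (h # vs)) \<le> e * norm h * (\<Prod>v\<leftarrow>vs. norm v))"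
    using assms unfolding jets_def by simp
  then show thesis using that by auto
qed

lemma bounded_multilinear_linear:
  "bounded_multilinear n m \<Longrightarrow> length vs = n \<Longrightarrow> i < n \<Longrightarrow> linear (\<lambda>v. m (vs[i := v]))"
  by (auto simp: bounded_multilinear_def)

lemma prod_list_norm_nonneg: "0 \<le> (\<Prod>v\<leftarrow>vs. norm v)"
  by (induction vs) auto

lemma bounded_multilinear_bound:
  assumes "bounded_multilinear n m"
  obtains K where "0 \<le> K" "\<And>vs. length vs = n \<Longrightarrow> norm (m vs) \<le> K * (\<Prod>v\<leftarrow>vs. norm v)"
proof -
  obtain K where K: "\<And>vs. length vs = n \<Longrightarrow> norm (m vs) \<le> K * (\<Prod>v\<leftarrow>vs. norm v)"
    using assms by (auto simp: bounded_multilinear_def)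
  show thesis
    by (rule that[of "max K 0"], simp, rule order_trans[OF K])
      (auto intro: mult_right_mono prod_list_norm_nonneg)
qed

lemma bounded_multilinear_linear_head:
  assumes "bounded_multilinear (Suc n) m" "length vs = n"
  shows "linear (\<lambda>v. m (v # vs))"
  using bounded_multilinear_linear[OF assms(1), of "0 # vs" 0] assms(2) by simp

lemma bounded_multilinear_Cons:
  assumes "bounded_multilinear (Suc n) m"
  shows "bounded_multilinear n (\<lambda>vs. m (v # vs))"
  unfolding bounded_multilinear_def
proof (intro conjI allI impI)
  fix vs :: "'a list" and i assume "length vs = n \<and> i < n"
  then show "linear (\<lambda>w. m (v # vs[i := w]))"
    using bounded_multilinear_linear[OF assms, of "v # vs" "Suc i"] by simp
next
  obtain K where K: "\<And>vs. length vs = Suc n \<Longrightarrow> norm (m vs) \<le> K * (\<Prod>v\<leftarrow>vs. norm v)"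
    by (rule bounded_multilinear_bound[OF assms]) blast
  have "norm (m (v # vs)) \<le> K * norm v * (\<Prod>v\<leftarrow>vs. norm v)" if "length vs = n" for vs
    using K[of "v # vs"] that by (simp add: mult.assoc)
  then show "\<exists>K. \<forall>vs. length vs = n \<longrightarrow> norm (m (v # vs)) \<le> K * (\<Prod>v\<leftarrow>vs. norm v)"
    by blast
qed

lemma bounded_multilinear_bounded_linear_last:
  assumes "bounded_multilinear (Suc n) m" "length vs = n"
  shows "bounded_linear (\<lambda>v. m (vs @ [v]))"
proof -
  interpret linear "\<lambda>v. m (vs @ [v])"
    using bounded_multilinear_linear[OF assms(1), of "vs @ [0]" n] assms(2)
    by (simp add: list_update_append)
  obtain K where K: "\<And>vs. length vs = Suc n \<Longrightarrow> norm (m vs) \<le> K * (\<Prod>v\<leftarrow>vs. norm v)"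
    by (rule bounded_multilinear_bound[OF assms(1)]) blast
  have "norm (m (vs @ [v])) \<le> norm v * (K * (\<Prod>v\<leftarrow>vs. norm v))" for v
    using K[of "vs @ [v]"] assms(2) by (simp add: ac_simps)
  then show ?thesis by (intro bounded_linear_intro[where K="K * (\<Prod>v\<leftarrow>vs. norm v)"])
      (simp_all add: add scale)
qed

text \<open>The derivative becomes operator valued by splitting off the last slot. The head of the
  list stays free for the direction \<open>h\<close> of the next differentiation, so the remainder
  estimate for \<open>D n\<close> is that of \<open>d (Suc n)\<close> on the list
  \<open>vs @ [v]\<close>, read as an operator norm in \<open>v\<close>.\<close>

lemma jets_derivative:
  fixes d :: "nat \<Rightarrow> 'a::real_normed_vector \<Rightarrow> 'a list \<Rightarrow> 'b::real_normed_vector"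
  assumes d: "jets d"
  defines "D \<equiv> \<lambda>n x vs. Blinfun (\<lambda>v. d (Suc n) x (vs @ [v]))"
  shows "jets D" and "((\<lambda>x. d 0 x []) has_derivative blinfun_apply (D 0 x [])) (at x)"
proof -
  have m: "bounded_multilinear n (d n x)" for n x
    using d by (auto simp: jets_def)
  have app: "blinfun_apply (D n x vs) v = d (Suc n) x (vs @ [v])" if "length vs = n" for n x vs v
    unfolding D_def
    by (simp add: bounded_linear_Blinfun_apply[OF bounded_multilinear_bounded_linear_last[OF m that]])
  show "jets D"
    unfolding jets_def
  proof (intro conjI allI impI)
    fix n x
    show "bounded_multilinear n (D n x)"
      unfolding bounded_multilinear_def
    proof (intro conjI allI impI)
      fix vs :: "'a list" and i assume i: "length vs = n \<and> i < n"
      have lin: "linear (\<lambda>v. d (Suc n) x (vs[i := v] @ [w]))" for w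
        using bounded_multilinear_linear[OF m, of "vs @ [w]" "Suc n" i x] i
        by (simp add: list_update_append)
      show "linear (\<lambda>v. D n x (vs[i := v]))"
        by (rule linearI; rule blinfun_eqI)
          (use i linear_add[OF lin] linear_scale[OF lin] in
            \<open>simp_all add: app blinfun.add_left blinfun.scaleR_left\<close>)
    next
      obtain K where K: "0 \<le> K"
        "\<And>vs. length vs = Suc n \<Longrightarrow> norm (d (Suc n) x vs) \<le> K * (\<Prod>v\<leftarrow>vs. norm v)"
        by (rule bounded_multilinear_bound[OF m]) blast
      have "norm (D n x vs) \<le> K * (\<Prod>v\<leftarrow>vs. norm v)" if "length vs = n" for vs
      proof (rule norm_blinfun_bound)
        show "0 \<le> K * (\<Prod>v\<leftarrow>vs. norm v)"
          by (intro mult_nonneg_nonneg K(1) prod_list_norm_nonneg)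
      qed (use K(2)[of "vs @ [_]"] that in \<open>simp_all add: app mult.assoc\<close>)
      then show "\<exists>K. \<forall>vs. length vs = n \<longrightarrow> norm (D n x vs) \<le> K * (\<Prod>v\<leftarrow>vs. norm v)"
        by blast
    qed
  next
    fix n x and e :: real assume "0 < e"
    obtain r where r: "r > 0"
      "\<And>h vs. norm h < r \<Longrightarrow> length vs = Suc n \<Longrightarrow>
          norm (d (Suc n) (x + h) vs - d (Suc n) x vs - d (Suc (Suc n)) x (h # vs))
            \<le> e * norm h * (\<Prod>v\<leftarrow>vs. norm v)"
      by (rule jets_remainder[OF d \<open>0 < e\<close>, of "Suc n" x]) (rule that; assumption)
    have "norm (D n (x + h) vs - D n x vs - D (Suc n) x (h # vs)) \<le> e * norm h * (\<Prod>v\<leftarrow>vs. norm v)"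
      if "norm h < r" "length vs = n" for h vs
    proof (rule norm_blinfun_bound)
      fix v
      show "norm (blinfun_apply (D n (x + h) vs - D n x vs - D (Suc n) x (h # vs)) v)
         \<le> e * norm h * (\<Prod>v\<leftarrow>vs. norm v) * norm v"
        using r(2)[OF that(1), of "vs @ [v]"] that(2) by (simp add: app blinfun.diff_left mult.assoc)
    qed (use \<open>0 < e\<close> in \<open>auto intro!: mult_nonneg_nonneg prod_list_norm_nonneg\<close>)
    then show "\<exists>r>0. \<forall>h. norm h < r \<longrightarrow> (\<forall>vs. length vs = n \<longrightarrow>
          norm (D n (x + h) vs - D n x vs - D (Suc n) x (h # vs)) \<le> e * norm h * (\<Prod>v\<leftarrow>vs. norm v))"
      using r(1) by blast
  qed
  show "((\<lambda>x. d 0 x []) has_derivative blinfun_apply (D 0 x [])) (at x)"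
    unfolding has_derivative_at_alt
  proof (intro conjI allI impI)
    fix e :: real assume "0 < e"
    obtain r where r: "r > 0" "\<And>h vs. norm h < r \<Longrightarrow> length vs = 0 \<Longrightarrow>
          norm (d 0 (x + h) vs - d 0 x vs - d (Suc 0) x (h # vs)) \<le> e * norm h * (\<Prod>v\<leftarrow>vs. norm v)"
      by (rule jets_remainder[OF d \<open>0 < e\<close>, of 0 x]) (rule that; assumption)
    then show "\<exists>r>0. \<forall>y. norm (y - x) < r \<longrightarrow>
        norm (d 0 y [] - d 0 x [] - blinfun_apply (D 0 x []) (y - x)) \<le> e * norm (y - x)"
      using r(2)[of "_ - x" "[]"] by (intro exI[of _ r]) (simp add: app)
  qed (rule blinfun.bounded_linear_right)
qed

lemma smooth_on_UNIV_derivative: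
  fixes f :: "'a::real_normed_vector \<Rightarrow> 'b::real_normed_vector"
  assumes "smooth_on UNIV f"
  obtains D :: "'a \<Rightarrow> 'a \<Rightarrow>\<^sub>L 'b"
    where "smooth_on UNIV D" "\<And>x. (f has_derivative blinfun_apply (D x)) (at x)"
proof -
  obtain d where d: "jets d" "\<And>x. d 0 x [] = f x"
    using assms unfolding smooth_on_UNIV_iff_jets by blast
  then have f: "f = (\<lambda>x. d 0 x [])" by auto
  show thesis
    by (rule that[of "\<lambda>x. Blinfun (\<lambda>v. d (Suc 0) x ([] @ [v]))"])
      (use jets_derivative[OF d(1)] in \<open>auto simp: f smooth_on_UNIV_iff_jets\<close>)
qed

lemma smooth_on_UNIV_continuous_on:
  assumes "smooth_on UNIV f" shows "continuous_on S f"
proof -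
  obtain D where "\<And>x. (f has_derivative blinfun_apply (D x)) (at x)"
    using smooth_on_UNIV_derivative[OF assms] by blast
  then show ?thesis
    by (intro continuous_at_imp_continuous_on) (auto dest: has_derivative_continuous)
qed

section \<open>Limits, product rule and chain rule for multilinear maps along curves\<close>

lemma tendsto_prod_list_norm:
  assumes "list_all2 (\<lambda>f l. (f \<longlongrightarrow> l) F) fs ls"
  shows "((\<lambda>s. \<Prod>f\<leftarrow>fs. norm (f s)) \<longlongrightarrow> (\<Prod>l\<leftarrow>ls. norm l)) F"
  using assms
proof induction
  case (Cons f fs l ls)
  then show ?case by (auto intro!: tendsto_intros)
qed simp

text \<open>One slot is exchanged at a time: the head is split into \<open>f s - l\<close> and
  \<open>l\<close>. The first part tends to zero by the norm bound, and the second leaves a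
  multilinear map with one slot less.\<close>

lemma bounded_multilinear_tendsto:
  fixes m :: "'a::real_normed_vector list \<Rightarrow> 'b::real_normed_vector"
  assumes "list_all2 (\<lambda>f l. (f \<longlongrightarrow> l) F) fs ls" "bounded_multilinear (length fs) m"
  shows "((\<lambda>s. m (map (\<lambda>f. f s) fs)) \<longlongrightarrow> m ls) F"
  using assms
proof (induction arbitrary: m)
  case (Cons f fs l ls)
  have lin: "linear (\<lambda>v. m (v # map (\<lambda>f. f s) fs))" for s
    by (rule bounded_multilinear_linear_head) (use Cons.prems in auto)
  have m': "bounded_multilinear (length fs) (\<lambda>vs. m (l # vs))"
    by (rule bounded_multilinear_Cons) (use Cons.prems in simp)
  obtain K where K: "\<And>vs. length vs = Suc (length fs) \<Longrightarrow> norm (m vs) \<le> K * (\<Prod>v\<leftarrow>vs. norm v)"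
    by (rule bounded_multilinear_bound[OF Cons.prems]) auto
  have lim: "((\<lambda>s. K * (norm (f s - l) * (\<Prod>f\<leftarrow>fs. norm (f s)))) \<longlongrightarrow> 0) F"
    using tendsto_mult[OF tendsto_const tendsto_mult[OF tendsto_norm[OF
        tendsto_diff[OF Cons.hyps(1) tendsto_const]] tendsto_prod_list_norm[OF Cons.hyps(2)]], of K l]
    by simp
  have bound: "norm (m ((f s - l) # map (\<lambda>f. f s) fs)) \<le>
      K * (norm (f s - l) * (\<Prod>f\<leftarrow>fs. norm (f s)))" for s
    using K[of "(f s - l) # map (\<lambda>f. f s) fs"] by (simp add: o_def)
  have "((\<lambda>s. m ((f s - l) # map (\<lambda>f. f s) fs)) \<longlongrightarrow> 0) F"
    by (rule Lim_null_comparison[OF always_eventually lim]) (rule allI, rule bound)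
  then have "((\<lambda>s. m ((f s - l) # map (\<lambda>f. f s) fs) + m (l # map (\<lambda>f. f s) fs)) \<longlongrightarrow>
     0 + m (l # ls)) F"
    by (intro tendsto_add Cons.IH m')
  then show ?case by (simp add: linear_diff[OF lin])
qed simp

text \<open>Difference quotients can be inserted into a slot of a multilinear map, so that product
  and chain rules reduce to statements about limits.\<close>

lemma has_vector_derivative_iff_quotient:
  "(f has_vector_derivative D) (at a) \<longleftrightarrow> ((\<lambda>s. (f s - f a) /\<^sub>R (s - a)) \<longlongrightarrow> D) (at a)"
proof -
  have "(f has_vector_derivative D) (at a) \<longleftrightarrow>
      ((\<lambda>s. norm ((1 / norm (s - a)) *\<^sub>R (f s - (f a + (s - a) *\<^sub>R D)))) \<longlongrightarrow> 0) (at a)"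
    unfolding has_vector_derivative_def has_derivative_within tendsto_norm_zero_iff
    by (auto intro: bounded_linear_scaleR_left)
  also have "\<dots> \<longleftrightarrow> ((\<lambda>s. norm ((f s - f a) /\<^sub>R (s - a) - D)) \<longlongrightarrow> 0) (at a)"
  proof (rule filterlim_cong[OF refl refl])
    have "norm ((1 / norm (s - a)) *\<^sub>R (f s - (f a + (s - a) *\<^sub>R D))) = norm ((f s - f a) /\<^sub>R (s - a) - D)"
      if "s \<noteq> a" for s
    proof -
      have "(f s - f a) /\<^sub>R (s - a) - D = (1 / (s - a)) *\<^sub>R (f s - (f a + (s - a) *\<^sub>R D))"
        using that
        by (simp add: scaleR_diff_right scaleR_add_right inverse_eq_divide del: scaleR_left_diff_distrib)
      then show ?thesis by simp
    qed
    then show "\<forall>\<^sub>F s in at a. norm ((1 / norm (s - a)) *\<^sub>R (f s - (f a + (s - a) *\<^sub>R D))) =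
        norm ((f s - f a) /\<^sub>R (s - a) - D)"
      by (auto simp: eventually_at_filter)
  qed
  finally show ?thesis
    by (simp add: tendsto_norm_zero_iff LIM_zero_iff)
qed

text \<open>The difference quotient splits into one term with the quotient of \<open>f\<close> in
  the head and moving tail, which converges by joint continuity, and one term with the head frozen
  at \<open>f a\<close>, to which the induction hypothesis applies.\<close>

lemma bounded_multilinear_has_vector_derivative:
  fixes m :: "'a::real_normed_vector list \<Rightarrow> 'b::real_normed_vector"
  assumes "list_all2 (\<lambda>f f'. (f has_vector_derivative f') (at a)) fs fs'"
    "bounded_multilinear (length fs) m"
  shows "((\<lambda>s. m (map (\<lambda>f. f s) fs)) has_vector_derivative
     (\<Sum>i<length fs. m ((map (\<lambda>f. f a) fs)[i := fs' ! i]))) (at a)"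
  using assms
proof (induction arbitrary: m)
  case (Cons f fs f' fs')
  let ?V = "\<lambda>s. map (\<lambda>f. f s) fs"
  have lin: "linear (\<lambda>v. m (v # ?V s))" for s
    by (rule bounded_multilinear_linear_head) (use Cons.prems in auto)
  have m': "bounded_multilinear (length fs) (\<lambda>vs. m (f a # vs))"
    by (rule bounded_multilinear_Cons) (use Cons.prems in simp)
  have cont: "list_all2 (\<lambda>f l. (f \<longlongrightarrow> l) (at a)) fs (?V a)"
    using Cons.hyps(2)
    by (auto simp: list_all2_conv_all_nth isCont_def[symmetric] has_vector_derivative_continuous)
  have "((\<lambda>s. m (((f s - f a) /\<^sub>R (s - a)) # ?V s)) \<longlongrightarrow> m (f' # ?V a)) (at a)"
    using bounded_multilinear_tendsto[of "at a" "(\<lambda>s. (f s - f a) /\<^sub>R (s - a)) # fs" "f' # ?V a" m]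
      Cons cont by (auto simp: has_vector_derivative_iff_quotient)
  moreover have "((\<lambda>s. (m (f a # ?V s) - m (f a # ?V a)) /\<^sub>R (s - a)) \<longlongrightarrow>
      (\<Sum>i<length fs. m (f a # (?V a)[i := fs' ! i]))) (at a)"
    using Cons.IH[OF m'] by (simp add: has_vector_derivative_iff_quotient)
  ultimately have "((\<lambda>s. m (((f s - f a) /\<^sub>R (s - a)) # ?V s) +
       (m (f a # ?V s) - m (f a # ?V a)) /\<^sub>R (s - a)) \<longlongrightarrow>
      m (f' # ?V a) + (\<Sum>i<length fs. m (f a # (?V a)[i := fs' ! i]))) (at a)"
    by (rule tendsto_add)
  moreover have "m (((f s - f a) /\<^sub>R (s - a)) # ?V s) + (m (f a # ?V s) - m (f a # ?V a)) /\<^sub>R (s - a) =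
      (m (f s # ?V s) - m (f a # ?V a)) /\<^sub>R (s - a)" for s
    by (simp only: linear_scale[OF lin] linear_diff[OF lin] scaleR_add_right[symmetric]) simp
  ultimately show ?case
    by (simp add: has_vector_derivative_iff_quotient sum.lessThan_Suc_shift del: sum.lessThan_Suc)
qed simp

text \<open>The remainder estimate of smoothness is uniform in the arguments up to the product of
  their norms. With tolerance 1 it already shows that moving the base point changes the value by the
  first-order term plus a vanishing error, and the first-order term vanishes in the limit because
  its head does.\<close>

lemma jets_tendsto:
  fixes d :: "nat \<Rightarrow> 'a::real_normed_vector \<Rightarrow> 'a list \<Rightarrow> 'b::real_normed_vector"
  assumes d: "jets d" and c: "(c \<longlongrightarrow> c0) F"
    and fs: "list_all2 (\<lambda>f l. (f \<longlongrightarrow> l) F) fs ls"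
  shows "((\<lambda>s. d (length fs) (c s) (map (\<lambda>f. f s) fs)) \<longlongrightarrow> d (length fs) c0 ls) F"
proof -
  let ?n = "length fs" and ?V = "\<lambda>s. map (\<lambda>f. f s) fs"
  have m: "bounded_multilinear n (d n x)" for n x using d by (auto simp: jets_def)
  have len: "length ls = ?n" using fs by (simp add: list_all2_lengthD)
  obtain r where r: "r > 0" "\<And>h vs. norm h < r \<Longrightarrow> length vs = ?n \<Longrightarrow>
      norm (d ?n (c0 + h) vs - d ?n c0 vs - d (Suc ?n) c0 (h # vs)) \<le> 1 * norm h * (\<Prod>v\<leftarrow>vs. norm v)"
    by (rule jets_remainder[OF d zero_less_one, of ?n c0]) (rule that; assumption)
  have c': "((\<lambda>s. c s - c0) \<longlongrightarrow> 0) F" using c by (rule LIM_zero)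
  have lim: "((\<lambda>s. norm (c s - c0) * (\<Prod>f\<leftarrow>fs. norm (f s))) \<longlongrightarrow> 0) F"
    using tendsto_mult[OF tendsto_norm[OF c'] tendsto_prod_list_norm[OF fs]] by simp
  have "\<forall>\<^sub>F s in F. norm (c s - c0) < r"
    using order_tendstoD(2)[OF tendsto_norm_zero[OF c'] r(1)] .
  then have bound: "\<forall>\<^sub>F s in F. norm (d ?n (c s) (?V s) - d ?n c0 (?V s) - d (Suc ?n) c0 ((c s - c0) # ?V s))
      \<le> norm (c s - c0) * (\<Prod>f\<leftarrow>fs. norm (f s))"
  proof eventually_elim
    case (elim s)
    then show ?case using r(2)[of "c s - c0" "?V s"] by (simp add: o_def)
  qed
  have "((\<lambda>s. d ?n (c s) (?V s) - d ?n c0 (?V s) - d (Suc ?n) c0 ((c s - c0) # ?V s)) \<longlongrightarrow> 0) F"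
    by (rule Lim_null_comparison[OF bound lim])
  moreover have "((\<lambda>s. d (Suc ?n) c0 ((c s - c0) # ?V s)) \<longlongrightarrow> d (Suc ?n) c0 (0 # ls)) F"
    using bounded_multilinear_tendsto[of F "(\<lambda>s. c s - c0) # fs" "0 # ls" "d (Suc ?n) c0"] m c' fs
    by simp
  moreover have "d (Suc ?n) c0 (0 # ls) = 0"
    using linear_0[OF bounded_multilinear_linear_head[OF m len, of c0]] by simp
  moreover have "((\<lambda>s. d ?n c0 (?V s)) \<longlongrightarrow> d ?n c0 ls) F"
    by (rule bounded_multilinear_tendsto[OF fs m])
  ultimately have "((\<lambda>s. (d ?n (c s) (?V s) - d ?n c0 (?V s) - d (Suc ?n) c0 ((c s - c0) # ?V s)) +
      d (Suc ?n) c0 ((c s - c0) # ?V s) + d ?n c0 (?V s)) \<longlongrightarrow> 0 + 0 + d ?n c0 ls) F"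
    by (intro tendsto_add) simp_all
  then show ?thesis by simp
qed

lemma jets_has_vector_derivative:
  fixes d :: "nat \<Rightarrow> 'a::real_normed_vector \<Rightarrow> 'a list \<Rightarrow> 'b::real_normed_vector"
  assumes d: "jets d" and c: "(c has_vector_derivative c') (at a)"
    and fs: "list_all2 (\<lambda>f f'. (f has_vector_derivative f') (at a)) fs fs'"
  shows "((\<lambda>s. d (length fs) (c s) (map (\<lambda>f. f s) fs)) has_vector_derivative
     d (Suc (length fs)) (c a) (c' # map (\<lambda>f. f a) fs) +
     (\<Sum>i<length fs. d (length fs) (c a) ((map (\<lambda>f. f a) fs)[i := fs' ! i]))) (at a)"
proof -
  let ?n = "length fs" and ?V = "\<lambda>s. map (\<lambda>f. f s) fs"
  have m: "bounded_multilinear n (d n x)" for n x using d by (auto simp: jets_def)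
  have cont: "list_all2 (\<lambda>f l. (f \<longlongrightarrow> l) (at a)) fs (?V a)"
    using fs by (auto simp: list_all2_conv_all_nth isCont_def[symmetric] has_vector_derivative_continuous)
  have lin: "linear (\<lambda>v. d (Suc ?n) (c a) (v # ?V s))" for s
    by (rule bounded_multilinear_linear_head[OF m]) simp
  let ?q = "\<lambda>s. (c s - c a) /\<^sub>R (s - a)"
  let ?R = "\<lambda>s. d ?n (c s) (?V s) - d ?n (c a) (?V s) - d (Suc ?n) (c a) ((c s - c a) # ?V s)"
  have q: "(?q \<longlongrightarrow> c') (at a)" using c by (simp add: has_vector_derivative_iff_quotient)
  have c0: "((\<lambda>s. c s - c a) \<longlongrightarrow> 0) (at a)"
    using has_vector_derivative_continuous[OF c] by (simp add: isCont_def LIM_zero)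
  \<comment> \<open>The remainder is at most its tolerance times the norm of the quotient of
    \<open>c\<close> and of the arguments. This product tends to \<open>B0\<close>, hence is
    eventually below \<open>B0 + 1\<close>, and the tolerance \<open>e / (B0 + 1)\<close> is
    enough.\<close>
  define B0 where "B0 = norm c' * (\<Prod>l\<leftarrow>?V a. norm l)"
  have B: "((\<lambda>s. norm (?q s) * (\<Prod>f\<leftarrow>fs. norm (f s))) \<longlongrightarrow> B0) (at a)"
    using tendsto_mult[OF tendsto_norm[OF q] tendsto_prod_list_norm[OF cont]] by (simp add: B0_def)
  have B0: "B0 \<ge> 0" unfolding B0_def by (intro mult_nonneg_nonneg norm_ge_zero prod_list_norm_nonneg)
  have "((\<lambda>s. ?R s /\<^sub>R (s - a)) \<longlongrightarrow> 0) (at a)"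
  proof (rule tendstoI)
    fix e :: real assume e: "0 < e"
    define e' where "e' = e / (B0 + 1)"
    have e': "e' > 0" using e B0 by (simp add: e'_def)
    obtain r where r: "r > 0" "\<And>h vs. norm h < r \<Longrightarrow> length vs = ?n \<Longrightarrow>
      norm (d ?n (c a + h) vs - d ?n (c a) vs - d (Suc ?n) (c a) (h # vs)) \<le> e' * norm h * (\<Prod>v\<leftarrow>vs. norm v)"
      by (rule jets_remainder[OF d e', of ?n "c a"]) (rule that; assumption)
    have "\<forall>\<^sub>F s in at a. norm (c s - c a) < r"
      using order_tendstoD(2)[OF tendsto_norm_zero[OF c0] r(1)] .
    moreover have "\<forall>\<^sub>F s in at a. norm (?q s) * (\<Prod>f\<leftarrow>fs. norm (f s)) < B0 + 1"
      by (rule order_tendstoD(2)[OF B]) simp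
    moreover have "\<forall>\<^sub>F s in at a. s \<noteq> a" by (simp add: eventually_at_filter)
    ultimately show "\<forall>\<^sub>F s in at a. dist (?R s /\<^sub>R (s - a)) 0 < e"
    proof eventually_elim
      case (elim s)
      have R: "norm (?R s) \<le> e' * norm (c s - c a) * (\<Prod>f\<leftarrow>fs. norm (f s))"
        using r(2)[of "c s - c a" "?V s"] elim(1) by (simp add: o_def)
      then have "norm (?R s /\<^sub>R (s - a)) \<le> e' * (norm (?q s) * (\<Prod>f\<leftarrow>fs. norm (f s)))"
        using mult_left_mono[OF R, of "\<bar>inverse (s - a)\<bar>"]
        by (simp only: norm_scaleR abs_ge_zero ac_simps simp_thms)
      also have "\<dots> < e' * (B0 + 1)" using elim(2) e' by simp
      also have "\<dots> = e" using B0 by (simp add: e'_def)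
      finally show ?case by simp
    qed
  qed
  moreover have "((\<lambda>s. d (Suc ?n) (c a) (?q s # ?V s)) \<longlongrightarrow> d (Suc ?n) (c a) (c' # ?V a)) (at a)"
    using bounded_multilinear_tendsto[of "at a" "?q # fs" "c' # ?V a" "d (Suc ?n) (c a)"] m q cont
    by simp
  moreover have "((\<lambda>s. (d ?n (c a) (?V s) - d ?n (c a) (?V a)) /\<^sub>R (s - a)) \<longlongrightarrow>
      (\<Sum>i<?n. d ?n (c a) ((?V a)[i := fs' ! i]))) (at a)"
    using bounded_multilinear_has_vector_derivative[OF fs m]
    by (simp add: has_vector_derivative_iff_quotient)
  ultimately have "((\<lambda>s. ?R s /\<^sub>R (s - a) + d (Suc ?n) (c a) (?q s # ?V s) +
      (d ?n (c a) (?V s) - d ?n (c a) (?V a)) /\<^sub>R (s - a)) \<longlongrightarrow>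
      0 + d (Suc ?n) (c a) (c' # ?V a) + (\<Sum>i<?n. d ?n (c a) ((?V a)[i := fs' ! i]))) (at a)"
    by (intro tendsto_add)
  moreover have "?R s /\<^sub>R (s - a) + d (Suc ?n) (c a) (?q s # ?V s) +
      (d ?n (c a) (?V s) - d ?n (c a) (?V a)) /\<^sub>R (s - a) =
      (d ?n (c s) (?V s) - d ?n (c a) (?V a)) /\<^sub>R (s - a)" for s
    by (simp only: linear_scale[OF lin] scaleR_add_right[symmetric]) simp
  ultimately show ?thesis
    by (simp add: has_vector_derivative_iff_quotient)
qed

section \<open>Differentiable curves depending continuously on a parameter\<close>

text \<open>\<open>f s t\<close> is a curve in \<open>s\<close>; the parameter \<open>t\<close> is the variable of a later integration over
  \<open>[0, 1]\<close>. Composition, integration and division along such curves stay within fixed types,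
  unlike the iterated derivatives of maps between Banach spaces.\<close>

primrec Ck_on :: "nat \<Rightarrow> real set \<Rightarrow> (real \<Rightarrow> real \<Rightarrow> 'a::real_normed_vector) \<Rightarrow> bool" where
  "Ck_on 0 S f \<longleftrightarrow> continuous_on (S \<times> {0..1}) (\<lambda>(s, t). f s t)"
| "Ck_on (Suc k) S f \<longleftrightarrow> continuous_on (S \<times> {0..1}) (\<lambda>(s, t). f s t) \<and>
     (\<exists>f'. (\<forall>s\<in>S. \<forall>t\<in>{0..1}. ((\<lambda>s. f s t) has_vector_derivative f' s t) (at s)) \<and> Ck_on k S f')"

lemma Ck_on_continuous: "Ck_on k S f \<Longrightarrow> continuous_on (S \<times> {0..1}) (\<lambda>(s, t). f s t)"
  by (cases k) auto

lemma Ck_on_SucI: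
  assumes "continuous_on (S \<times> {0..1}) (\<lambda>(s, t). f s t)"
    "\<And>s t. s \<in> S \<Longrightarrow> t \<in> {0..1} \<Longrightarrow> ((\<lambda>s. f s t) has_vector_derivative f' s t) (at s)"
    "Ck_on k S f'"
  shows "Ck_on (Suc k) S f"
  using assms unfolding Ck_on.simps by blast

lemma Ck_on_SucE:
  assumes "Ck_on (Suc k) S f"
  obtains f' where "\<And>s t. s \<in> S \<Longrightarrow> t \<in> {0..1} \<Longrightarrow> ((\<lambda>s. f s t) has_vector_derivative f' s t) (at s)"
    "Ck_on k S f'"
  using assms unfolding Ck_on.simps by blast

lemma Ck_on_Suc_imp: "Ck_on (Suc k) S f \<Longrightarrow> Ck_on k S f"
proof (induction k arbitrary: f)
  case (Suc k)
  obtain f' where "\<And>s t. s \<in> S \<Longrightarrow> t \<in> {0..1} \<Longrightarrow> ((\<lambda>s. f s t) has_vector_derivative f' s t) (at s)"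
    "Ck_on (Suc k) S f'"
    using Suc.prems by (rule Ck_on_SucE) (rule that; assumption)
  then show ?case using Suc.IH Ck_on_continuous[OF Suc.prems] by (intro Ck_on_SucI[of S f f']) auto
qed simp

lemma Ck_on_subset: "Ck_on k S f \<Longrightarrow> T \<subseteq> S \<Longrightarrow> Ck_on k T f"
proof (induction k arbitrary: f)
  case 0
  then show ?case by (auto elim: continuous_on_subset)
next
  case (Suc k)
  obtain f' where f': "\<And>s t. s \<in> S \<Longrightarrow> t \<in> {0..1} \<Longrightarrow> ((\<lambda>s. f s t) has_vector_derivative f' s t) (at s)"
    "Ck_on k S f'"
    using Suc.prems(1) by (rule Ck_on_SucE) (rule that; assumption)
  have "continuous_on (T \<times> {0..1}) (\<lambda>(s, t). f s t)"
    by (rule continuous_on_subset[OF Ck_on_continuous[OF Suc.prems(1)]]) (use Suc.prems(2) in auto)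
  then show ?case using f' Suc.prems Suc.IH[OF f'(2)] by (intro Ck_on_SucI[of T f f']) auto
qed

lemma Ck_on_cong:
  assumes "open S" "\<And>s t. s \<in> S \<Longrightarrow> t \<in> {0..1} \<Longrightarrow> f s t = g s t" "Ck_on k S f"
  shows "Ck_on k S g"
proof -
  have cont: "continuous_on (S \<times> {0..1}) (\<lambda>(s, t). g s t)"
    using Ck_on_continuous[OF assms(3)]
    by (rule continuous_on_eq) (use assms(2) in auto)
  show ?thesis
  proof (cases k)
    case (Suc j)
    obtain f' where f': "\<And>s t. s \<in> S \<Longrightarrow> t \<in> {0..1} \<Longrightarrow> ((\<lambda>s. f s t) has_vector_derivative f' s t) (at s)"
      "Ck_on j S f'"
      using assms(3) unfolding Suc by (rule Ck_on_SucE) (rule that; assumption)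
    have "((\<lambda>s. g s t) has_vector_derivative f' s t) (at s)" if "s \<in> S" "t \<in> {0..1}" for s t
      by (rule has_vector_derivative_transform_within_open[OF f'(1) assms(1)]) (use that assms(2) in auto)
    then show ?thesis unfolding Suc using cont f' by (intro Ck_on_SucI)
  qed (use cont in simp)
qed

lemma Ck_on_const: "Ck_on k S (\<lambda>s t. c)"
  by (induction k arbitrary: c) (auto intro!: exI[of _ "\<lambda>s t. 0"])

lemma Ck_on_param: "Ck_on k S (\<lambda>s t. t)"
  by (cases k)
    (auto simp: split_beta intro!: exI[of _ "\<lambda>s t. 0"] Ck_on_const continuous_intros)

lemma Ck_on_self: "Ck_on k S (\<lambda>s t. s)"
  by (cases k)
    (auto simp: split_beta intro!: exI[of _ "\<lambda>s t. 1"] Ck_on_const continuous_intros)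

lemma Ck_on_add: "Ck_on k S f \<Longrightarrow> Ck_on k S g \<Longrightarrow> Ck_on k S (\<lambda>s t. f s t + g s t)"
proof (induction k arbitrary: f g)
  case 0
  then show ?case by (auto simp: split_beta intro: continuous_on_add)
next
  case (Suc k)
  obtain f' where f': "\<And>s t. s \<in> S \<Longrightarrow> t \<in> {0..1} \<Longrightarrow> ((\<lambda>s. f s t) has_vector_derivative f' s t) (at s)"
    "Ck_on k S f'"
    using Suc.prems(1) by (rule Ck_on_SucE) (rule that; assumption)
  obtain g' where g': "\<And>s t. s \<in> S \<Longrightarrow> t \<in> {0..1} \<Longrightarrow> ((\<lambda>s. g s t) has_vector_derivative g' s t) (at s)"
    "Ck_on k S g'"
    using Suc.prems(2) by (rule Ck_on_SucE) (rule that; assumption)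
  have "continuous_on (S \<times> {0..1}) (\<lambda>(s, t). f s t + g s t)"
    using continuous_on_add[OF Ck_on_continuous[OF Suc.prems(1)] Ck_on_continuous[OF Suc.prems(2)]]
    by (simp add: split_beta)
  then show ?case
    by (rule Ck_on_SucI[OF _ has_vector_derivative_add[OF f'(1) g'(1)] Suc.IH[OF f'(2) g'(2)]])
qed

lemma Ck_on_sum:
  "(\<And>i. i \<in> I \<Longrightarrow> Ck_on k S (f i)) \<Longrightarrow> Ck_on k S (\<lambda>s t. \<Sum>i\<in>I. f i s t)"
  by (induction I rule: infinite_finite_induct) (auto intro: Ck_on_const Ck_on_add)

lemma (in bounded_linear) Ck_on: "Ck_on k S g \<Longrightarrow> Ck_on k S (\<lambda>s t. f (g s t))"
proof (induction k arbitrary: g)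
  case 0
  then show ?case by (auto simp: split_beta intro: continuous_on)
next
  case (Suc k)
  obtain g' where g': "\<And>s t. s \<in> S \<Longrightarrow> t \<in> {0..1} \<Longrightarrow> ((\<lambda>s. g s t) has_vector_derivative g' s t) (at s)"
    "Ck_on k S g'"
    using Suc.prems by (rule Ck_on_SucE) (rule that; assumption)
  have "continuous_on (S \<times> {0..1}) (\<lambda>(s, t). f (g s t))"
    using continuous_on[OF Ck_on_continuous[OF Suc.prems]] by (simp add: split_beta)
  then show ?case
    by (rule Ck_on_SucI[OF _ has_vector_derivative[OF g'(1)] Suc.IH[OF g'(2)]])
qed

lemma Ck_on_diff:
  assumes "Ck_on k S f" "Ck_on k S g"
  shows "Ck_on k S (\<lambda>s t. f s t - g s t)"
  using Ck_on_add[OF assms(1) bounded_linear.Ck_on[OF bounded_linear_minus[OF bounded_linear_ident] assms(2)]]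
  by simp

lemma (in bounded_bilinear) Ck_on:
  "Ck_on k S f \<Longrightarrow> Ck_on k S g \<Longrightarrow> Ck_on k S (\<lambda>s t. prod (f s t) (g s t))"
proof (induction k arbitrary: f g)
  case 0
  then show ?case by (auto simp: split_beta intro: continuous_on)
next
  case (Suc k)
  obtain f' where f': "\<And>s t. s \<in> S \<Longrightarrow> t \<in> {0..1} \<Longrightarrow> ((\<lambda>s. f s t) has_vector_derivative f' s t) (at s)"
    "Ck_on k S f'"
    using Suc.prems(1) by (rule Ck_on_SucE) (rule that; assumption)
  obtain g' where g': "\<And>s t. s \<in> S \<Longrightarrow> t \<in> {0..1} \<Longrightarrow> ((\<lambda>s. g s t) has_vector_derivative g' s t) (at s)"
    "Ck_on k S g'"
    using Suc.prems(2) by (rule Ck_on_SucE) (rule that; assumption)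
  have "continuous_on (S \<times> {0..1}) (\<lambda>(s, t). prod (f s t) (g s t))"
    using continuous_on[OF Ck_on_continuous[OF Suc.prems(1)] Ck_on_continuous[OF Suc.prems(2)]]
    by (simp add: split_beta)
  then show ?case
    by (rule Ck_on_SucI[OF _ has_vector_derivative[OF f'(1) g'(1)] Ck_on_add[OF
          Suc.IH[OF Ck_on_Suc_imp[OF Suc.prems(1)] g'(2)] Suc.IH[OF f'(2) Ck_on_Suc_imp[OF Suc.prems(2)]]]])
qed

lemma Ck_on_Pair: "Ck_on k S f \<Longrightarrow> Ck_on k S g \<Longrightarrow> Ck_on k S (\<lambda>s t. (f s t, g s t))"
  using Ck_on_add[OF bounded_linear.Ck_on[of "\<lambda>x. (x, 0)"] bounded_linear.Ck_on[of "\<lambda>y. (0, y)"], of k S f g]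
  by (simp add: bounded_linear_Pair bounded_linear_ident bounded_linear_zero)

section \<open>Composition with smooth maps and integration over the parameter\<close>

lemma continuous_on_jets:
  fixes d :: "nat \<Rightarrow> 'a::real_normed_vector \<Rightarrow> 'a list \<Rightarrow> 'b::real_normed_vector"
  assumes d: "jets d" and c: "continuous_on A (\<lambda>(s, t). c s t)"
    and fs: "\<And>f. f \<in> set fs \<Longrightarrow> continuous_on A (\<lambda>(s, t). f s t)"
  shows "continuous_on A (\<lambda>(s, t). d (length fs) (c s t) (map (\<lambda>f. f s t) fs))"
  unfolding continuous_on_def
proof
  fix p assume p: "p \<in> A"
  have fs': "list_all2 (\<lambda>f l. (f \<longlongrightarrow> l) (at p within A))
      (map (\<lambda>f (s, t). f s t) fs) (map (\<lambda>f. f (fst p) (snd p)) fs)"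
    using fs p unfolding list_all2_conv_all_nth continuous_on_def split_beta by auto
  have c': "((\<lambda>(s, t). c s t) \<longlongrightarrow> c (fst p) (snd p)) (at p within A)"
    using c p unfolding continuous_on_def split_beta by auto
  show "((\<lambda>(s, t). d (length fs) (c s t) (map (\<lambda>f. f s t) fs)) \<longlongrightarrow>
      (case p of (s, t) \<Rightarrow> d (length fs) (c s t) (map (\<lambda>f. f s t) fs))) (at p within A)"
    using jets_tendsto[OF d c' fs'] by (simp add: split_beta' o_def)
qed

text \<open>Differentiating a jet of order \<open>n\<close> along curves gives one jet of order
  \<open>n + 1\<close> with the velocity as new head, and jets of order \<open>n\<close> with one
  argument replaced by its derivative. The induction on \<open>k\<close> must therefore range over
  all orders and all lists of arguments.\<close>

lemma Ck_on_jets: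
  fixes d :: "nat \<Rightarrow> 'a::real_normed_vector \<Rightarrow> 'a list \<Rightarrow> 'b::real_normed_vector"
  assumes d: "jets d"
  shows "Ck_on k S c \<Longrightarrow> \<forall>f\<in>set fs. Ck_on k S f \<Longrightarrow>
    Ck_on k S (\<lambda>s t. d (length fs) (c s t) (map (\<lambda>f. f s t) fs))"
proof (induction k arbitrary: c fs)
  case 0
  then show ?case by (simp add: continuous_on_jets[OF d])
next
  case (Suc k)
  obtain c' where c': "\<And>s t. s \<in> S \<Longrightarrow> t \<in> {0..1} \<Longrightarrow> ((\<lambda>s. c s t) has_vector_derivative c' s t) (at s)"
    "Ck_on k S c'"
    using Suc.prems(1) by (rule Ck_on_SucE) (rule that; assumption)
  have "\<forall>f\<in>set fs. \<exists>f'. (\<forall>s\<in>S. \<forall>t\<in>{0..1}. ((\<lambda>s. f s t) has_vector_derivative f' s t) (at s)) \<and> Ck_on k S f'"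
    using Suc.prems(2) by simp
  then obtain D where D: "\<And>f s t. f \<in> set fs \<Longrightarrow> s \<in> S \<Longrightarrow> t \<in> {0..1} \<Longrightarrow>
      ((\<lambda>s. f s t) has_vector_derivative D f s t) (at s)" "\<And>f. f \<in> set fs \<Longrightarrow> Ck_on k S (D f)"
    by metis
  let ?V = "\<lambda>fs s t. map (\<lambda>f. f s t) fs"
  \<comment> \<open>The orders are written as lengths of the lists actually inserted, so that every
    summand is an instance of the induction hypothesis.\<close>
  define g where "g s t = d (length (c' # fs)) (c s t) (?V (c' # fs) s t) +
      (\<Sum>i<length fs. d (length (fs[i := D (fs ! i)])) (c s t) (?V (fs[i := D (fs ! i)]) s t))" for s t
  have c: "Ck_on k S c" and fs: "\<forall>f\<in>set fs. Ck_on k S f"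
    using Suc.prems by (auto intro: Ck_on_Suc_imp simp del: Ck_on.simps)
  have "Ck_on k S g"
    unfolding g_def
  proof (intro Ck_on_add Ck_on_sum Suc.IH[OF c] ballI)
    fix i f assume "i \<in> {..<length fs}" "f \<in> set (fs[i := D (fs ! i)])"
    then show "Ck_on k S f"
      using set_update_subset_insert[of fs i "D (fs ! i)"] fs D(2)[of "fs ! i"] by auto
  qed (use fs c'(2) in auto)
  moreover have "((\<lambda>s. d (length fs) (c s t) (?V fs s t)) has_vector_derivative g s t) (at s)"
    if st: "s \<in> S" "t \<in> {0..1}" for s t
  proof -
    have "list_all2 (\<lambda>f f'. (f has_vector_derivative f') (at s)) (map (\<lambda>f s. f s t) fs) (map (\<lambda>f. D f s t) fs)"
      using D(1)[OF _ st] by (auto simp: list_all2_conv_all_nth)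
    from jets_has_vector_derivative[OF d c'(1)[OF st] this]
    show ?thesis by (simp add: o_def g_def map_update)
  qed
  moreover have "continuous_on (S \<times> {0..1}) (\<lambda>(s, t). d (length fs) (c s t) (?V fs s t))"
    by (rule continuous_on_jets[OF d])
      (use Suc.prems in \<open>auto intro: Ck_on_continuous simp del: Ck_on.simps\<close>)
  ultimately show ?case by (intro Ck_on_SucI) auto
qed

lemma Ck_on_smooth:
  assumes "smooth_on UNIV G" "Ck_on k S c"
  shows "Ck_on k S (\<lambda>s t. G (c s t))"
proof -
  obtain d where d: "jets d" "\<And>x. d 0 x [] = G x"
    using assms(1) unfolding smooth_on_UNIV_iff_jets by blast
  show ?thesis using Ck_on_jets[OF d(1) assms(2), of "[]"] d(2) by simp
qed

text \<open>Differentiation under the integral sign. The result is constant in the parameter but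
  keeps the two-variable form, so that it can be combined with other curves.\<close>

lemma Ck_on_integral:
  fixes f :: "real \<Rightarrow> real \<Rightarrow> 'a::banach"
  assumes "open S"
  shows "Ck_on k S f \<Longrightarrow> Ck_on k S (\<lambda>s t. integral {0..1} (f s))"
proof (induction k arbitrary: f)
  case 0
  then have "continuous_on S (\<lambda>s. integral {0..1} (f s))"
    using integral_continuous_on_param[of S 0 1 f] by simp
  then have "continuous_on (S \<times> {0..1}) (\<lambda>x. integral {0..1} (f (fst x)))"
    by (rule continuous_on_compose2) (auto intro: continuous_intros)
  then show ?case by (simp add: split_beta)
next
  case (Suc k)
  obtain f' where f': "\<And>s t. s \<in> S \<Longrightarrow> t \<in> {0..1} \<Longrightarrow> ((\<lambda>s. f s t) has_vector_derivative f' s t) (at s)"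
    "Ck_on k S f'"
    using Suc.prems(1) by (rule Ck_on_SucE) (rule that; assumption)
  have cont_f: "continuous_on (S \<times> {0..1}) (\<lambda>(s, t). f s t)" by (rule Ck_on_continuous[OF Suc.prems])
  then have "continuous_on S (\<lambda>s. integral {0..1} (f s))"
    using integral_continuous_on_param[of S 0 1 f] by simp
  then have "continuous_on (S \<times> {0..1}) (\<lambda>x. integral {0..1} (f (fst x)))"
    by (rule continuous_on_compose2) (auto intro: continuous_intros)
  then have cont: "continuous_on (S \<times> {0..1}) (\<lambda>(s, t). integral {0..1} (f s))"
    by (simp add: split_beta)
  have der: "((\<lambda>s. integral {0..1} (f s)) has_vector_derivative integral {0..1} (f' s0)) (at s0)"
    if s0: "s0 \<in> S" for s0
  proof -
    \<comment> \<open>The Leibniz rule works on a convex set of parameters, hence the restriction to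
      a ball.\<close>
    obtain e where e: "e > 0" "ball s0 e \<subseteq> S" using assms s0 by (auto simp: open_contains_ball)
    have "((\<lambda>s. integral (cbox 0 1) (f s)) has_vector_derivative integral (cbox 0 1) (f' s0))
        (at s0 within ball s0 e)"
    proof (rule leibniz_rule_vector_derivative)
      show "((\<lambda>s. f s t) has_vector_derivative f' s t) (at s within ball s0 e)"
        if "s \<in> ball s0 e" "t \<in> cbox 0 1" for s t
        by (rule has_vector_derivative_at_within[OF f'(1)]) (use that e in auto)
      show "f s integrable_on cbox 0 1" if "s \<in> ball s0 e" for s
      proof (rule integrable_continuous)
        have "continuous_on {0..1} (\<lambda>t. (\<lambda>(s, t). f s t) (s, t))"
          by (rule continuous_on_compose2[OF cont_f]) (use that e in \<open>auto intro!: continuous_intros\<close>)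
        then show "continuous_on (cbox 0 1) (f s)" by simp
      qed
      show "continuous_on (ball s0 e \<times> cbox 0 1) (\<lambda>(s, t). f' s t)"
        by (rule continuous_on_subset[OF Ck_on_continuous[OF f'(2)]]) (use e in auto)
    qed (use e in auto)
    then show ?thesis using e(1) by (simp add: has_vector_derivative_within_open[of s0 "ball s0 e"])
  qed
  show ?case
    by (rule Ck_on_SucI[OF cont der]) (use Suc.IH[OF f'(2)] in auto)
qed

text \<open>On the real line an \<open>n\<close>-linear map is the product of its arguments times
  its value at the all-one list. The multilinear derivatives are thus the iterated vector
  derivatives \<open>D n\<close>, multiplied by \<open>prod_list vs\<close>.\<close>

lemma smooth_on_Ck_on:
  fixes f :: "real \<Rightarrow> 'a::real_normed_vector"
  assumes S: "open S" and f: "\<And>k. Ck_on k S (\<lambda>s t. f s)"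
  shows "smooth_on S f"
proof -
  define D where "D n = ((\<lambda>g s. vector_derivative g (at s)) ^^ n) f" for n :: nat
  have D0: "D 0 = f" and DS: "D (Suc n) = (\<lambda>s. vector_derivative (D n) (at s))" for n
    by (auto simp: D_def)
  \<comment> \<open>The derivative supplied by \<open>Ck_on\<close> may vary with \<open>k\<close>.
    Uniqueness identifies it with \<open>vector_derivative\<close>, which yields a single sequence
    of derivatives serving all orders.\<close>
  have step: "Ck_on k S (\<lambda>s t. vector_derivative g (at s)) \<and>
      (\<forall>s\<in>S. (g has_vector_derivative vector_derivative g (at s)) (at s))"
    if g: "\<And>k. Ck_on k S (\<lambda>s t. g s)" for g :: "real \<Rightarrow> 'a" and k
  proof -
    obtain g' where g': "\<And>s t. s \<in> S \<Longrightarrow> t \<in> {0..1} \<Longrightarrow> (g has_vector_derivative g' s t) (at s)"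
      "Ck_on k S g'"
      using g[of "Suc k"] by (rule Ck_on_SucE) (rule that; assumption)
    have eq: "g' s t = vector_derivative g (at s)" if "s \<in> S" "t \<in> {0..1}" for s t
      using vector_derivative_at[OF g'(1)[OF that]] by simp
    show ?thesis
      using Ck_on_cong[OF S eq g'(2)] g'(1)[of _ 0] eq[of _ 0] by auto
  qed
  have Ck: "Ck_on k S (\<lambda>s t. D n s)" for k n
    by (induction n arbitrary: k) (use f step in \<open>auto simp: D0 DS\<close>)
  have der: "(D n has_vector_derivative D (Suc n) s) (at s)" if "s \<in> S" for n s
    using step[of "D n"] Ck that by (auto simp: DS)
  define d where "d n s vs = prod_list vs *\<^sub>R D n s" for n s vs
  have abs_prod: "\<bar>prod_list vs\<bar> = (\<Prod>v\<leftarrow>vs. norm v)" for vs :: "real list"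
    by (induction vs) (auto simp: abs_mult)
  have upd: "prod_list (vs[i := v]) = prod_list (vs[i := 1]) * v" if "i < length vs" for vs i and v :: real
    using that by (induction vs arbitrary: i) (auto split: nat.split)
  show ?thesis
    unfolding smooth_on_def
  proof (intro exI[of _ d] conjI ballI allI impI)
    show "d 0 s [] = f s" for s by (simp add: d_def D0)
    show "bounded_multilinear n (d n s)" for n s
      unfolding bounded_multilinear_def
    proof (intro conjI allI impI)
      fix vs :: "real list" and i assume "length vs = n \<and> i < n"
      then have "d n s (vs[i := v]) = v *\<^sub>R prod_list (vs[i := 1]) *\<^sub>R D n s" for v
        using upd[of i vs v] by (simp add: d_def)
      then show "linear (\<lambda>v. d n s (vs[i := v]))"
        by (simp add: linear_iff distrib_right scaleR_add_left)
    next
      show "\<exists>K. \<forall>vs. length vs = n \<longrightarrow> norm (d n s vs) \<le> K * (\<Prod>v\<leftarrow>vs. norm v)"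
        by (intro exI[of _ "norm (D n s)"]) (simp add: d_def abs_prod mult.commute)
    qed
    fix n s and e :: real assume "s \<in> S" "0 < e"
    then obtain r where r: "r > 0" "\<And>y. norm (y - s) < r \<Longrightarrow>
        norm (D n y - D n s - (y - s) *\<^sub>R D (Suc n) s) \<le> e * norm (y - s)"
      using der[of s n] unfolding has_vector_derivative_def has_derivative_at_alt by blast
    have "norm (d n (s + h) vs - d n s vs - d (Suc n) s (h # vs)) \<le> e * norm h * (\<Prod>v\<leftarrow>vs. norm v)"
      if "norm h < r" for h vs
    proof -
      have "d n (s + h) vs - d n s vs - d (Suc n) s (h # vs) =
          prod_list vs *\<^sub>R (D n (s + h) - D n s - h *\<^sub>R D (Suc n) s)"
        by (simp add: d_def scaleR_diff_right mult.commute)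
      then have "norm (d n (s + h) vs - d n s vs - d (Suc n) s (h # vs)) =
          (\<Prod>v\<leftarrow>vs. norm v) * norm (D n (s + h) - D n s - h *\<^sub>R D (Suc n) s)"
        by (simp add: abs_prod)
      also have "\<dots> \<le> (\<Prod>v\<leftarrow>vs. norm v) * (e * norm h)"
        using r(2)[of "s + h"] that by (intro mult_left_mono prod_list_norm_nonneg) simp
      finally show ?thesis by (simp add: mult.commute)
    qed
    then show "\<exists>r>0. \<forall>h. norm h < r \<and> s + h \<in> S \<longrightarrow> (\<forall>vs. length vs = n \<longrightarrow>
        norm (d n (s + h) vs - d n s vs - d (Suc n) s (h # vs)) \<le> e * norm h * (\<Prod>v\<leftarrow>vs. norm v))"
      using r(1) by blast
  qed
qed

lemma vector_derivative_in_closed_subspace: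
  assumes W: "subspace W" "closed W" and S: "open S" "s \<in> S" "\<And>x. x \<in> S \<Longrightarrow> f x \<in> W"
    and f: "(f has_vector_derivative f') (at s)"
  shows "f' \<in> W"
proof (rule Lim_in_closed_set[OF W(2) _ _ f[unfolded has_vector_derivative_iff_quotient]])
  show "\<forall>\<^sub>F x in at s. (f x - f s) /\<^sub>R (x - s) \<in> W"
    using eventually_at_in_open'[OF S(1,2)]
    by eventually_elim (use W S in \<open>auto intro: subspace_scale subspace_diff\<close>)
qed simp

text \<open>The inverse of \<open>M s t\<close> is only defined on \<open>W\<close>, which need not be complemented; so the
  solution \<open>y\<close> is differentiated instead of the inverse, via \<open>M y' = b' - M' y\<close>.\<close>

lemma Ck_on_solve:
  fixes M :: "real \<Rightarrow> real \<Rightarrow> ('a::real_normed_vector \<Rightarrow>\<^sub>L 'b::real_normed_vector)"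
  assumes S: "open S" and V: "subspace V" and W: "subspace W" "closed W"
    and iso: "\<And>s t. s \<in> S \<Longrightarrow> t \<in> {0..1} \<Longrightarrow> isomorphism_between V W (M s t) K"
  shows "Ck_on k S M \<Longrightarrow> Ck_on k S b \<Longrightarrow>
    (\<And>s t. s \<in> S \<Longrightarrow> t \<in> {0..1} \<Longrightarrow> y s t \<in> V \<and> M s t (y s t) = b s t) \<Longrightarrow> Ck_on k S y"
proof (induction k arbitrary: b y)
  case 0
  have lo: "norm v \<le> K * norm (M s t v)" if "s \<in> S" "t \<in> {0..1}" "v \<in> V" for s t v
    using iso[OF that(1,2)] that(3) by (simp add: isomorphism_between_def)
  have "((\<lambda>(s, t). y s t) \<longlongrightarrow> (case p of (s, t) \<Rightarrow> y s t)) (at p within S \<times> {0..1})"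
    if p: "p \<in> S \<times> {0..1}" for p
  proof -
    obtain s0 t0 where p0: "p = (s0, t0)" "s0 \<in> S" "t0 \<in> {0..1}" using p by auto
    have "((\<lambda>(s, t). b s t) \<longlongrightarrow> b s0 t0) (at p within S \<times> {0..1})"
      using 0(2) p p0(1) by (auto simp: continuous_on_def)
    moreover have "((\<lambda>(s, t). M s t) \<longlongrightarrow> M s0 t0) (at p within S \<times> {0..1})"
      using 0(1) p p0(1) by (auto simp: continuous_on_def)
    ultimately have "((\<lambda>x. K * norm ((\<lambda>(s, t). b s t) x - (\<lambda>(s, t). M s t) x (y s0 t0))) \<longlongrightarrow>
        K * norm (b s0 t0 - M s0 t0 (y s0 t0))) (at p within S \<times> {0..1})"
      by (intro tendsto_intros)
    then have lim: "((\<lambda>x. K * norm ((\<lambda>(s, t). b s t) x - (\<lambda>(s, t). M s t) x (y s0 t0))) \<longlongrightarrow> 0)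
        (at p within S \<times> {0..1})"
      using 0(3)[OF p0(2,3)] by simp
    have bound: "norm (y s t - y s0 t0) \<le> K * norm (b s t - M s t (y s0 t0))"
      if "s \<in> S" "t \<in> {0..1}" for s t
      using lo[OF that, of "y s t - y s0 t0"] 0(3)[OF that] 0(3)[OF p0(2,3)] V
      by (simp add: subspace_diff blinfun.diff_right)
    have "\<forall>\<^sub>F x in at p within S \<times> {0..1}. norm ((\<lambda>(s, t). y s t) x - y s0 t0) \<le>
        K * norm ((\<lambda>(s, t). b s t) x - (\<lambda>(s, t). M s t) x (y s0 t0))"
      unfolding eventually_at_filter using bound by (intro always_eventually) auto
    from Lim_null_comparison[OF this lim]
    have "((\<lambda>x. (\<lambda>(s, t). y s t) x - y s0 t0) \<longlongrightarrow> 0) (at p within S \<times> {0..1})" .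
    then show ?thesis using p0(1) by (simp add: LIM_zero_iff)
  qed
  then show ?case by (simp add: continuous_on_def)
next
  case (Suc k)
  have lo: "norm v \<le> K * norm (M s t v)" if "s \<in> S" "t \<in> {0..1}" "v \<in> V" for s t v
    using iso[OF that(1,2)] that(3) by (simp add: isomorphism_between_def)
  \<comment> \<open>One order less is available for \<open>y\<close> from the induction hypothesis.
    This is what makes the right-hand side \<open>b' - M' y\<close> of the differentiated equation
    regular enough.\<close>
  have y: "Ck_on k S y"
    using Suc.IH[OF Ck_on_Suc_imp[OF Suc.prems(1)] Ck_on_Suc_imp[OF Suc.prems(2)] Suc.prems(3)] .
  have yV: "y s t \<in> V" and My: "M s t (y s t) = b s t" if "s \<in> S" "t \<in> {0..1}" for s t
    using Suc.prems(3)[OF that] by auto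
  have MW: "M s t v \<in> W" if "s \<in> S" "t \<in> {0..1}" "v \<in> V" for s t v
    using iso[OF that(1,2)] that(3) by (auto simp: isomorphism_between_def)
  obtain M' where M': "\<And>s t. s \<in> S \<Longrightarrow> t \<in> {0..1} \<Longrightarrow> ((\<lambda>s. M s t) has_vector_derivative M' s t) (at s)"
    "Ck_on k S M'"
    using Suc.prems(1) by (rule Ck_on_SucE) (rule that; assumption)
  obtain b' where b': "\<And>s t. s \<in> S \<Longrightarrow> t \<in> {0..1} \<Longrightarrow> ((\<lambda>s. b s t) has_vector_derivative b' s t) (at s)"
    "Ck_on k S b'"
    using Suc.prems(2) by (rule Ck_on_SucE) (rule that; assumption)
  \<comment> \<open>The differentiated equation is solvable because its right-hand side lies in
    \<open>W\<close>: both terms are velocities of curves in the closed subspace \<open>W\<close>,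
    the second with the vector \<open>y s t\<close> held fixed while only the operator
    moves.\<close>
  have "\<exists>z\<in>V. M s t z = b' s t - M' s t (y s t)" if st: "s \<in> S" "t \<in> {0..1}" for s t
  proof -
    have "b' s t \<in> W"
      by (rule vector_derivative_in_closed_subspace[OF W S st(1) _ b'(1)[OF st]])
        (use MW yV My st in metis)
    moreover have "M' s t (y s t) \<in> W"
    proof (rule vector_derivative_in_closed_subspace[OF W S st(1)])
      show "((\<lambda>s'. M s' t (y s t)) has_vector_derivative M' s t (y s t)) (at s)"
        by (rule bounded_linear.has_vector_derivative[OF blinfun.bounded_linear_left M'(1)[OF st]])
    qed (use MW yV st in auto)
    ultimately have "b' s t - M' s t (y s t) \<in> M s t ` V"
      using iso[OF st] W by (simp add: isomorphism_between_def subspace_diff)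
    then show ?thesis by auto
  qed
  then obtain z where z: "\<And>s t. s \<in> S \<Longrightarrow> t \<in> {0..1} \<Longrightarrow> z s t \<in> V \<and> M s t (z s t) = b' s t - M' s t (y s t)"
    by metis
  have "Ck_on k S (\<lambda>s t. b' s t - M' s t (y s t))"
    by (intro Ck_on_diff b' blinfun.Ck_on M' y)
  then have "Ck_on k S z"
    by (rule Suc.IH[OF Ck_on_Suc_imp[OF Suc.prems(1)] _ z])
  moreover have "((\<lambda>s. y s t) has_vector_derivative z s t) (at s)" if st: "s \<in> S" "t \<in> {0..1}" for s t
  proof -
    let ?q = "\<lambda>g x. (g x - g s) /\<^sub>R (x - s)"
    \<comment> \<open>This is the operator \<open>M x t\<close> at the nearby point applied to the
      error of the difference quotient of \<open>y\<close>. Since all these operators share the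
      lower bound \<open>K\<close>, smallness of \<open>?e\<close> carries over to that
      error.\<close>
    let ?e = "\<lambda>x. ?q (\<lambda>s. b s t) x - ?q (\<lambda>s. M s t) x (y s t) - M x t (z s t)"
    have Mc: "((\<lambda>s. M s t) \<longlongrightarrow> M s t) (at s)"
      using has_vector_derivative_continuous[OF M'(1)[OF st]] by (simp add: isCont_def)
    have "((\<lambda>x. K * norm (?e x)) \<longlongrightarrow> K * norm (b' s t - M' s t (y s t) - M s t (z s t))) (at s)"
      using b'(1)[OF st] M'(1)[OF st] Mc unfolding has_vector_derivative_iff_quotient
      by (intro tendsto_intros)
    then have lim: "((\<lambda>x. K * norm (?e x)) \<longlongrightarrow> 0) (at s)" using z[OF st] by simp
    have bound: "norm (?q (\<lambda>s. y s t) x - z s t) \<le> K * norm (?e x)" if x: "x \<in> S" for x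
    proof -
      have "?q (\<lambda>s. y s t) x - z s t \<in> V"
        using yV z x st V by (auto intro!: subspace_diff subspace_scale)
      moreover have "M x t (?q (\<lambda>s. y s t) x - z s t) = ?e x"
        using My[OF x st(2)] My[OF st]
        by (simp add: blinfun.bilinear_simps scaleR_diff_right)
      ultimately show ?thesis using lo[OF x st(2)] by metis
    qed
    have "\<forall>\<^sub>F x in at s. norm (?q (\<lambda>s. y s t) x - z s t) \<le> K * norm (?e x)"
      by (rule eventually_mono[OF eventually_at_in_open'[OF S st(1)] bound])
    from Lim_null_comparison[OF this lim] show ?thesis
      by (simp add: has_vector_derivative_iff_quotient LIM_zero_iff)
  qed
  ultimately show ?case
    by (intro Ck_on_SucI) (use Ck_on_continuous[OF y] in auto)
qed

section \<open>The implicit function theorem between closed subspaces\<close>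

text \<open>As a bounded operator the inclusion turns partial derivatives into compositions, to
  which the rules for curves of operators apply.\<close>

definition snd_embed :: "'b::real_normed_vector \<Rightarrow>\<^sub>L ('a::real_normed_vector \<times> 'b)" where
  "snd_embed = Blinfun (\<lambda>v. (0, v))"

lemma snd_embed_apply [simp]: "blinfun_apply snd_embed v = (0, v)"
  unfolding snd_embed_def
  by (simp add: bounded_linear_Blinfun_apply bounded_linear_Pair bounded_linear_zero bounded_linear_ident)

lemma continuous_blinfun_ball:
  fixes D :: "'a::real_normed_vector \<Rightarrow> 'b::real_normed_vector"
  assumes "continuous_on UNIV D" "0 < e"
  obtains r where "0 < r" "\<And>z. norm (z - z0) < r \<Longrightarrow> norm (D z - D z0) < e"
  using assms by (force simp: continuous_on_iff dist_norm)

lemma has_derivative_Pair_snd: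
  assumes "(f has_derivative f') (at (a, x))"
  shows "((\<lambda>x. f (a, x)) has_derivative (\<lambda>v. f' (0, v))) (at x within S)"
proof -
  have "((\<lambda>x. (a, x)) has_derivative (\<lambda>v. (0, v))) (at x within S)"
    by (auto intro!: derivative_eq_intros)
  from has_derivative_compose[OF this, of f f'] show ?thesis using assms by simp
qed

lemma derivative_maps_into_closed_subspace:
  fixes \<Phi> :: "'a::real_normed_vector \<Rightarrow> 'b::real_normed_vector"
  assumes V: "subspace V" and W: "subspace W" "closed W"
    and \<Phi>: "(\<Phi> has_derivative D) (at x)" and maps: "\<And>x. x \<in> V \<Longrightarrow> \<Phi> x \<in> W"
    and x: "x \<in> V" "v \<in> V"
  shows "D v \<in> W"
proof (rule vector_derivative_in_closed_subspace[OF W open_UNIV UNIV_I])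
  show "\<Phi> (x + s *\<^sub>R v) \<in> W" for s
    using V x by (intro maps subspace_add subspace_scale)
  have "((\<lambda>s::real. x + s *\<^sub>R v) has_derivative (\<lambda>s. s *\<^sub>R v)) (at 0)"
    by (auto intro!: derivative_eq_intros)
  from has_derivative_compose[OF this, of \<Phi> D]
  show "((\<lambda>s. \<Phi> (x + s *\<^sub>R v)) has_vector_derivative D v) (at 0)"
    using \<Phi> linear_scale[OF has_derivative_linear[OF \<Phi>]] by (simp add: has_vector_derivative_def)
qed

text \<open>Mean value inequality on a ball for the map with its linear part at the centre
  subtracted. Continuity of the derivative makes the estimate uniform in the parameter
  \<open>a\<close>.\<close>

lemma strict_derivative_snd:
  fixes \<Phi> :: "'p::real_normed_vector \<times> 'a::real_normed_vector \<Rightarrow> 'b::real_normed_vector"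
  assumes der: "\<And>z. (\<Phi> has_derivative blinfun_apply (D z)) (at z)"
    and cont: "continuous_on UNIV D" and e: "0 < e"
  obtains r where "0 < r" "\<And>a z. norm (a - a0) \<le> r \<Longrightarrow> norm (z - x0) \<le> r \<Longrightarrow>
      norm (D (a, z) - D (a0, x0)) < e"
    "\<And>a x y. norm (a - a0) \<le> r \<Longrightarrow> x \<in> cball x0 r \<Longrightarrow> y \<in> cball x0 r \<Longrightarrow>
      norm (\<Phi> (a, x) - \<Phi> (a, y) - D (a0, x0) (0, x - y)) \<le> e * norm (x - y)"
proof -
  obtain r where r: "0 < r" "\<And>z. norm (z - (a0, x0)) < r \<Longrightarrow> norm (D z - D (a0, x0)) < e"
    using continuous_blinfun_ball[OF cont e] by blast
  \<comment> \<open>A third of \<open>r\<close> in each component leaves the pair strictly inside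
    the ball of radius \<open>r\<close>.\<close>
  have near: "norm (D (a, z) - D (a0, x0)) < e" if "norm (a - a0) \<le> r / 3" "norm (z - x0) \<le> r / 3" for a z
    using norm_Pair_le[of "a - a0" "z - x0"] that r(1) by (intro r(2)) simp
  show thesis
  proof (rule that[of "r / 3"])
    fix a x y assume a: "norm (a - a0) \<le> r / 3" and xy: "x \<in> cball x0 (r / 3)" "y \<in> cball x0 (r / 3)"
    define f where "f x = \<Phi> (a, x) - D (a0, x0) (0, x)" for x
    have "norm (f x - f y) \<le> e * norm (x - y)"
    proof (rule differentiable_bound[OF convex_cball _ _ xy])
      fix z assume z: "z \<in> cball x0 (r / 3)"
      show "(f has_derivative blinfun_apply ((D (a, z) - D (a0, x0)) o\<^sub>L snd_embed)) (at z within cball x0 (r / 3))"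
        unfolding f_def
        by (rule derivative_eq_intros has_derivative_Pair_snd[OF der] refl)+
          (auto simp: blinfun.diff_left)
      have "norm ((D (a, z) - D (a0, x0)) o\<^sub>L snd_embed) \<le> e"
      proof (rule norm_blinfun_bound)
        fix v
        have "norm ((D (a, z) - D (a0, x0)) (0, v)) \<le> norm (D (a, z) - D (a0, x0)) * norm (0::'p, v)"
          by (rule norm_blinfun)
        also have "\<dots> \<le> e * norm v"
          using near[OF a, of z] z e by (intro mult_mono) (auto simp: norm_Pair dist_norm norm_minus_commute)
        finally show "norm (((D (a, z) - D (a0, x0)) o\<^sub>L snd_embed) v) \<le> e * norm v" by simp
      qed (use e in simp)
      then show "onorm (blinfun_apply ((D (a, z) - D (a0, x0)) o\<^sub>L snd_embed)) \<le> e"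
        by (simp add: norm_blinfun.rep_eq)
    qed
    moreover have "f x - f y = \<Phi> (a, x) - \<Phi> (a, y) - D (a0, x0) (0, x - y)"
      using blinfun.diff_right[of "D (a0, x0)" "(0, x)" "(0, y)"] by (simp add: f_def)
    ultimately show "norm (\<Phi> (a, x) - \<Phi> (a, y) - D (a0, x0) (0, x - y)) \<le> e * norm (x - y)"
      by simp
  qed (use r near in auto)
qed

text \<open>Let \<open>u\<close> be the error of the linear approximation. By the equation for
  \<open>y\<close>, \<open>D (0, u)\<close> is the full linearised increment of \<Phi>, and since
  \<Phi> vanishes along the curve it equals the remainder up to sign. The lower bound turns this
  into an estimate of \<open>u\<close>, in which the part proportional to \<open>norm u\<close> is
  absorbed.\<close>

lemma implicit_curve_has_derivative:
  fixes \<Phi> :: "real \<times> 'a::real_normed_vector \<Rightarrow> 'b::real_normed_vector"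
  assumes V: "subspace V" and S: "open S" "\<beta> \<in> S"
    and der: "(\<Phi> has_derivative D) (at (\<beta>, x \<beta>))"
    and x: "\<And>\<alpha>. \<alpha> \<in> S \<Longrightarrow> x \<alpha> \<in> V \<and> \<Phi> (\<alpha>, x \<alpha>) = 0" and cont: "continuous_on S x"
    and K: "0 < K" "\<And>v. v \<in> V \<Longrightarrow> norm v \<le> K * norm (D (0, v))"
    and y: "y \<in> V" "D (0, y) = - D (1, 0)"
  shows "(x has_vector_derivative y) (at \<beta>)"
  unfolding has_vector_derivative_def has_derivative_at_alt
proof (intro conjI allI impI bounded_linear_scaleR_left)
  interpret D: bounded_linear D using der by (rule has_derivative_bounded_linear)
  fix e :: real assume e: "0 < e"
  \<comment> \<open>The first bound lets half of \<open>norm u\<close> be absorbed; the second turns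
    what is left into \<open>e\<close> times the increment of the parameter.\<close>
  define \<epsilon> where "\<epsilon> = min (1 / (2 * K)) (e / (2 * K * (1 + norm y)))"
  have pos: "0 < 1 + norm y" by (simp add: add_pos_nonneg)
  have \<epsilon>: "0 < \<epsilon>" "K * \<epsilon> \<le> 1 / 2" "2 * K * \<epsilon> * (1 + norm y) \<le> e"
  proof -
    show "0 < \<epsilon>" using K e pos by (simp add: \<epsilon>_def)
    have "\<epsilon> \<le> 1 / (2 * K)" by (simp add: \<epsilon>_def)
    then show "K * \<epsilon> \<le> 1 / 2" using K by (simp add: field_simps)
    have "\<epsilon> \<le> e / (2 * K * (1 + norm y))" by (simp add: \<epsilon>_def)
    then have "\<epsilon> * (2 * K * (1 + norm y)) \<le> e"
      using K pos by (subst (asm) pos_le_divide_eq) auto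
    then show "2 * K * \<epsilon> * (1 + norm y) \<le> e" by (simp add: ac_simps)
  qed
  obtain d where d: "d > 0" "\<And>z. norm (z - (\<beta>, x \<beta>)) < d \<Longrightarrow>
      norm (\<Phi> z - \<Phi> (\<beta>, x \<beta>) - D (z - (\<beta>, x \<beta>))) \<le> \<epsilon> * norm (z - (\<beta>, x \<beta>))"
    using der \<epsilon>(1) unfolding has_derivative_at_alt by blast
  obtain \<eta> where \<eta>: "\<eta> > 0" "\<And>\<alpha>. \<alpha> \<in> S \<Longrightarrow> \<bar>\<alpha> - \<beta>\<bar> < \<eta> \<Longrightarrow> norm (x \<alpha> - x \<beta>) < d / 2"
    using cont S(2) half_gt_zero[OF d(1)] unfolding continuous_on_iff dist_norm real_norm_def by metis
  obtain \<eta>' where \<eta>': "\<eta>' > 0" "ball \<beta> \<eta>' \<subseteq> S" using S by (auto simp: open_contains_ball)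
  have "norm (x \<alpha> - x \<beta> - (\<alpha> - \<beta>) *\<^sub>R y) \<le> e * \<bar>\<alpha> - \<beta>\<bar>"
    if \<alpha>: "\<bar>\<alpha> - \<beta>\<bar> < min (min \<eta> \<eta>') (d / 2)" for \<alpha>
  proof -
    have \<alpha>S: "\<alpha> \<in> S" using \<alpha> \<eta>'(2) by (auto simp: dist_real_def abs_minus_commute)
    define u where "u = x \<alpha> - x \<beta> - (\<alpha> - \<beta>) *\<^sub>R y"
    have uV: "u \<in> V" using x[OF \<alpha>S] x[OF S(2)] y(1) V by (simp add: u_def subspace_diff subspace_scale)
    have nz: "norm ((\<alpha>, x \<alpha>) - (\<beta>, x \<beta>)) \<le> \<bar>\<alpha> - \<beta>\<bar> + norm (x \<alpha> - x \<beta>)"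
      using norm_Pair_le[of "\<alpha> - \<beta>" "x \<alpha> - x \<beta>"] by simp
    have "D ((\<alpha>, x \<alpha>) - (\<beta>, x \<beta>)) = D ((\<alpha> - \<beta>) *\<^sub>R (1, 0) + (0, u) + (\<alpha> - \<beta>) *\<^sub>R (0, y))"
      by (simp add: u_def)
    also have "\<dots> = D (0, u)" unfolding D.add D.scaleR y(2) by simp
    finally have Du: "D (0, u) = D ((\<alpha>, x \<alpha>) - (\<beta>, x \<beta>))" by simp
    have "norm (D (0, u)) \<le> \<epsilon> * norm ((\<alpha>, x \<alpha>) - (\<beta>, x \<beta>))"
      using d(2)[of "(\<alpha>, x \<alpha>)"] nz \<eta>(2)[OF \<alpha>S] \<alpha> x[OF \<alpha>S] x[OF S(2)] Du by simp
    also have "\<dots> \<le> \<epsilon> * (\<bar>\<alpha> - \<beta>\<bar> + norm (x \<alpha> - x \<beta>))"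
      using nz \<epsilon>(1) by (intro mult_left_mono) auto
    also have "norm (x \<alpha> - x \<beta>) \<le> norm u + \<bar>\<alpha> - \<beta>\<bar> * norm y"
      using norm_triangle_ineq[of u "(\<alpha> - \<beta>) *\<^sub>R y"] by (simp add: u_def)
    finally have Du_le: "norm (D (0, u)) \<le> \<epsilon> * (\<bar>\<alpha> - \<beta>\<bar> * (1 + norm y) + norm u)"
      using \<epsilon>(1) by (simp add: algebra_simps)
    have "norm u \<le> K * (\<epsilon> * (\<bar>\<alpha> - \<beta>\<bar> * (1 + norm y) + norm u))"
      using order_trans[OF K(2)[OF uV] mult_left_mono[OF Du_le]] K(1) by simp
    also have "\<dots> = K * \<epsilon> * (\<bar>\<alpha> - \<beta>\<bar> * (1 + norm y)) + (K * \<epsilon>) * norm u" by (simp add: algebra_simps)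
    also have "(K * \<epsilon>) * norm u \<le> 1 / 2 * norm u" using \<epsilon>(2) by (rule mult_right_mono) simp
    finally have "norm u \<le> (2 * K * \<epsilon> * (1 + norm y)) * \<bar>\<alpha> - \<beta>\<bar>" by (simp add: algebra_simps)
    also have "\<dots> \<le> e * \<bar>\<alpha> - \<beta>\<bar>" using \<epsilon>(3) by (rule mult_right_mono) simp
    finally show ?thesis by (simp add: u_def)
  qed
  then show "\<exists>d>0. \<forall>\<alpha>. norm (\<alpha> - \<beta>) < d \<longrightarrow> norm (x \<alpha> - x \<beta> - (\<alpha> - \<beta>) *\<^sub>R y) \<le> e * norm (\<alpha> - \<beta>)"
    using \<eta>(1) \<eta>'(1) d(1) by (intro exI[of _ "min (min \<eta> \<eta>') (d / 2)"]) auto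
qed

text \<open>Regularity of \<Phi> is expressed by how its derivative acts on curves. In this form it
  is available both for \<open>F\<close> and for maps defined by an integral.\<close>

lemma implicit_curve:
  fixes \<Phi> :: "real \<times> 'a::banach \<Rightarrow> 'b::real_normed_vector"
  assumes V: "subspace V" "closed V" and W: "subspace W" "closed W"
    and der: "\<And>z. (\<Phi> has_derivative blinfun_apply (D z)) (at z)"
    and cont: "continuous_on UNIV D"
    and Ck: "\<And>k S c. open S \<Longrightarrow> Ck_on k S (\<lambda>s t. c s) \<Longrightarrow> Ck_on k S (\<lambda>s t. D (c s))"
    and maps: "\<And>a x. x \<in> V \<Longrightarrow> \<Phi> (a, x) \<in> W"
    and x0: "x0 \<in> V" "\<Phi> (a0, x0) = 0"
    and iso: "isomorphism_between V W (\<lambda>v. D (a0, x0) (0, v)) K"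
  obtains \<delta> \<rho> x where "0 < \<delta>" "0 < \<rho>" "\<And>k. Ck_on k {a0 - \<delta><..<a0 + \<delta>} (\<lambda>s t. x s)" "x a0 = x0"
    "\<And>a. a \<in> {a0 - \<delta><..<a0 + \<delta>} \<Longrightarrow> x a \<in> V \<and> \<Phi> (a, x a) = 0"
    "\<And>a y. a \<in> {a0 - \<delta><..<a0 + \<delta>} \<Longrightarrow> y \<in> V \<Longrightarrow> y \<in> cball x0 \<rho> \<Longrightarrow> \<Phi> (a, y) = 0 \<Longrightarrow> y = x a"
proof -
  define T where "T v = D (a0, x0) (0, v)" for v
  have K: "K > 0" and lo: "\<And>v. v \<in> V \<Longrightarrow> norm v \<le> K * norm (T v)"
    using iso by (auto simp: isomorphism_between_def T_def)
  have linD: "linear (\<lambda>v. D z (0, v))" for z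
    by (rule linearI) (simp_all add: blinfun.add_right[symmetric] blinfun.scaleR_right[symmetric])
  define e where "e = 1 / (2 * K)"
  have e: "0 < e" "K * e \<le> 1 / 2" using K by (auto simp: e_def)
  obtain \<rho> where \<rho>: "0 < \<rho>"
    "\<And>a z. norm (a - a0) \<le> \<rho> \<Longrightarrow> norm (z - x0) \<le> \<rho> \<Longrightarrow> norm (D (a, z) - D (a0, x0)) < e"
    "\<And>a x y. norm (a - a0) \<le> \<rho> \<Longrightarrow> x \<in> cball x0 \<rho> \<Longrightarrow> y \<in> cball x0 \<rho> \<Longrightarrow>
      norm (\<Phi> (a, x) - \<Phi> (a, y) - T (x - y)) \<le> e * norm (x - y)"
    unfolding T_def using strict_derivative_snd[OF der cont e(1)] by blast
  have cont\<Phi>: "continuous_on UNIV \<Phi>"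
    by (intro continuous_at_imp_continuous_on ballI has_derivative_continuous[OF der])
  have "continuous_on UNIV (\<lambda>a. \<Phi> (a, y))" for y
    by (rule continuous_on_compose2[OF cont\<Phi>]) (auto intro!: continuous_intros)
  then have cont_a: "((\<lambda>a. \<Phi> (a, y)) \<longlongrightarrow> \<Phi> (b, y)) (at b)" for y b
    by (simp add: continuous_on_def)
  \<comment> \<open>The threshold from the fixed point argument: a value of \<Phi> below it at
    \<open>x0\<close> guarantees a zero within distance \<rho>.\<close>
  have "0 < \<rho> / (2 * K)" using K \<rho>(1) by simp
  then obtain \<delta>1 where \<delta>1: "\<delta>1 > 0" "\<And>a. \<bar>a - a0\<bar> < \<delta>1 \<Longrightarrow> norm (\<Phi> (a, x0)) < \<rho> / (2 * K)"
    using cont_a[of x0 a0] x0(2) unfolding LIM_def dist_norm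
    by (metis diff_0_right norm_zero real_norm_def cancel_comm_monoid_add_class.diff_cancel)
  define \<delta> where "\<delta> = min \<rho> \<delta>1"
  have \<delta>: "\<delta> > 0" "\<delta> \<le> \<rho>" "\<delta> \<le> \<delta>1" using \<rho>(1) \<delta>1(1) by (auto simp: \<delta>_def)
  define S where "S = {a0 - \<delta><..<a0 + \<delta>}"
  have S: "open S" and a0S: "a0 \<in> S" using \<delta> by (auto simp: S_def)
  have near: "norm (a - a0) \<le> \<rho>" if "a \<in> S" for a
    using that \<delta>(2) by (auto simp: S_def)
  have "\<exists>x\<in>V \<inter> cball x0 \<rho>. \<Phi> (a, x) = 0" if a: "a \<in> S" for a
  proof (rule near_isomorphism_zero[of T V W K e x0])
    show "linear T" using linD[of "(a0, x0)"] by (simp add: T_def[abs_def])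
    show "isomorphism_between V W T K" using iso by (simp add: T_def[abs_def])
    have "norm (\<Phi> (a, x0)) < \<rho> / (2 * K)" using a \<delta>(3) by (intro \<delta>1(2)) (auto simp: S_def)
    then show "2 * K * norm (\<Phi> (a, x0)) \<le> \<rho>" using K by (simp add: field_simps)
  qed (use V e x0 maps \<rho>(3)[OF near[OF a]] in auto)
  then obtain x where x: "\<And>a. a \<in> S \<Longrightarrow> x a \<in> V" "\<And>a. a \<in> S \<Longrightarrow> x a \<in> cball x0 \<rho>"
    "\<And>a. a \<in> S \<Longrightarrow> \<Phi> (a, x a) = 0"
    by (metis IntE)
  \<comment> \<open>Quantitative injectivity for a fixed parameter, from which both uniqueness of
    the zero and continuity of the curve follow.\<close>
  have diff: "norm (y - z) \<le> 2 * K * norm (\<Phi> (a, y) - \<Phi> (a, z))"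
    if a: "a \<in> S" and yz: "y \<in> V" "z \<in> V" "y \<in> cball x0 \<rho>" "z \<in> cball x0 \<rho>" for a y z
  proof -
    have "norm (T (y - z)) \<le> norm (\<Phi> (a, y) - \<Phi> (a, z)) + e * norm (y - z)"
      using \<rho>(3)[OF near[OF a] yz(3,4)]
        norm_triangle_ineq4[of "\<Phi> (a, y) - \<Phi> (a, z)" "\<Phi> (a, y) - \<Phi> (a, z) - T (y - z)"] by simp
    then have "norm (y - z) \<le> K * (norm (\<Phi> (a, y) - \<Phi> (a, z)) + e * norm (y - z))"
      using lo[of "y - z"] yz(1,2) V(1) K by (meson mult_le_cancel_left_pos order_trans subspace_diff)
    also have "\<dots> = K * norm (\<Phi> (a, y) - \<Phi> (a, z)) + norm (y - z) / 2"
      using K by (simp add: e_def field_simps)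
    finally show ?thesis by simp
  qed
  have uniq: "y = x a" if "a \<in> S" "y \<in> V" "y \<in> cball x0 \<rho>" "\<Phi> (a, y) = 0" for a y
    using diff[OF that(1,2) x(1)[OF that(1)] that(3) x(2)[OF that(1)]] that(4) x(3)[OF that(1)] by simp
  have contx: "continuous_on S x"
    unfolding continuous_on_def
  proof
    fix b assume b: "b \<in> S"
    have "((\<lambda>a. 2 * K * norm (\<Phi> (a, x b))) \<longlongrightarrow> 2 * K * norm (\<Phi> (b, x b))) (at b within S)"
      by (intro tendsto_intros tendsto_within_subset[OF cont_a]) auto
    then have lim: "((\<lambda>a. 2 * K * norm (\<Phi> (a, x b))) \<longlongrightarrow> 0) (at b within S)"
      using x(3)[OF b] by simp
    have "norm (x a - x b) \<le> 2 * K * norm (\<Phi> (a, x b))" if "a \<in> S" for a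
      using diff[OF that x(1)[OF that] x(1)[OF b] x(2)[OF that] x(2)[OF b]] x(3)[OF that] by simp
    then have "\<forall>\<^sub>F a in at b within S. norm (x a - x b) \<le> 2 * K * norm (\<Phi> (a, x b))"
      unfolding eventually_at_filter by (intro always_eventually) auto
    from Lim_null_comparison[OF this lim] show "(x \<longlongrightarrow> x b) (at b within S)"
      by (simp add: LIM_zero_iff)
  qed
  define M where "M a = D (a, x a) o\<^sub>L snd_embed" for a
  define b where "b a = - D (a, x a) (1, 0)" for a
  \<comment> \<open>The right-hand side \<open>b\<close> is a derivative in the parameter direction.
    For it to lie in \<open>W\<close>, \<Phi> has to be viewed on the product of the real line with
    \<open>V\<close>.\<close>
  have V': "subspace (UNIV \<times> V :: (real \<times> 'a) set)" using V(1) by (auto simp: subspace_def zero_prod_def)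
  have DW: "D (a, x a) (\<mu>, v) \<in> W" if "a \<in> S" "v \<in> V" for a \<mu> v
    by (rule derivative_maps_into_closed_subspace[OF V' W der]) (use that x(1) maps in auto)
  have isoM: "isomorphism_between V W (M a) (2 * K)" if a: "a \<in> S" for a
  proof (rule isomorphism_between_perturb[OF _ V W(1) _ _ _ e(2)])
    show "linear T" using linD[of "(a0, x0)"] by (simp add: T_def[abs_def])
    show "isomorphism_between V W T K" using iso by (simp add: T_def[abs_def])
    show "linear (blinfun_apply (M a))"
      using linD[of "(a, x a)"] by (simp add: M_def linear_iff)
    show "M a v \<in> W" if "v \<in> V" for v using DW[OF a that, of 0] by (simp add: M_def)
    show "norm (M a v - T v) \<le> e * norm v" for v
    proof -
      have "norm ((D (a, x a) - D (a0, x0)) (0, v)) \<le> norm (D (a, x a) - D (a0, x0)) * norm (0::real, v)"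
        by (rule norm_blinfun)
      also have "\<dots> \<le> e * norm v"
        using \<rho>(2)[OF near[OF a], of "x a"] x(2)[OF a] e(1)
        by (intro mult_mono) (auto simp: norm_Pair dist_norm norm_minus_commute)
      finally show ?thesis by (simp add: M_def T_def blinfun.diff_left)
    qed
  qed
  have "\<exists>y\<in>V. M a y = b a" if a: "a \<in> S" for a
  proof -
    have "b a \<in> W" using DW[OF a subspace_0[OF V(1)], of "-1"]
      by (simp add: b_def blinfun.minus_right[symmetric])
    then have "b a \<in> M a ` V" using isoM[OF a] by (simp add: isomorphism_between_def)
    then show ?thesis by auto
  qed
  then obtain y where y: "\<And>a. a \<in> S \<Longrightarrow> y a \<in> V \<and> M a (y a) = b a" by metis
  have derx: "(x has_vector_derivative y a) (at a)" if a: "a \<in> S" for a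
    by (rule implicit_curve_has_derivative[OF V(1) S a der _ contx, of "2 * K"])
      (use x y[OF a] isoM[OF a] K in \<open>auto simp: M_def b_def isomorphism_between_def\<close>)
  have contx': "continuous_on (S \<times> {0..1}) (\<lambda>(s, t). x s)"
    unfolding split_beta'
    by (rule continuous_on_compose2[OF contx]) (auto intro: continuous_intros)
  \<comment> \<open>Bootstrapping: if \<open>x\<close> has regularity \<open>k\<close>, so have the
    coefficients \<open>M\<close> and \<open>b\<close>, hence also the solution \<open>y\<close> of
    \<open>M y = b\<close>, which is the velocity of \<open>x\<close>.\<close>
  have Ckx: "Ck_on k S (\<lambda>s t. x s)" for k
  proof (induction k)
    case 0
    then show ?case using contx' by simp
  next
    case (Suc k)
    have Dk: "Ck_on k S (\<lambda>s t. D (s, x s))" by (rule Ck[OF S Ck_on_Pair[OF Ck_on_self Suc]])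
    have Cky: "Ck_on k S (\<lambda>s t. y s)"
    proof (rule Ck_on_solve[OF S V(1) W isoM])
      show "Ck_on k S (\<lambda>s t. M s)"
        unfolding M_def by (intro bounded_bilinear.Ck_on[OF bounded_bilinear_blinfun_compose] Dk Ck_on_const)
      have "Ck_on k S (\<lambda>s t. 0 - D (s, x s) (1, 0))"
        by (intro Ck_on_diff blinfun.Ck_on Dk Ck_on_const)
      then show "Ck_on k S (\<lambda>s t. b s)" by (simp add: b_def)
    qed (use y in auto)
    show ?case by (rule Ck_on_SucI[OF contx' derx Cky])
  qed
  show thesis
  proof (rule that)
    show "x a0 = x0" using uniq[OF a0S x0(1) _ x0(2)] \<rho>(1) by simp
    show "x a \<in> V \<and> \<Phi> (a, x a) = 0" if "a \<in> {a0 - \<delta><..<a0 + \<delta>}" for a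
      using x that unfolding S_def by blast
  qed (fact \<delta>(1) \<rho>(1) Ckx[unfolded S_def] uniq[unfolded S_def])+
qed

section \<open>Derivatives of the operator and the extended system\<close>

lemma integral_derivative_along_segment:
  fixes f :: "'a::real_normed_vector \<Rightarrow> 'b::banach"
  assumes "\<And>z. (f has_derivative blinfun_apply (D z)) (at z)"
  shows "integral {0..1} (\<lambda>t. D (p + t *\<^sub>R v) v) = f (p + v) - f p"
proof -
  have "((\<lambda>t. f (p + t *\<^sub>R v)) has_vector_derivative D (p + t *\<^sub>R v) v) (at t within {0..1})" for t
  proof -
    have "((\<lambda>t. p + t *\<^sub>R v) has_derivative (\<lambda>t. t *\<^sub>R v)) (at t within {0..1})"
      by (auto intro!: derivative_eq_intros)
    from has_derivative_compose[OF this assms] show ?thesis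
      by (simp add: has_vector_derivative_def blinfun.scaleR_right)
  qed
  then have "((\<lambda>t. D (p + t *\<^sub>R v) v) has_integral f (p + 1 *\<^sub>R v) - f (p + 0 *\<^sub>R v)) {0..1}"
    by (intro fundamental_theorem_of_calculus) auto
  then show ?thesis by (simp add: integral_unique)
qed

text \<open>The increment of \<open>f\<close> by \<open>v\<close> is an integral over the segment;
  differentiating this identity in direction \<open>a\<close> writes
  \<open>D (z + v) a - D z a\<close> as the integral of
  \<open>D2 (z + \<tau> *\<^sub>R v) a v\<close>. For \<open>v = t *\<^sub>R b\<close>, division by
  \<open>t\<close> and the limit at 0 give \<open>D2 z b a\<close> on one side and
  \<open>D2 z a b\<close> on the other.\<close>

lemma second_derivative_symmetric:
  fixes f :: "'a::real_normed_vector \<Rightarrow> 'b::banach" and D2 :: "'a \<Rightarrow> 'a \<Rightarrow>\<^sub>L 'a \<Rightarrow>\<^sub>L 'b"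
  assumes D: "\<And>z. (f has_derivative blinfun_apply (D z)) (at z)"
    and D2: "\<And>z. (D has_derivative blinfun_apply (D2 z)) (at z)" and cont: "continuous_on UNIV D2"
  shows "D2 z a b = D2 z b a"
proof -
  have contD: "continuous_on UNIV D"
    by (intro continuous_at_imp_continuous_on ballI has_derivative_continuous[OF D2])
  note [continuous_intros] = continuous_on_compose2[OF contD] continuous_on_compose2[OF cont]
  have dir: "((\<lambda>s. g (q + s *\<^sub>R c)) has_vector_derivative g' (q + s *\<^sub>R c) c) (at s within S)"
    if "\<And>z. (g has_derivative blinfun_apply (g' z)) (at z)"
    for g :: "'a \<Rightarrow> 'c::real_normed_vector" and g' q s S c
  proof -
    have "((\<lambda>s. q + s *\<^sub>R c) has_derivative (\<lambda>t. t *\<^sub>R c)) (at s within S)"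
      by (auto intro!: derivative_eq_intros)
    from has_derivative_compose[OF this that] show ?thesis
      by (simp add: has_vector_derivative_def blinfun.scaleR_right)
  qed
  have eq: "D (z + v) a - D z a = integral {0..1} (\<lambda>\<tau>. D2 (z + \<tau> *\<^sub>R v) a v)" for v
  proof -
    have "((\<lambda>s. integral (cbox 0 1) (\<lambda>\<tau>. D (z + s *\<^sub>R a + \<tau> *\<^sub>R v) v)) has_vector_derivative
        integral (cbox 0 1) (\<lambda>\<tau>. D2 (z + 0 *\<^sub>R a + \<tau> *\<^sub>R v) a v)) (at (0::real) within UNIV)"
    proof (rule leibniz_rule_vector_derivative)
      fix s \<tau> :: real
      have "((\<lambda>s. D ((z + \<tau> *\<^sub>R v) + s *\<^sub>R a)) has_vector_derivative D2 ((z + \<tau> *\<^sub>R v) + s *\<^sub>R a) a)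
          (at s within UNIV)"
        by (rule dir[OF D2])
      then have "((\<lambda>s. D ((z + \<tau> *\<^sub>R v) + s *\<^sub>R a) v) has_vector_derivative D2 ((z + \<tau> *\<^sub>R v) + s *\<^sub>R a) a v)
          (at s within UNIV)"
        by (rule bounded_linear.has_vector_derivative[OF blinfun.bounded_linear_left])
      then show "((\<lambda>s. D (z + s *\<^sub>R a + \<tau> *\<^sub>R v) v) has_vector_derivative D2 (z + s *\<^sub>R a + \<tau> *\<^sub>R v) a v)
          (at s within UNIV)"
        by (simp add: add.commute add.left_commute)
    next
      show "(\<lambda>\<tau>. D (z + s *\<^sub>R a + \<tau> *\<^sub>R v) v) integrable_on cbox 0 1" for s :: real
        by (rule integrable_continuous) (auto intro!: continuous_intros)
      show "continuous_on (UNIV \<times> cbox 0 1) (\<lambda>(s, \<tau>). D2 (z + s *\<^sub>R a + \<tau> *\<^sub>R v) a v)"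
        by (auto simp: split_beta' intro!: continuous_intros)
    qed auto
    moreover have "((\<lambda>s. f (z + v + s *\<^sub>R a) - f (z + s *\<^sub>R a)) has_vector_derivative
        D (z + v + 0 *\<^sub>R a) a - D (z + 0 *\<^sub>R a) a) (at (0::real) within UNIV)"
      by (intro has_vector_derivative_diff dir[OF D])
    moreover have "(\<lambda>s. integral (cbox 0 1) (\<lambda>\<tau>. D (z + s *\<^sub>R a + \<tau> *\<^sub>R v) v)) =
        (\<lambda>s. f (z + v + s *\<^sub>R a) - f (z + s *\<^sub>R a))"
    proof
      fix s
      have eq: "z + s *\<^sub>R a + v = z + v + s *\<^sub>R a" by simp
      show "integral (cbox 0 1) (\<lambda>\<tau>. D (z + s *\<^sub>R a + \<tau> *\<^sub>R v) v) = f (z + v + s *\<^sub>R a) - f (z + s *\<^sub>R a)"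
        using integral_derivative_along_segment[OF D, of "z + s *\<^sub>R a" v] unfolding eq by simp
    qed
    ultimately show ?thesis
      by (auto dest: vector_derivative_unique_at)
  qed
  have "((\<lambda>t. D (z + t *\<^sub>R b)) has_vector_derivative D2 (z + 0 *\<^sub>R b) b) (at 0 within UNIV)"
    by (rule dir[OF D2])
  then have "((\<lambda>t. D (z + t *\<^sub>R b) a) has_vector_derivative D2 (z + 0 *\<^sub>R b) b a) (at 0 within UNIV)"
    by (rule bounded_linear.has_vector_derivative[OF blinfun.bounded_linear_left])
  then have "((\<lambda>t. (D (z + t *\<^sub>R b) a - D z a) /\<^sub>R t) \<longlongrightarrow> D2 z b a) (at 0)"
    by (simp add: has_vector_derivative_iff_quotient)
  moreover have "\<forall>\<^sub>F t in at 0. (D (z + t *\<^sub>R b) a - D z a) /\<^sub>R t =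
      integral (cbox 0 1) (\<lambda>\<tau>. D2 (z + (\<tau> * t) *\<^sub>R b) a b)"
    unfolding eventually_at_filter eq
    by (intro always_eventually) (auto simp: blinfun.scaleR_right)
  ultimately have "((\<lambda>t. integral (cbox 0 1) (\<lambda>\<tau>. D2 (z + (\<tau> * t) *\<^sub>R b) a b)) \<longlongrightarrow> D2 z b a) (at 0)"
    by (rule Lim_transform_eventually)
  moreover have "continuous_on UNIV (\<lambda>t::real. integral (cbox 0 1) (\<lambda>\<tau>. D2 (z + (\<tau> * t) *\<^sub>R b) a b))"
    by (rule integral_continuous_on_param) (auto simp: split_beta' intro!: continuous_intros)
  then have "((\<lambda>t. integral (cbox 0 1) (\<lambda>\<tau>. D2 (z + (\<tau> * t) *\<^sub>R b) a b)) \<longlongrightarrow>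
      integral (cbox 0 1) (\<lambda>\<tau>. D2 (z + (\<tau> * 0) *\<^sub>R b) a b)) (at 0)"
    unfolding continuous_on_def by blast
  ultimately have "D2 z b a = integral (cbox 0 (1::real)) (\<lambda>\<tau>. D2 (z + (\<tau> * 0) *\<^sub>R b) a b)"
    by (rule tendsto_unique[OF trivial_limit_at])
  then show ?thesis by simp
qed

lemma has_derivative_Pair_fst:
  assumes "(f has_derivative blinfun_apply f') (at (l, u))"
  shows "((\<lambda>t. f (t, u)) has_vector_derivative f' (1, 0)) (at l)"
proof -
  have pair: "((\<lambda>t. (t, u)) has_derivative (\<lambda>t. (t, 0))) (at l)"
    by (auto intro!: derivative_eq_intros)
  have "f' (t, 0) = t *\<^sub>R f' (1, 0)" for t
    by (simp add: blinfun.scaleR_right[symmetric])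
  then show ?thesis
    unfolding has_vector_derivative_def
    by (intro has_derivative_eq_rhs[OF has_derivative_compose[OF pair assms]] ext)
qed

text \<open>With the first two total derivatives fixed as smooth operator-valued maps, the partial
  derivatives occurring in (SB) become evaluations of them.\<close>

locale parametrized_operator =
  fixes F :: "real \<times> 'x::banach \<Rightarrow> 'y::banach" and DF :: "real \<times> 'x \<Rightarrow> (real \<times> 'x) \<Rightarrow>\<^sub>L 'y"
    and D2F :: "real \<times> 'x \<Rightarrow> (real \<times> 'x) \<Rightarrow>\<^sub>L (real \<times> 'x) \<Rightarrow>\<^sub>L 'y"
  assumes smooth_DF: "smooth_on UNIV DF" and smooth_D2F: "smooth_on UNIV D2F"
    and DF: "\<And>z. (F has_derivative blinfun_apply (DF z)) (at z)"
    and D2F: "\<And>z. (DF has_derivative blinfun_apply (D2F z)) (at z)"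

lemma smooth_imp_parametrized_operator:
  fixes F :: "real \<times> 'x::banach \<Rightarrow> 'y::banach"
  assumes "smooth_on UNIV F"
  obtains DF D2F where "parametrized_operator F DF D2F"
proof -
  obtain DF where DF: "smooth_on UNIV DF" "\<And>z. (F has_derivative blinfun_apply (DF z)) (at z)"
    using smooth_on_UNIV_derivative[OF assms] by blast
  obtain D2F where "smooth_on UNIV D2F" "\<And>z. (DF has_derivative blinfun_apply (D2F z)) (at z)"
    using smooth_on_UNIV_derivative[OF DF(1)] by blast
  with DF show thesis by (intro that) unfold_locales
qed

section \<open>Partial derivatives and the smooth difference quotient\<close>

context parametrized_operator
begin

lemma continuous_on_DF: "continuous_on S DF"
  by (rule smooth_on_UNIV_continuous_on[OF smooth_DF])

lemma continuous_on_D2F: "continuous_on S D2F"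
  by (rule smooth_on_UNIV_continuous_on[OF smooth_D2F])

lemma D2F_symmetric: "D2F z a b = D2F z b a"
  by (rule second_derivative_symmetric[OF DF D2F continuous_on_D2F])

lemma D_u_eq: "D_u F l u = DF (l, u) o\<^sub>L snd_embed"
proof -
  have "((\<lambda>v. F (l, v)) has_derivative blinfun_apply (DF (l, u) o\<^sub>L snd_embed)) (at u)"
    by (rule has_derivative_eq_rhs[OF has_derivative_Pair_snd[OF DF]]) (simp add: fun_eq_iff)
  then show ?thesis
    unfolding D_u_def by (simp only: frechet_derivative_at[symmetric] blinfun_apply_inverse)
qed

lemma D_l_eq: "D_l F l u = DF (l, u) (1, 0)"
  unfolding D_l_def by (rule vector_derivative_at[OF has_derivative_Pair_fst[OF DF]])

lemma D_lu_eq: "D_lu F l u = D2F (l, u) (1, 0) o\<^sub>L snd_embed"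
proof -
  have "((\<lambda>t. DF (t, u) o\<^sub>L snd_embed) has_vector_derivative D2F (l, u) (1, 0) o\<^sub>L snd_embed) (at l)"
    by (rule bounded_linear.has_vector_derivative[OF
          bounded_bilinear.bounded_linear_left[OF bounded_bilinear_blinfun_compose]
          has_derivative_Pair_fst[OF D2F]])
  then show ?thesis unfolding D_lu_def D_u_eq by (rule vector_derivative_at)
qed

lemma D_uu_eq: "D_uu F l u v w = D2F (l, u) (0, v) (0, w)"
proof -
  have "((\<lambda>v. DF (l, v)) has_derivative (\<lambda>v. D2F (l, u) (0, v))) (at u)"
    by (rule has_derivative_Pair_snd[OF D2F])
  from bounded_linear.has_derivative[OF
      bounded_bilinear.bounded_linear_left[OF bounded_bilinear_blinfun_compose] this]
  have "((\<lambda>v. D_u F l v) has_derivative (\<lambda>v. D2F (l, u) (0, v) o\<^sub>L snd_embed)) (at u)"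
    unfolding D_u_eq .
  then have "D_uu F l u = Blinfun (\<lambda>v. D2F (l, u) (0, v) o\<^sub>L snd_embed)"
    "bounded_linear (\<lambda>v. D2F (l, u) (0, v) o\<^sub>L snd_embed)"
    unfolding D_uu_def by (simp_all add: frechet_derivative_at[symmetric] has_derivative_bounded_linear)
  then show ?thesis by (simp add: bounded_linear_Blinfun_apply)
qed

text \<open>On \<open>z = (\<alpha>, \<lambda>, u, \<phi>)\<close> the difference quotient
  \<open>(F (\<lambda>, u + \<alpha> \<phi>) - F (\<lambda>, u)) / \<alpha>\<close>, extended smoothly to \<open>\<alpha> = 0\<close> by its integral form.\<close>

definition base :: "(real \<times> real \<times> 'x \<times> 'x) \<Rightarrow>\<^sub>L (real \<times> 'x)" where
  "base = Blinfun (\<lambda>(\<alpha>, l, u, \<phi>). (l, u))"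

definition direction :: "(real \<times> real \<times> 'x \<times> 'x) \<Rightarrow>\<^sub>L (real \<times> 'x)" where
  "direction = Blinfun (\<lambda>(\<alpha>, l, u, \<phi>). (0, \<phi>))"

lemma base_apply [simp]: "base (\<alpha>, l, u, \<phi>) = (l, u)"
proof -
  have "bounded_linear (\<lambda>(\<alpha>::real, l::real, u::'x, \<phi>::'x). (l, u))"
    unfolding split_beta' by (intro bounded_linear_intros)
  then show ?thesis unfolding base_def by (simp add: bounded_linear_Blinfun_apply)
qed

lemma direction_apply [simp]: "direction (\<alpha>, l, u, \<phi>) = (0, \<phi>)"
proof -
  have "bounded_linear (\<lambda>(\<alpha>::real, l::real, u::'x, \<phi>::'x). (0::real, \<phi>))"
    unfolding split_beta' by (intro bounded_linear_intros)
  then show ?thesis unfolding direction_def by (simp add: bounded_linear_Blinfun_apply)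
qed

definition seg :: "real \<Rightarrow> real \<times> real \<times> 'x \<times> 'x \<Rightarrow> real \<times> 'x" where
  "seg t z = base z + (t * fst_blinfun z) *\<^sub>R direction z"

definition Dseg :: "real \<Rightarrow> real \<times> real \<times> 'x \<times> 'x \<Rightarrow> (real \<times> real \<times> 'x \<times> 'x) \<Rightarrow>\<^sub>L (real \<times> 'x)" where
  "Dseg t z = base + t *\<^sub>R (blinfun_scaleR_left (direction z) o\<^sub>L fst_blinfun) + (t * fst_blinfun z) *\<^sub>R direction"

definition quot_integrand :: "real \<Rightarrow> real \<times> real \<times> 'x \<times> 'x \<Rightarrow> 'y" where
  "quot_integrand t z = DF (seg t z) (direction z)"

text \<open>Product rule for the evaluation of the operator \<open>DF (seg t z)\<close> at the
  vector \<open>direction z\<close>: in the first summand the operator varies and is then evaluated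
  by \<open>blinfun.prod_left\<close>, in the second the vector varies.\<close>

definition Dquot_integrand :: "real \<Rightarrow> real \<times> real \<times> 'x \<times> 'x \<Rightarrow> (real \<times> real \<times> 'x \<times> 'x) \<Rightarrow>\<^sub>L 'y" where
  "Dquot_integrand t z =
     ((blinfun.prod_left (direction z) o\<^sub>L D2F (seg t z)) o\<^sub>L Dseg t z) + (DF (seg t z) o\<^sub>L direction)"

definition quot :: "real \<times> real \<times> 'x \<times> 'x \<Rightarrow> 'y" where
  "quot z = integral {0..1} (\<lambda>t. quot_integrand t z)"

definition Dquot :: "real \<times> real \<times> 'x \<times> 'x \<Rightarrow> (real \<times> real \<times> 'x \<times> 'x) \<Rightarrow>\<^sub>L 'y" where
  "Dquot z = integral {0..1} (\<lambda>t. Dquot_integrand t z)"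

lemma has_derivative_seg: "(seg t has_derivative blinfun_apply (Dseg t z)) (at z within S)"
  unfolding seg_def Dseg_def
  by (rule derivative_eq_intros refl)+ (auto simp: blinfun.bilinear_simps scaleR_add_left)

lemma has_derivative_quot_integrand:
  "(quot_integrand t has_derivative blinfun_apply (Dquot_integrand t z)) (at z within S)"
proof -
  have "((\<lambda>z. DF (seg t z)) has_derivative (\<lambda>h. D2F (seg t z) (Dseg t z h))) (at z within S)"
    by (rule has_derivative_compose[OF has_derivative_seg D2F])
  from blinfun.FDERIV[OF this bounded_linear_imp_has_derivative[OF blinfun.bounded_linear_right[of direction]]]
  show ?thesis
    unfolding quot_integrand_def[abs_def] Dquot_integrand_def
    by (rule has_derivative_eq_rhs) (simp add: fun_eq_iff blinfun.add_left add.commute)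
qed

lemma continuous_on_seg: "continuous_on S f \<Longrightarrow> continuous_on S g \<Longrightarrow> continuous_on S (\<lambda>x. seg (f x) (g x))"
  unfolding seg_def by (intro continuous_intros)

lemma continuous_on_quot_integrand:
  "continuous_on S f \<Longrightarrow> continuous_on S g \<Longrightarrow> continuous_on S (\<lambda>x. quot_integrand (f x) (g x))"
  unfolding quot_integrand_def
  by (intro continuous_intros continuous_on_seg continuous_on_compose2[OF continuous_on_DF[of UNIV]]) auto

lemma continuous_on_Dquot_integrand:
  assumes "continuous_on S f" "continuous_on S g"
  shows "continuous_on S (\<lambda>x. Dquot_integrand (f x) (g x))"
  unfolding Dquot_integrand_def Dseg_def using assms
  by (intro continuous_intros continuous_on_seg continuous_on_compose2[OF continuous_on_DF[of UNIV]]
      continuous_on_compose2[OF continuous_on_D2F[of UNIV]]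
      bounded_linear.continuous_on[OF blinfun.bounded_linear_prod_left]
      bounded_linear.continuous_on[OF bounded_linear_blinfun_scaleR_left]) auto

text \<open>Here the parameter \<open>t\<close> of the curve calculus acquires its meaning as the
  position on the segment, over which the integral is taken afterwards.\<close>

lemma Ck_on_Dquot_integrand:
  assumes "Ck_on k S c"
  shows "Ck_on k S (\<lambda>s t. Dquot_integrand t (c s t))"
proof -
  note bl = bounded_linear.Ck_on[OF bounded_linear_blinfun_apply[OF bounded_linear_ident]]
  have seg: "Ck_on k S (\<lambda>s t. seg t (c s t))"
    unfolding seg_def
    by (intro Ck_on_add bounded_bilinear.Ck_on[OF bounded_bilinear_scaleR]
        bounded_bilinear.Ck_on[OF bounded_bilinear_mult] Ck_on_param bl assms)
  have Dseg: "Ck_on k S (\<lambda>s t. Dseg t (c s t))"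
    unfolding Dseg_def
    by (intro Ck_on_add bounded_bilinear.Ck_on[OF bounded_bilinear_scaleR]
        bounded_bilinear.Ck_on[OF bounded_bilinear_mult] Ck_on_param Ck_on_const
        bounded_bilinear.Ck_on[OF bounded_bilinear_blinfun_compose]
        bounded_linear.Ck_on[OF bounded_linear_blinfun_scaleR_left] bl assms)
  show ?thesis
    unfolding Dquot_integrand_def
    by (intro Ck_on_add bounded_bilinear.Ck_on[OF bounded_bilinear_blinfun_compose] Dseg
        bounded_linear.Ck_on[OF blinfun.bounded_linear_prod_left] Ck_on_const
        Ck_on_smooth[OF smooth_DF] Ck_on_smooth[OF smooth_D2F] seg bl assms)
qed

lemma has_derivative_quot: "(quot has_derivative blinfun_apply (Dquot z)) (at z)"
proof -
  have "((\<lambda>z. integral (cbox 0 1) (\<lambda>t. quot_integrand t z)) has_derivative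
      blinfun_apply (integral (cbox 0 1) (\<lambda>t. Dquot_integrand t z))) (at z within UNIV)"
    by (rule leibniz_rule[where fx="\<lambda>z t. Dquot_integrand t z"])
      (auto intro!: has_derivative_quot_integrand integrable_continuous_real continuous_on_quot_integrand
        continuous_on_Dquot_integrand continuous_intros simp: split_beta')
  then show ?thesis by (simp add: quot_def[abs_def] Dquot_def)
qed

lemma continuous_on_Dquot: "continuous_on UNIV Dquot"
proof -
  have "continuous_on UNIV (\<lambda>z. integral (cbox 0 1) (\<lambda>t. Dquot_integrand t z))"
    by (rule integral_continuous_on_param)
      (auto intro!: continuous_on_Dquot_integrand continuous_intros simp: split_beta')
  then show ?thesis by (simp add: Dquot_def[abs_def])
qed

lemma Ck_on_Dquot:
  assumes "open S" "Ck_on k S (\<lambda>s t. c s)"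
  shows "Ck_on k S (\<lambda>s t. Dquot (c s))"
  unfolding Dquot_def by (rule Ck_on_integral[OF assms(1) Ck_on_Dquot_integrand[OF assms(2)]])

text \<open>The fundamental theorem of calculus on the segment, with the factor \<alpha> moved into
  the direction. No division occurs, so \<alpha> = 0 is included.\<close>

lemma quot_difference: "\<alpha> *\<^sub>R quot (\<alpha>, l, u, \<phi>) = F (l, u + \<alpha> *\<^sub>R \<phi>) - F (l, u)"
proof -
  have "\<alpha> *\<^sub>R quot (\<alpha>, l, u, \<phi>) = integral {0..1} (\<lambda>t. DF ((l, u) + t *\<^sub>R (0, \<alpha> *\<^sub>R \<phi>)) (0, \<alpha> *\<^sub>R \<phi>))"
    unfolding quot_def integral_cmul[symmetric] quot_integrand_def seg_def
    by (simp add: blinfun.scaleR_right[symmetric])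
  then show ?thesis
    using integral_derivative_along_segment[OF DF, of "(l, u)" "(0, \<alpha> *\<^sub>R \<phi>)"] by simp
qed

lemma quot_zero: "quot (0, l, u, \<phi>) = DF (l, u) (0, \<phi>)"
  by (simp add: quot_def quot_integrand_def seg_def)

text \<open>At \<alpha> = 0 the segment shrinks to a point, and for increments without
  \<alpha>-component the integrand is constant in \<open>t\<close>. What remains is the derivative
  of \<open>DF (l, u) (0, \<phi>)\<close>, the third component of the extended system.\<close>

lemma Dquot_zero: "Dquot (0, l, u, \<phi>) (0, \<mu>, v, \<eta>) = D2F (l, u) (\<mu>, v) (0, \<phi>) + DF (l, u) (0, \<eta>)"
proof -
  have int: "(\<lambda>t. Dquot_integrand t (0, l, u, \<phi>)) integrable_on {0..1}"
    by (auto intro!: integrable_continuous_real continuous_on_Dquot_integrand continuous_intros)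
  have "Dquot (0, l, u, \<phi>) (0, \<mu>, v, \<eta>) =
      integral {0..1} ((\<lambda>D. blinfun_apply D (0, \<mu>, v, \<eta>)) \<circ> (\<lambda>t. Dquot_integrand t (0, l, u, \<phi>)))"
    unfolding Dquot_def by (rule integral_linear[OF int blinfun.bounded_linear_left, symmetric])
  then show ?thesis
    by (simp add: o_def Dquot_integrand_def Dseg_def seg_def blinfun.bilinear_simps)
qed

end

section \<open>Fredholm operators of index zero\<close>

lemma finite_dimensional_basis:
  assumes "finite_dimensional C" "subspace C"
  obtains B where "finite B" "span B = C" "card B = dim C"
proof -
  obtain B where B: "B \<subseteq> C" "independent B" "C \<subseteq> span B" "card B = dim C"
    using basis_exists[of C] by blast
  obtain A where "finite A" "C \<subseteq> span A"
    using assms(1) by (auto simp: finite_dimensional_def)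
  then have "finite B" using independent_span_bound[of A B] B by auto
  moreover have "span B = C" using B assms(2) span_minimal by blast
  ultimately show thesis using B(4) that by blast
qed

lemma dim_singleton_zero: "dim {0 :: 'a::real_vector} = 0"
  using dim_span[of "{} :: 'a set"] dim_eq_card_independent[of "{} :: 'a set"]
  by (simp add: independent_empty)

lemma fredholm_index_zero_onto:
  assumes T: "fredholm_with_index V W T 0" and ker: "{v \<in> V. blinfun_apply T v = 0} = {0}"
  shows "blinfun_apply T ` V = W"
proof -
  obtain C where C: "complement_in W (blinfun_apply T ` V) C" "finite_dimensional C" "dim C = 0"
    using T unfolding fredholm_with_index_def ker dim_singleton_zero by auto
  obtain B where "finite B" "span B = C" "card B = 0"
    using finite_dimensional_basis[OF C(2)] C(1,3) by (metis complement_in_def)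
  then have "C = {0}" by simp
  then show ?thesis using C(1) by (auto simp: complement_in_def)
qed

lemma fredholm_index_zero_codim_one:
  assumes T: "fredholm_with_index V W T 0" and ker: "{v \<in> V. blinfun_apply T v = 0} = span {\<phi>}" "\<phi> \<noteq> 0"
  obtains c where "c \<notin> blinfun_apply T ` V" "\<And>w. w \<in> W \<Longrightarrow> \<exists>a. w - a *\<^sub>R c \<in> blinfun_apply T ` V"
proof -
  have "dim (span {\<phi>}) = 1" using ker(2) by (simp add: dim_eq_card_independent)
  then obtain C where C: "complement_in W (blinfun_apply T ` V) C" "finite_dimensional C" "dim C = 1"
    using T unfolding fredholm_with_index_def ker by auto
  obtain B where B: "finite B" "span B = C" "card B = 1"
    using finite_dimensional_basis[OF C(2)] C(1,3) by (metis complement_in_def)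
  then obtain c where c: "B = {c}" by (auto simp: card_1_singleton_iff)
  have Cc: "C = range (\<lambda>a. a *\<^sub>R c)" using B(2) c by (simp add: span_singleton)
  have "c \<noteq> 0"
  proof
    assume "c = 0"
    then have "C = {0}" using Cc by auto
    then show False using C(3) by (simp add: dim_singleton_zero)
  qed
  moreover have "c \<in> C" using B(2) c by (auto intro: span_base)
  moreover have "blinfun_apply T ` V \<inter> C = {0}" using C(1) by (simp add: complement_in_def)
  ultimately have "c \<notin> blinfun_apply T ` V" by auto
  moreover have "\<exists>a. w - a *\<^sub>R c \<in> blinfun_apply T ` V" if "w \<in> W" for w
  proof -
    have "w \<in> {r + c |r c. r \<in> blinfun_apply T ` V \<and> c \<in> C}"
      using C(1) that by (simp add: complement_in_def)
    then obtain r a where "r \<in> blinfun_apply T ` V" "w = r + a *\<^sub>R c" using Cc by auto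
    then show ?thesis by (intro exI[of _ a]) simp
  qed
  ultimately show thesis using that by blast
qed

text \<open>The functional \<open>f\<close> is the coordinate along \<open>c\<close> modulo
  \<open>R\<close>. If \<open>f x\<close> is nonzero, then \<open>c - x / f x\<close> belongs to
  \<open>R\<close>, so the positive distance \<open>d\<close> of \<open>c\<close> from the closed
  set \<open>R\<close> bounds \<open>f\<close> by \<open>1 / d\<close>.\<close>

lemma closed_hyperplane_functional:
  fixes R :: "'a::real_normed_vector set"
  assumes R: "subspace R" "closed R" and c: "c \<notin> R" "\<And>y. \<exists>a. y - a *\<^sub>R c \<in> R"
  obtains \<psi> :: "'a \<Rightarrow>\<^sub>L real" where "\<psi> \<noteq> 0" "R = {y. \<psi> y = 0}"
proof -
  have uniq: "a = b" if "y - a *\<^sub>R c \<in> R" "y - b *\<^sub>R c \<in> R" for a b y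
  proof (rule ccontr)
    assume "a \<noteq> b"
    have "(y - b *\<^sub>R c) - (y - a *\<^sub>R c) \<in> R" using subspace_diff[OF R(1) that(2,1)] .
    then have "(a - b) *\<^sub>R c \<in> R" by (simp add: scaleR_left_diff_distrib)
    then have "inverse (a - b) *\<^sub>R ((a - b) *\<^sub>R c) \<in> R" by (rule subspace_scale[OF R(1)])
    then show False using \<open>a \<noteq> b\<close> c(1) by simp
  qed
  obtain f where f: "\<And>y. y - f y *\<^sub>R c \<in> R" using c(2) by metis
  have f_eq: "f y = a" if "y - a *\<^sub>R c \<in> R" for y a using uniq[OF f that] .
  obtain d where d: "d > 0" "\<And>y. y \<in> R \<Longrightarrow> d \<le> dist c y"
  proof -
    obtain d where "d > 0" "ball c d \<subseteq> - R"
      using R(2) c(1) open_Compl[of R] by (metis ComplI open_contains_ball)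
    then show thesis by (intro that[of d]) force+
  qed
  have "bounded_linear f"
  proof (rule bounded_linear_intro[where K="1 / d"])
    fix x y r
    have "(x - f x *\<^sub>R c) + (y - f y *\<^sub>R c) \<in> R" "r *\<^sub>R (x - f x *\<^sub>R c) \<in> R"
      using f R(1) by (auto intro: subspace_add subspace_scale)
    then show "f (x + y) = f x + f y" "f (r *\<^sub>R x) = r *\<^sub>R f x"
      by (auto intro!: f_eq simp: algebra_simps)
    show "norm (f x) \<le> norm x * (1 / d)"
    proof (cases "f x = 0")
      case False
      have "(- inverse (f x)) *\<^sub>R (x - f x *\<^sub>R c) \<in> R" by (rule subspace_scale[OF R(1) f])
      then have "c - inverse (f x) *\<^sub>R x \<in> R" using False by (simp add: algebra_simps)
      from d(2)[OF this] have "d \<le> norm x / \<bar>f x\<bar>" by (simp add: dist_norm divide_inverse mult.commute)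
      then show ?thesis using False d(1) by (simp add: field_simps)
    qed (use d(1) in simp)
  qed
  then have \<psi>: "blinfun_apply (Blinfun f) = f" by (rule bounded_linear_Blinfun_apply)
  have "R = {y. f y = 0}"
  proof safe
    show "f y = 0" if "y \<in> R" for y using that by (intro f_eq) simp
    show "y \<in> R" if "f y = 0" for y using f[of y] that by simp
  qed
  moreover have "f c = 1" using R(1) by (intro f_eq) (simp add: subspace_0)
  then have "Blinfun f \<noteq> 0" using \<psi> by (metis blinfun.zero_left zero_neq_one)
  ultimately show thesis using that[of "Blinfun f"] \<psi> by simp
qed

section \<open>Derivatives within a subspace and isolated zeros\<close>

lemma derivative_unique_on_subspace:
  assumes "(G has_derivative D) (at z within V)" "(G has_derivative D') (at z within V)"
    and V: "subspace V" "z \<in> V" "v \<in> V"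
  shows "D v = D' v"
proof -
  have aff: "((\<lambda>s. z + s *\<^sub>R v) has_derivative (\<lambda>s. s *\<^sub>R v)) (at 0 within (UNIV :: real set))"
    by (auto intro!: derivative_eq_intros)
  \<comment> \<open>A derivative within \<open>V\<close> is determined only in directions of
    \<open>V\<close>. Lines through \<open>z\<close> inside \<open>V\<close> reduce the claim to
    uniqueness of derivatives on the real line.\<close>
  have sub: "range (\<lambda>s. z + s *\<^sub>R v) \<subseteq> V" using V by (auto intro: subspace_add subspace_scale)
  have "((\<lambda>s. G (z + s *\<^sub>R v)) has_derivative (\<lambda>s. E (s *\<^sub>R v))) (at 0)"
    if "(G has_derivative E) (at z within V)" for E
    using has_derivative_in_compose[OF aff, of G E] has_derivative_subset[OF that sub] by simp
  from has_derivative_unique[OF this[OF assms(1)] this[OF assms(2)]]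
  have "D (1 *\<^sub>R v) = D' (1 *\<^sub>R v)" by metis
  then show ?thesis by simp
qed

text \<open>At a nearby second zero the linear part would equal the remainder up to sign. With
  tolerance \<open>1 / (2 * K)\<close> the lower bound makes the distance at most half of
  itself.\<close>

lemma isomorphism_between_isolated_zero:
  assumes G: "(G has_derivative T) (at z)" "G z = 0" and V: "subspace V" "z \<in> V"
    and iso: "isomorphism_between V W T K"
  shows "z isolated_in {w \<in> V. G w = 0}"
proof -
  have K: "0 < K" "\<And>v. v \<in> V \<Longrightarrow> norm v \<le> K * norm (T v)"
    using iso by (auto simp: isomorphism_between_def)
  obtain d where d: "d > 0" "\<And>w. norm (w - z) < d \<Longrightarrow> norm (G w - G z - T (w - z)) \<le> 1 / (2 * K) * norm (w - z)"
    using G(1) K(1) unfolding has_derivative_at_alt by (metis divide_pos_pos mult_pos_pos zero_less_numeral zero_less_one)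
  have "w = z" if w: "w \<in> V" "G w = 0" "norm (w - z) < d" for w
  proof -
    have "norm (T (w - z)) \<le> 1 / (2 * K) * norm (w - z)" using d(2)[OF w(3)] w(2) G(2) by simp
    then have "K * norm (T (w - z)) \<le> norm (w - z) / 2" using K(1) by (simp add: field_simps)
    moreover have "norm (w - z) \<le> K * norm (T (w - z))"
      using K(2) w(1) V by (simp add: subspace_diff)
    ultimately have "norm (w - z) \<le> 0" by linarith
    then show ?thesis by simp
  qed
  then have "ball z d \<inter> {w \<in> V. G w = 0} = {z}"
    using d(1) V(2) G(2) by (auto simp: dist_norm norm_minus_commute)
  then show ?thesis using V(2) G(2) by (auto simp: isolated_in_def intro!: exI[of _ "ball z d"])
qed

section \<open>The linearised extended system\<close>

definition fst_embed :: "'a::real_normed_vector \<Rightarrow>\<^sub>L ('a \<times> 'b::real_normed_vector)" where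
  "fst_embed = Blinfun (\<lambda>v. (v, 0))"

lemma fst_embed_apply [simp]: "blinfun_apply fst_embed v = (v, 0)"
  unfolding fst_embed_def
  by (simp add: bounded_linear_Blinfun_apply bounded_linear_Pair bounded_linear_zero bounded_linear_ident)

context parametrized_operator
begin

definition desing :: "('x \<Rightarrow>\<^sub>L real) \<Rightarrow> real \<times> real \<times> 'x \<times> 'x \<Rightarrow> real \<times> 'y \<times> 'y" where
  "desing ell z = (ell (snd (direction z)) - 1, F (base z), quot z)"

definition Ddesing ::
  "('x \<Rightarrow>\<^sub>L real) \<Rightarrow> real \<times> real \<times> 'x \<times> 'x \<Rightarrow> (real \<times> real \<times> 'x \<times> 'x) \<Rightarrow>\<^sub>L (real \<times> 'y \<times> 'y)" where
  "Ddesing ell z = (fst_embed o\<^sub>L (ell o\<^sub>L (snd_blinfun o\<^sub>L direction))) +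
     ((snd_embed o\<^sub>L fst_embed) o\<^sub>L (DF (base z) o\<^sub>L base)) + ((snd_embed o\<^sub>L snd_embed) o\<^sub>L Dquot z)"

lemma desing_zero: "desing ell (0, w) = extended_system F ell w"
  by (cases w) (simp add: desing_def extended_system_def quot_zero D_u_eq)

lemma has_derivative_desing: "(desing ell has_derivative blinfun_apply (Ddesing ell z)) (at z)"
proof -
  have lin: "(blinfun_apply A has_derivative blinfun_apply A) (at x)" for A :: "'p::real_normed_vector \<Rightarrow>\<^sub>L 'q::real_normed_vector" and x
    by (rule bounded_linear_imp_has_derivative[OF blinfun.bounded_linear_right])
  have 1: "((\<lambda>z. ell (snd (direction z)) - 1) has_derivative (\<lambda>h. ell (snd (direction h)))) (at z)"
    by (intro derivative_eq_intros has_derivative_compose[OF lin lin] has_derivative_snd lin)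
      (auto intro!: has_derivative_eq_rhs)
  have 2: "((\<lambda>z. F (base z)) has_derivative (\<lambda>h. DF (base z) (base h))) (at z)"
    by (rule has_derivative_compose[OF lin DF])
  show ?thesis
    unfolding desing_def[abs_def]
    by (rule has_derivative_eq_rhs[OF has_derivative_Pair[OF 1 has_derivative_Pair[OF 2 has_derivative_quot]]])
      (simp add: fun_eq_iff Ddesing_def blinfun.add_left)
qed

lemma continuous_on_Ddesing: "continuous_on UNIV (Ddesing ell)"
  unfolding Ddesing_def
  by (intro continuous_intros continuous_on_compose2[OF continuous_on_DF[of UNIV]] continuous_on_Dquot) auto

lemma Ck_on_Ddesing:
  assumes "open S" "Ck_on k S (\<lambda>s t. c s)"
  shows "Ck_on k S (\<lambda>s t. Ddesing ell (c s))"
  unfolding Ddesing_def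
  by (intro Ck_on_add Ck_on_const bounded_bilinear.Ck_on[OF bounded_bilinear_blinfun_compose]
      Ck_on_smooth[OF smooth_DF] Ck_on_Dquot assms
      bounded_linear.Ck_on[OF bounded_linear_blinfun_apply[OF bounded_linear_ident]])

text \<open>Obtained as the partial derivative of the desingularised map at \<alpha> = 0.
  Nondegeneracy of the zero is then literally the isomorphism hypothesis for continuing it in
  \<alpha>.\<close>

definition Dext :: "('x \<Rightarrow>\<^sub>L real) \<Rightarrow> real \<times> 'x \<times> 'x \<Rightarrow> (real \<times> 'x \<times> 'x) \<Rightarrow>\<^sub>L (real \<times> 'y \<times> 'y)" where
  "Dext ell w = Ddesing ell (0, w) o\<^sub>L snd_embed"

lemma has_derivative_extended_system:
  "(extended_system F ell has_derivative blinfun_apply (Dext ell w)) (at w)"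
proof -
  have "((\<lambda>w. desing ell (0, w)) has_derivative blinfun_apply (Dext ell w)) (at w)"
    by (rule has_derivative_eq_rhs[OF has_derivative_Pair_snd[OF has_derivative_desing]])
      (simp add: Dext_def fun_eq_iff)
  then show ?thesis by (simp add: desing_zero)
qed

text \<open>Differentiating \<open>D_u F l u \<phi>\<close> leaves \<phi> in the second slot of the
  second derivative. Symmetry moves it to the first, as in the nondegeneracy condition.\<close>

lemma Dext_apply:
  "Dext ell (l, u, \<phi>) (\<mu>, v, \<eta>) =
     (ell \<eta>, \<mu> *\<^sub>R D_l F l u + D_u F l u v,
      \<mu> *\<^sub>R D_lu F l u \<phi> + D_uu F l u \<phi> v + D_u F l u \<eta>)"
proof -
  have eq: "(\<mu>, v) = \<mu> *\<^sub>R (1, 0) + (0, v)" by simp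
  have "DF (l, u) (\<mu>, v) = \<mu> *\<^sub>R D_l F l u + D_u F l u v"
    unfolding eq blinfun.add_right blinfun.scaleR_right by (simp add: D_l_eq D_u_eq)
  moreover have "D2F (l, u) (\<mu>, v) (0, \<phi>) = \<mu> *\<^sub>R D_lu F l u \<phi> + D_uu F l u \<phi> v"
    unfolding eq blinfun.add_right blinfun.scaleR_right blinfun.add_left blinfun.scaleR_left
    using D2F_symmetric[of "(l, u)" "(0, v)" "(0, \<phi>)"] by (simp add: D_lu_eq D_uu_eq)
  ultimately show ?thesis
    by (simp add: Dext_def Ddesing_def blinfun.add_left Dquot_zero D_u_eq)
qed

section \<open>Invertibility of the linearisation and the hypotheses (SB)\<close>

lemma subspace_ext_space: "subspace S \<Longrightarrow> subspace (ext_space S)"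
  by (auto simp: subspace_def zero_prod_def)

text \<open>Every derivative within \<open>ext_space Xsym\<close> agrees there with
  \<open>Dext\<close>, so the existentially quantified derivative may be replaced by this explicit
  operator.\<close>

lemma nondegenerate_zero_iff:
  assumes "subspace Xsym"
  shows "nondegenerate_zero (ext_space Xsym) (ext_space Ysym) (extended_system F ell) w \<longleftrightarrow>
    w \<in> ext_space Xsym \<and> extended_system F ell w = 0 \<and>
    (\<exists>K. isomorphism_between (ext_space Xsym) (ext_space Ysym) (Dext ell w) K)"
    (is "?L \<longleftrightarrow> ?R")
proof
  note V = subspace_ext_space[OF assms]
  have lin: "linear (blinfun_apply (Dext ell w))"
    by (rule bounded_linear.linear[OF blinfun.bounded_linear_right])
  show "?L \<Longrightarrow> ?R"
  proof -
    assume ?L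
    then obtain D where w: "w \<in> ext_space Xsym" "extended_system F ell w = 0"
      and D: "(extended_system F ell has_derivative D) (at w within ext_space Xsym)"
      and inv: "invertible_between (ext_space Xsym) (ext_space Ysym) D"
      unfolding nondegenerate_zero_def by blast
    obtain K where "isomorphism_between (ext_space Xsym) (ext_space Ysym) D K"
      using inv invertible_between_iff_isomorphism[OF has_derivative_linear[OF D] V] by blast
    moreover have "D v = Dext ell w v" if "v \<in> ext_space Xsym" for v
      by (rule derivative_unique_on_subspace[OF D has_derivative_at_withinI[OF has_derivative_extended_system]
            V w(1) that])
    ultimately have "isomorphism_between (ext_space Xsym) (ext_space Ysym) (Dext ell w) K"
      by (auto simp: isomorphism_between_def cong: image_cong)
    then show ?R using w by blast
  qed
  assume ?R
  then show ?L
    unfolding nondegenerate_zero_def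
    using invertible_between_iff_isomorphism[OF lin V]
      has_derivative_at_withinI[OF has_derivative_extended_system] by blast
qed

lemma SB_imp_kernel_trivial:
  assumes "SB F Xsym Ysym l0 u0 \<phi>0"
  shows "{v \<in> Xsym. D_u F l0 u0 v = 0} = {0}"
proof -
  have ker: "{v. D_u F l0 u0 v = 0} = span {\<phi>0}" and X: "subspace Xsym" "\<phi>0 \<notin> Xsym"
    using assms by (auto simp: SB_def SB1_def SB2_def)
  have "v = 0" if v: "v \<in> Xsym" "D_u F l0 u0 v = 0" for v
  proof -
    obtain a where a: "v = a *\<^sub>R \<phi>0" using ker v(2) by (auto simp: span_singleton)
    show "v = 0"
    proof (rule ccontr)
      assume "v \<noteq> 0"
      then have "\<phi>0 = inverse a *\<^sub>R v" using a by auto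
      then show False using X v(1) by (metis subspace_scale)
    qed
  qed
  then show ?thesis using subspace_0[OF X(1)] by auto
qed

lemma SB_imp_isomorphism:
  assumes SB: "SB F Xsym Ysym l0 u0 \<phi>0" and ell: "blinfun_apply ell \<phi>0 = 1"
  obtains K where "isomorphism_between (ext_space Xsym) (ext_space Ysym) (Dext ell (l0, u0, \<phi>0)) K"
proof -
  let ?L = "D_u F l0 u0" and ?T = "Dext ell (l0, u0, \<phi>0)"
  have ker: "{v. ?L v = 0} = span {\<phi>0}"
    using SB by (auto simp: SB_def SB1_def)
  obtain \<psi> :: "'y \<Rightarrow>\<^sub>L real" where \<psi>: "range ?L = {y. \<psi> y = 0}"
    using SB by (auto simp: SB_def SB1_def)
  have X: "subspace Xsym" "closed Xsym" and Y: "subspace Ysym" "closed Ysym"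
    and fr: "fredholm_with_index Xsym Ysym ?L 0"
    using SB by (auto simp: SB_def SB2_def)
  have kerX: "{v \<in> Xsym. ?L v = 0} = {0}" by (rule SB_imp_kernel_trivial[OF SB])
  have onto: "blinfun_apply ?L ` Xsym = Ysym" by (rule fredholm_index_zero_onto[OF fr kerX])
  obtain \<xi> where \<xi>: "\<And>x. x \<in> Xsym \<and> ?L x + D_l F l0 u0 = 0 \<longleftrightarrow> x = \<xi>"
    and B: "D_lu F l0 u0 \<phi>0 + D_uu F l0 u0 \<phi>0 \<xi> \<notin> range ?L"
    using SB by (auto simp: SB_def SB3_def)
  define b where "b = D_lu F l0 u0 \<phi>0 + D_uu F l0 u0 \<phi>0 \<xi>"
  have \<xi>X: "\<xi> \<in> Xsym" and \<xi>eq: "D_l F l0 u0 = - ?L \<xi>" using \<xi>[of \<xi>] by (auto simp: add_eq_0_iff)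
  have T: "?T (\<mu>, v + \<mu> *\<^sub>R \<xi>, \<eta>) = (ell \<eta>, ?L v, \<mu> *\<^sub>R b + D_uu F l0 u0 \<phi>0 v + ?L \<eta>)" for \<mu> v \<eta>
    by (simp add: Dext_apply \<xi>eq b_def blinfun.bilinear_simps algebra_simps)
  have \<psi>b: "\<psi> b \<noteq> 0" using B \<psi> by (auto simp: b_def)
  have \<psi>L: "\<psi> (?L x) = 0" for x using \<psi> by auto
  have kernel: "w = 0" if w: "w \<in> ext_space Xsym" "?T w = 0" for w
  proof -
    obtain \<mu> v \<eta> where w': "w = (\<mu>, v, \<eta>)" by (cases w)
    define v' where "v' = v - \<mu> *\<^sub>R \<xi>"
    have v': "v = v' + \<mu> *\<^sub>R \<xi>" "v' \<in> Xsym"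
      using w(1) w' \<xi>X X(1) by (auto simp: v'_def subspace_diff subspace_scale)
    have eqs: "ell \<eta> = 0" "?L v' = 0" "\<mu> *\<^sub>R b + D_uu F l0 u0 \<phi>0 v' + ?L \<eta> = 0"
      using w(2) unfolding w' v'(1) T by (auto simp: zero_prod_def)
    have "v' = 0" using eqs(2) v'(2) kerX by auto
    with eqs(3) have eq3: "\<mu> *\<^sub>R b + ?L \<eta> = 0" by simp
    then have "\<psi> (\<mu> *\<^sub>R b + ?L \<eta>) = 0" by simp
    then have "\<mu> = 0" using \<psi>b \<psi>L by (simp add: blinfun.bilinear_simps)
    then have "?L \<eta> = 0" using eq3 by simp
    then obtain a where "\<eta> = a *\<^sub>R \<phi>0" using ker by (auto simp: span_singleton)
    then have "\<eta> = 0" using eqs(1) ell by (simp add: blinfun.scaleR_right)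
    then show ?thesis using w' v'(1) \<open>v' = 0\<close> \<open>\<mu> = 0\<close> by (simp add: zero_prod_def)
  qed
  have "bij_betw (blinfun_apply ?T) (ext_space Xsym) (ext_space Ysym)"
    unfolding bij_betw_def
  proof
    show "inj_on (blinfun_apply ?T) (ext_space Xsym)"
    proof (rule inj_onI)
      fix x y assume "x \<in> ext_space Xsym" "y \<in> ext_space Xsym" "?T x = ?T y"
      then have "x - y = 0"
        by (intro kernel subspace_diff subspace_ext_space X) (simp_all add: blinfun.diff_right)
      then show "x = y" by simp
    qed
    show "blinfun_apply ?T ` ext_space Xsym = ext_space Ysym"
    proof safe
      fix r y1 y2 \<mu> v \<eta> assume v: "v \<in> Xsym" and eq: "(r, y1, y2) = ?T (\<mu>, v, \<eta>)"
      have "v - \<mu> *\<^sub>R \<xi> \<in> Xsym" using v \<xi>X X(1) by (simp add: subspace_diff subspace_scale)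
      moreover have "y1 = ?L (v - \<mu> *\<^sub>R \<xi>)" using eq T[of \<mu> "v - \<mu> *\<^sub>R \<xi>" \<eta>] by simp
      ultimately show "y1 \<in> Ysym" using onto by auto
    next
      fix r y1 y2 assume "y1 \<in> Ysym"
      then obtain v where v: "v \<in> Xsym" "?L v = y1" using onto by auto
      \<comment> \<open>The value for which \<psi> annihilates the part of the third equation that
        \<open>?L \<eta>\<close> has to match, so that this part lies in the range of
        \<open>?L\<close>.\<close>
      define \<mu> where "\<mu> = \<psi> (y2 - D_uu F l0 u0 \<phi>0 v) / \<psi> b"
      have "\<psi> (y2 - D_uu F l0 u0 \<phi>0 v - \<mu> *\<^sub>R b) = 0"
        using \<psi>b by (simp add: \<mu>_def blinfun.bilinear_simps)
      then obtain \<eta> where \<eta>: "y2 - D_uu F l0 u0 \<phi>0 v - \<mu> *\<^sub>R b = ?L \<eta>" using \<psi> by blast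
      have L\<phi>: "?L \<phi>0 = 0" using ker span_base[of \<phi>0 "{\<phi>0}"] by auto
      \<comment> \<open>A multiple of the kernel vector \<open>\<phi>0\<close> adjusts the first
        component without disturbing the others, because \<open>ell \<phi>0 = 1\<close>.\<close>
      have "?T (\<mu>, v + \<mu> *\<^sub>R \<xi>, \<eta> + (r - ell \<eta>) *\<^sub>R \<phi>0) = (r, y1, y2)"
        unfolding T using ell v(2) L\<phi> \<eta>[symmetric] by (simp add: blinfun.bilinear_simps)
      moreover have "(\<mu>, v + \<mu> *\<^sub>R \<xi>, \<eta> + (r - ell \<eta>) *\<^sub>R \<phi>0) \<in> ext_space Xsym"
        using v(1) \<xi>X X(1) by (simp add: subspace_add subspace_scale)
      ultimately show "(r, y1, y2) \<in> blinfun_apply ?T ` ext_space Xsym" by (metis imageI)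
    qed auto
  qed
  then show thesis
    using bijective_imp_isomorphism_between[OF blinfun.bounded_linear_right subspace_ext_space[OF X(1)] _
        subspace_ext_space[OF Y(1)], of ?T] X(2) Y(2) that
    by (metis closed_Times closed_UNIV)
qed

text \<open>Injectivity is tested on special vectors. For \<open>v\<close> in the kernel of
  \<open>?L\<close>, the vector \<open>(0, 0, v - ell v *\<^sub>R \<phi>0)\<close> is annihilated,
  so the kernel is spanned by \<open>\<phi>0\<close>. If the nondegeneracy condition failed, some
  vector with first component 1 and second component \<xi> would be annihilated. The functional
  \<psi> comes from index zero: the closed range has codimension one.\<close>

lemma isomorphism_imp_SB:
  assumes X: "subspace Xsym" "closed Xsym" and Y: "subspace Ysym" "closed Ysym"
    and maps: "\<And>l u. u \<in> Xsym \<Longrightarrow> F (l, u) \<in> Ysym"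
    and fr: "fredholm_with_index UNIV UNIV (D_u F l0 u0) 0"
    and frX: "fredholm_with_index Xsym Ysym (D_u F l0 u0) 0"
    and z: "u0 \<in> Xsym" "\<phi>0 \<notin> Xsym" "extended_system F ell (l0, u0, \<phi>0) = 0"
    and iso: "isomorphism_between (ext_space Xsym) (ext_space Ysym) (Dext ell (l0, u0, \<phi>0)) K"
  shows "SB F Xsym Ysym l0 u0 \<phi>0"
proof -
  let ?L = "D_u F l0 u0" and ?T = "Dext ell (l0, u0, \<phi>0)"
  have ell: "ell \<phi>0 = 1" and F0: "F (l0, u0) = 0" and L\<phi>: "?L \<phi>0 = 0"
    using z(3) by (auto simp: extended_system_def zero_prod_def)
  have \<phi>0: "\<phi>0 \<noteq> 0" using ell by auto
  have kernel: "w = 0" if "w \<in> ext_space Xsym" "?T w = 0" for w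
  proof -
    have "norm w \<le> K * norm (?T w)" using iso that(1) unfolding isomorphism_between_def by blast
    then show ?thesis using that(2) by simp
  qed
  have span: "v \<in> span {\<phi>0}" if "?L v = 0" for v
  proof -
    have "(0, 0, v - ell v *\<^sub>R \<phi>0) = (0 :: real \<times> 'x \<times> 'x)"
      by (rule kernel)
        (use subspace_0[OF X(1)] that ell L\<phi> in \<open>auto simp: Dext_apply blinfun.bilinear_simps zero_prod_def\<close>)
    then have "v = ell v *\<^sub>R \<phi>0" by (simp add: zero_prod_def)
    then show ?thesis by (metis rangeI span_singleton)
  qed
  have ker: "{v. ?L v = 0} = span {\<phi>0}"
    using span L\<phi> by (auto simp: span_singleton blinfun.scaleR_right)
  have kerX: "{v \<in> Xsym. ?L v = 0} = {0}"
  proof -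
    have "v = 0" if v: "v \<in> Xsym" "?L v = 0" for v
    proof (rule ccontr)
      assume "v \<noteq> 0"
      obtain a where a: "v = a *\<^sub>R \<phi>0" using span[OF v(2)] by (auto simp: span_singleton)
      then have "\<phi>0 = inverse a *\<^sub>R v" using \<open>v \<noteq> 0\<close> by auto
      then show False using X(1) v(1) z(2) by (metis subspace_scale)
    qed
    then show ?thesis using subspace_0[OF X(1)] by auto
  qed
  have onto: "blinfun_apply ?L ` Xsym = Ysym" by (rule fredholm_index_zero_onto[OF frX kerX])
  have ker': "{v \<in> UNIV. ?L v = 0} = span {\<phi>0}" using ker by simp
  obtain c where c: "c \<notin> range ?L" "\<And>y. \<exists>a. y - a *\<^sub>R c \<in> range ?L"
    using fredholm_index_zero_codim_one[OF fr ker' \<phi>0] by (metis UNIV_I)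
  have "subspace (range ?L)" "closed (range ?L)"
    using fr linear_subspace_image[OF bounded_linear.linear[OF blinfun.bounded_linear_right] subspace_UNIV, of ?L]
    by (auto simp: fredholm_with_index_def)
  then obtain \<psi> :: "'y \<Rightarrow>\<^sub>L real" where \<psi>: "\<psi> \<noteq> 0" "range ?L = {y. \<psi> y = 0}"
    using closed_hyperplane_functional[OF _ _ c] by blast
  have "SB1 F l0 u0 \<phi>0" unfolding SB1_def using F0 fr ker \<phi>0 \<psi> by blast
  moreover have "SB2 F Xsym Ysym l0 u0 \<phi>0" unfolding SB2_def using X Y maps frX z by blast
  moreover have "SB3 F Xsym l0 u0 \<phi>0"
  proof -
    have "D_l F l0 u0 \<in> Ysym"
      unfolding D_l_eq
      by (rule vector_derivative_in_closed_subspace[OF Y open_UNIV UNIV_I maps[OF z(1)] has_derivative_Pair_fst[OF DF]])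
    then have "- D_l F l0 u0 \<in> Ysym" using Y(1) by (simp add: subspace_neg)
    then obtain \<xi> where \<xi>: "\<xi> \<in> Xsym" "?L \<xi> = - D_l F l0 u0" using onto by auto
    have uniq: "x = \<xi>" if "x \<in> Xsym" "?L x + D_l F l0 u0 = 0" for x
    proof -
      have "x - \<xi> \<in> {v \<in> Xsym. ?L v = 0}" using that \<xi> X(1) by (simp add: subspace_diff blinfun.diff_right)
      then show ?thesis using kerX by simp
    qed
    have "D_lu F l0 u0 \<phi>0 + D_uu F l0 u0 \<phi>0 \<xi> \<notin> range ?L"
    proof
      assume "D_lu F l0 u0 \<phi>0 + D_uu F l0 u0 \<phi>0 \<xi> \<in> range ?L"
      then obtain \<eta> where \<eta>: "D_lu F l0 u0 \<phi>0 + D_uu F l0 u0 \<phi>0 \<xi> = ?L \<eta>" by auto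
      have "(1, \<xi>, ell \<eta> *\<^sub>R \<phi>0 - \<eta>) = (0 :: real \<times> 'x \<times> 'x)"
        by (rule kernel)
          (use \<xi> \<eta> ell L\<phi> in \<open>auto simp: Dext_apply blinfun.bilinear_simps zero_prod_def\<close>)
      then show False by (simp add: zero_prod_def)
    qed
    moreover have "x \<in> Xsym \<and> ?L x + D_l F l0 u0 = 0 \<longleftrightarrow> x = \<xi>" for x
    proof
      show "x \<in> Xsym \<and> ?L x + D_l F l0 u0 = 0" if "x = \<xi>" using that \<xi> by simp
    qed (use uniq in blast)
    ultimately show ?thesis unfolding SB3_def by blast
  qed
  ultimately show ?thesis by (simp add: SB_def)
qed

end

section \<open>The bifurcating branches\<close>

context parametrized_operator
begin

text \<open>For two solutions with the same parameter, strict differentiability makes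
  \<open>D_u F l0 u0 (v - u)\<close> small relative to \<open>v - u\<close>. Removing the multiple
  \<open>a\<close> of \<open>\<phi>0\<close> with \<open>a = ell (v - u)\<close> leaves a vector
  \<open>f\<close> in the kernel of \<open>ell\<close> with the same image, which the lower bound
  makes small as well.\<close>

lemma solution_pair_direction:
  assumes K: "0 < K" "\<And>z. blinfun_apply ell z = 0 \<Longrightarrow> norm z \<le> K * norm (D_u F l0 u0 z)"
    and \<phi>0: "blinfun_apply ell \<phi>0 = 1" "D_u F l0 u0 \<phi>0 = 0" and \<rho>: "0 < \<rho>"
  obtains r where "0 < r" "\<And>l u v. \<bar>l - l0\<bar> \<le> r \<Longrightarrow> norm (u - u0) \<le> r \<Longrightarrow> norm (v - u0) \<le> r \<Longrightarrow>
    F (l, u) = 0 \<Longrightarrow> F (l, v) = 0 \<Longrightarrow> u \<noteq> v \<Longrightarrow>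
    ell (v - u) \<noteq> 0 \<and> norm ((v - u) /\<^sub>R ell (v - u) - \<phi>0) \<le> \<rho>"
proof -
  have "\<phi>0 \<noteq> 0" using \<phi>0(1) by auto
  \<comment> \<open>The first bound gives \<open>norm f \<le> norm (v - u) / 2\<close>, hence
    \<open>norm (v - u)\<close> is at most twice the norm of \<open>a *\<^sub>R \<phi>0\<close> and
    \<open>a\<close> cannot vanish. The second then bounds \<open>norm f\<close> by \<rho> times the
    modulus of \<open>a\<close>.\<close>
  define e where "e = min (1 / (2 * K)) (\<rho> / (2 * K * norm \<phi>0))"
  have e: "0 < e" using K \<rho> \<open>\<phi>0 \<noteq> 0\<close> by (simp add: e_def)
  have "e \<le> 1 / (2 * K)" "e \<le> \<rho> / (2 * K * norm \<phi>0)" by (auto simp: e_def)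
  then have Ke: "K * e \<le> 1 / 2" "2 * K * e * norm \<phi>0 \<le> \<rho>"
    using K(1) \<open>\<phi>0 \<noteq> 0\<close> by (simp_all add: field_simps)
  obtain r where r: "0 < r"
    "\<And>a x y. norm (a - l0) \<le> r \<Longrightarrow> x \<in> cball u0 r \<Longrightarrow> y \<in> cball u0 r \<Longrightarrow>
      norm (F (a, x) - F (a, y) - DF (l0, u0) (0, x - y)) \<le> e * norm (x - y)"
    by (rule strict_derivative_snd[OF DF continuous_on_DF e, where ?a0.0=l0 and ?x0.0=u0]) (rule that; assumption)
  show thesis
  proof (rule that[OF r(1)])
    fix l u v assume near: "\<bar>l - l0\<bar> \<le> r" "norm (u - u0) \<le> r" "norm (v - u0) \<le> r"
      and F0: "F (l, u) = 0" "F (l, v) = 0" and "u \<noteq> v"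
    define a where "a = ell (v - u)"
    define f where "f = (v - u) - a *\<^sub>R \<phi>0"
    have "norm (D_u F l0 u0 (v - u)) \<le> e * norm (v - u)"
      using r(2)[of l v u] near F0 by (simp add: D_u_eq dist_norm norm_minus_commute)
    moreover have "D_u F l0 u0 f = D_u F l0 u0 (v - u)"
      using \<phi>0(2) unfolding f_def blinfun.diff_right[of _ "v - u"] by (simp add: blinfun.scaleR_right)
    moreover have "ell f = 0" using \<phi>0(1) unfolding f_def blinfun.diff_right[of _ "v - u"]
      by (simp add: a_def blinfun.scaleR_right)
    ultimately have "norm f \<le> K * (e * norm (v - u))"
      using order_trans[OF K(2)[of f] mult_left_mono[of _ "e * norm (v - u)" K]] K(1) by simp
    then have f: "norm f \<le> K * e * norm (v - u)" by (simp add: mult.assoc)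
    also have "\<dots> \<le> 1 / 2 * norm (v - u)" using Ke(1) by (rule mult_right_mono) simp
    finally have f2: "norm f \<le> norm (v - u) / 2" by simp
    have "norm (v - u) \<le> \<bar>a\<bar> * norm \<phi>0 + norm f"
      using norm_triangle_ineq[of "a *\<^sub>R \<phi>0" f] by (simp add: f_def)
    with f2 have vu: "norm (v - u) \<le> 2 * (\<bar>a\<bar> * norm \<phi>0)" by linarith
    have a: "a \<noteq> 0"
    proof
      assume "a = 0"
      then have "norm (v - u) \<le> 0" using vu by simp
      then show False using \<open>u \<noteq> v\<close> by simp
    qed
    have "norm f \<le> K * e * (2 * (\<bar>a\<bar> * norm \<phi>0))"
      using order_trans[OF f mult_left_mono[OF vu]] K(1) e by simp
    also have "\<dots> = (2 * K * e * norm \<phi>0) * \<bar>a\<bar>" by simp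
    also have "\<dots> \<le> \<rho> * \<bar>a\<bar>" using Ke(2) by (rule mult_right_mono) simp
    finally have "norm f / \<bar>a\<bar> \<le> \<rho>" using a by (simp add: divide_le_eq)
    moreover have "(v - u) /\<^sub>R a - \<phi>0 = f /\<^sub>R a" using a by (simp add: f_def scaleR_diff_right)
    ultimately show "ell (v - u) \<noteq> 0 \<and> norm ((v - u) /\<^sub>R ell (v - u) - \<phi>0) \<le> \<rho>"
      using a by (simp add: a_def divide_inverse mult.commute)
  qed
qed

lemma desing_eq_zero_iff:
  assumes "\<alpha> \<noteq> 0"
  shows "desing ell (\<alpha>, l, u, \<phi>) = 0 \<longleftrightarrow> ell \<phi> = 1 \<and> F (l, u) = 0 \<and> F (l, u + \<alpha> *\<^sub>R \<phi>) = 0"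
  using assms quot_difference[of \<alpha> l u \<phi>]
  by (auto simp: desing_def zero_prod_def)

lemma desing_zero_imp_solution:
  assumes "desing ell (\<alpha>, l, u, \<phi>) = 0"
  shows "F (l, u + \<alpha> *\<^sub>R \<phi>) = 0"
  using assms quot_difference[of \<alpha> l u \<phi>] by (simp add: desing_def zero_prod_def)

lemma symmetric_branch:
  assumes SB: "SB F Xsym Ysym l0 u0 \<phi>0"
  obtains \<delta> p where "0 < \<delta>" "\<And>k. Ck_on k {l0 - \<delta><..<l0 + \<delta>} (\<lambda>s t. p s)" "p l0 = u0"
    "\<And>l. l \<in> {l0 - \<delta><..<l0 + \<delta>} \<Longrightarrow> p l \<in> Xsym \<and> F (l, p l) = 0"
proof -
  let ?L = "D_u F l0 u0"
  have X: "subspace Xsym" "closed Xsym" and Y: "subspace Ysym" "closed Ysym"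
    and maps: "\<And>l u. u \<in> Xsym \<Longrightarrow> F (l, u) \<in> Ysym" and u0: "u0 \<in> Xsym" "F (l0, u0) = 0"
    and fr: "fredholm_with_index Xsym Ysym ?L 0"
    using SB by (auto simp: SB_def SB1_def SB2_def)
  have ker: "{v \<in> Xsym. ?L v = 0} = {0}" by (rule SB_imp_kernel_trivial[OF SB])
  have "inj_on (blinfun_apply ?L) Xsym"
  proof (rule inj_onI)
    fix x y assume "x \<in> Xsym" "y \<in> Xsym" "?L x = ?L y"
    then have "x - y \<in> {v \<in> Xsym. ?L v = 0}" using X(1) by (simp add: subspace_diff blinfun.diff_right)
    then show "x = y" using ker by simp
  qed
  then have "bij_betw (blinfun_apply ?L) Xsym Ysym"
    using fredholm_index_zero_onto[OF fr ker] by (simp add: bij_betw_def)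
  then obtain K where "isomorphism_between Xsym Ysym (blinfun_apply ?L) K"
    using bijective_imp_isomorphism_between[OF blinfun.bounded_linear_right X Y] by blast
  then have iso: "isomorphism_between Xsym Ysym (\<lambda>v. DF (l0, u0) (0, v)) K"
    by (simp add: D_u_eq isomorphism_between_def)
  have Ck: "Ck_on k S (\<lambda>s t. DF (c s))" if "Ck_on k S (\<lambda>s t. c s)" for k S c
    by (rule Ck_on_smooth[OF smooth_DF that])
  show thesis
    by (rule implicit_curve[OF X Y DF continuous_on_DF Ck maps u0 iso];
        (assumption | (rule that; assumption)))
qed

lemma desingularised_branch:
  assumes SB: "SB F Xsym Ysym l0 u0 \<phi>0" and ell: "blinfun_apply ell \<phi>0 = 1"
  obtains \<delta> \<rho> w where "0 < \<delta>" "0 < \<rho>" "\<And>k. Ck_on k {-\<delta><..<\<delta>} (\<lambda>s t. w s)" "w 0 = (l0, u0, \<phi>0)"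
    "\<And>a. a \<in> {-\<delta><..<\<delta>} \<Longrightarrow> w a \<in> ext_space Xsym \<and> desing ell (a, w a) = 0"
    "\<And>a y. a \<in> {-\<delta><..<\<delta>} \<Longrightarrow> y \<in> ext_space Xsym \<Longrightarrow> y \<in> cball (l0, u0, \<phi>0) \<rho> \<Longrightarrow>
      desing ell (a, y) = 0 \<Longrightarrow> y = w a"
proof -
  have X: "subspace Xsym" "closed Xsym" and Y: "subspace Ysym" "closed Ysym"
    and maps: "\<And>l u. u \<in> Xsym \<Longrightarrow> F (l, u) \<in> Ysym" and u0: "u0 \<in> Xsym" "F (l0, u0) = 0"
    and L\<phi>: "D_u F l0 u0 \<phi>0 = 0"
    using SB span_base[of \<phi>0 "{\<phi>0}"] by (auto simp: SB_def SB1_def SB2_def)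
  obtain K where "isomorphism_between (ext_space Xsym) (ext_space Ysym) (Dext ell (l0, u0, \<phi>0)) K"
    using SB_imp_isomorphism[OF SB ell] by blast
  then have iso: "isomorphism_between (ext_space Xsym) (ext_space Ysym)
      (\<lambda>v. Ddesing ell (0, l0, u0, \<phi>0) (0, v)) K"
    by (simp add: Dext_def isomorphism_between_def)
  have "closed (ext_space Xsym)" "closed (ext_space Ysym)"
    using X Y by (auto intro!: closed_Times)
  note spaces = subspace_ext_space[OF X(1)] this(1) subspace_ext_space[OF Y(1)] this(2)
  have maps': "desing ell (a, x) \<in> ext_space Ysym" if "x \<in> ext_space Xsym" for a x
    using that maps by (auto simp: desing_def)
  have x0: "(l0, u0, \<phi>0) \<in> ext_space Xsym" using u0 by simp
  have z0: "desing ell (0, l0, u0, \<phi>0) = 0"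
    using u0 ell L\<phi> by (simp add: desing_zero extended_system_def zero_prod_def)
  show thesis
  proof (rule implicit_curve[OF spaces has_derivative_desing continuous_on_Ddesing Ck_on_Ddesing maps' x0 z0 iso])
    fix \<delta> \<rho> w
    assume "0 < \<delta>" "0 < \<rho>" "\<And>k. Ck_on k {0 - \<delta><..<0 + \<delta>} (\<lambda>s t. w s)" "w 0 = (l0, u0, \<phi>0)"
      "\<And>a. a \<in> {0 - \<delta><..<0 + \<delta>} \<Longrightarrow> w a \<in> ext_space Xsym \<and> desing ell (a, w a) = 0"
      "\<And>a y. a \<in> {0 - \<delta><..<0 + \<delta>} \<Longrightarrow> y \<in> ext_space Xsym \<Longrightarrow> y \<in> cball (l0, u0, \<phi>0) \<rho> \<Longrightarrow>
        desing ell (a, y) = 0 \<Longrightarrow> y = w a"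
    then show thesis
      unfolding diff_0 add_0_left by (rule that)
  qed
qed

lemma SB_imp_solution_branches:
  fixes ell :: "'x \<Rightarrow>\<^sub>L real"
  assumes SB: "SB F Xsym Ysym l0 u0 \<phi>0" and ell: "blinfun_apply ell \<phi>0 = 1"
  shows "\<exists>p h u. solution_branches F Xsym l0 u0 p h u"
proof -
  have X: "subspace Xsym" "closed Xsym" and u0: "u0 \<in> Xsym" and \<phi>0: "\<phi>0 \<notin> Xsym"
    and L\<phi>: "D_u F l0 u0 \<phi>0 = 0"
    using SB span_base[of \<phi>0 "{\<phi>0}"] by (auto simp: SB_def SB1_def SB2_def)
  obtain \<delta>1 p where \<delta>1: "0 < \<delta>1" and p: "\<And>k. Ck_on k {l0 - \<delta>1<..<l0 + \<delta>1} (\<lambda>s t. p s)" "p l0 = u0"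
    "\<And>l. l \<in> {l0 - \<delta>1<..<l0 + \<delta>1} \<Longrightarrow> p l \<in> Xsym \<and> F (l, p l) = 0"
    by (rule symmetric_branch[OF SB]) (rule that; assumption)
  obtain \<delta>2 \<rho> w where \<delta>2: "0 < \<delta>2" and \<rho>: "0 < \<rho>"
    and w: "\<And>k. Ck_on k {-\<delta>2<..<\<delta>2} (\<lambda>s t. w s)" "w 0 = (l0, u0, \<phi>0)"
      "\<And>a. a \<in> {-\<delta>2<..<\<delta>2} \<Longrightarrow> w a \<in> ext_space Xsym \<and> desing ell (a, w a) = 0"
    and uniq: "\<And>a y. a \<in> {-\<delta>2<..<\<delta>2} \<Longrightarrow> y \<in> ext_space Xsym \<Longrightarrow> y \<in> cball (l0, u0, \<phi>0) \<rho> \<Longrightarrow>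
      desing ell (a, y) = 0 \<Longrightarrow> y = w a"
    by (rule desingularised_branch[OF SB ell]) (rule that; assumption)
  define h where "h a = fst (w a)" for a
  define q where "q a = fst (snd (w a))" for a
  define f where "f a = snd (snd (w a))" for a
  define u where "u a = q a + a *\<^sub>R f a" for a
  have w_eq: "w a = (h a, q a, f a)" for a by (simp add: h_def q_def f_def)
  have at0: "h 0 = l0" "q 0 = u0" "f 0 = \<phi>0" "u 0 = u0" using w(2) by (auto simp: h_def q_def f_def u_def)
  define S where "S = {-\<delta>2<..<\<delta>2}"
  have S: "open S" "0 \<in> S" using \<delta>2 by (auto simp: S_def)
  note wS = w(1)[folded S_def] w(3)[folded S_def]
  have qX: "q a \<in> Xsym" if "a \<in> S" for a using wS(2)[OF that] by (simp add: w_eq)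
  have Fu: "F (h a, u a) = 0" if "a \<in> S" for a
    using desing_zero_imp_solution[of ell a "h a" "q a" "f a"] wS(2)[OF that] by (simp add: w_eq u_def)
  have Ck_w: "Ck_on k S (\<lambda>s t. h s)" "Ck_on k S (\<lambda>s t. q s)" "Ck_on k S (\<lambda>s t. f s)" for k
    unfolding h_def q_def f_def
    by (rule bounded_linear.Ck_on[OF _ wS(1)], intro bounded_linear_intros)+
  have Ck_u: "Ck_on k S (\<lambda>s t. u s)" for k
    unfolding u_def by (intro Ck_on_add Ck_w bounded_bilinear.Ck_on[OF bounded_bilinear_scaleR] Ck_on_self)
  have deriv: "\<exists>g'. (\<forall>s\<in>S. (g has_vector_derivative g' s) (at s)) \<and> continuous_on S g'"
    if g: "\<And>k. Ck_on k S (\<lambda>s t. g s)" for g :: "real \<Rightarrow> 'p::real_normed_vector"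
  proof -
    obtain g' where g': "\<And>s t. s \<in> S \<Longrightarrow> t \<in> {0..1} \<Longrightarrow> (g has_vector_derivative g' s t) (at s)" "Ck_on 0 S g'"
      using g[of "Suc 0"] by (rule Ck_on_SucE) (rule that; assumption)
    have "continuous_on S (\<lambda>s. (\<lambda>(s, t). g' s t) (s, 0))"
      by (rule continuous_on_compose2[OF Ck_on_continuous[OF g'(2)]]) (auto intro!: continuous_intros)
    then show ?thesis using g'(1)[of _ 0] by (intro exI[of _ "\<lambda>s. g' s 0"]) auto
  qed
  obtain q' f' where q': "(q has_vector_derivative q') (at 0)" and f': "(f has_vector_derivative f') (at 0)"
    using deriv[OF Ck_w(2)] deriv[OF Ck_w(3)] S(2) by blast
  obtain c' where c': "\<And>s. s \<in> S \<Longrightarrow> ((\<lambda>a. (h a, u a)) has_vector_derivative c' s) (at s)" "continuous_on S c'"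
    using deriv[OF Ck_on_Pair[OF Ck_w(1) Ck_u]] by blast
  \<comment> \<open>The velocity of \<open>u\<close> at 0 is \<open>q' + \<phi>0\<close> with
    \<open>q'\<close> in \<open>Xsym\<close>; if it vanished, \<open>\<phi>0\<close> would be
    symmetric.\<close>
  have "c' 0 \<noteq> 0"
  proof
    assume 0: "c' 0 = 0"
    have "(u has_vector_derivative snd (c' 0)) (at 0)"
      using bounded_linear.has_vector_derivative[OF bounded_linear_snd c'(1)[OF S(2)]] by simp
    moreover have "(u has_vector_derivative q' + (0 *\<^sub>R f' + 1 *\<^sub>R f 0)) (at 0)"
      unfolding u_def by (intro derivative_intros q' f')
    ultimately have "q' + \<phi>0 = 0" using 0 at0 by (auto dest: vector_derivative_unique_at)
    moreover have "q' \<in> Xsym" by (rule vector_derivative_in_closed_subspace[OF X S qX q'])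
    ultimately have "\<phi>0 \<in> Xsym" using X(1) by (metis add_eq_0_iff subspace_neg)
    then show False using \<phi>0 by simp
  qed
  moreover have "isCont c' 0" using c'(2) S by (simp add: continuous_on_eq_continuous_at)
  ultimately have "\<forall>\<^sub>F a in nhds 0. c' a \<noteq> 0"
    by (simp add: isCont_def tendsto_imp_eventually_ne eventually_nhds_conv_at)
  then obtain \<delta>3 where \<delta>3: "\<delta>3 > 0" "\<And>a. \<bar>a\<bar> < \<delta>3 \<Longrightarrow> c' a \<noteq> 0"
    unfolding eventually_nhds_metric dist_real_def by auto
  have velocity: "vector_derivative (\<lambda>a. (h a, u a)) (at a) \<noteq> 0" if "a \<in> S" "\<bar>a\<bar> < \<delta>3" for a
    using vector_derivative_at[OF c'(1)[OF that(1)]] \<delta>3(2)[OF that(2)] by simp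
  \<comment> \<open>Symmetry of \<open>u a\<close> would pass to the quotient
    \<open>(u a - q a) / a = f a\<close>, but \<open>f\<close> tends to \<open>\<phi>0\<close> in
    the open complement of \<open>Xsym\<close>.\<close>
  have "\<forall>\<^sub>F a in at 0. u a \<notin> Xsym"
  proof -
    have "(f \<longlongrightarrow> \<phi>0) (at 0)"
      using has_vector_derivative_continuous[OF f'] at0 by (simp add: isCont_def)
    then have "\<forall>\<^sub>F a in at 0. f a \<in> - Xsym"
      using X(2) \<phi>0 by (intro topological_tendstoD) auto
    moreover have "\<forall>\<^sub>F a in at 0. a \<in> S" by (rule eventually_at_in_open'[OF S])
    moreover have "\<forall>\<^sub>F a in at (0::real). a \<noteq> 0" by (simp add: eventually_at_filter)
    ultimately show ?thesis
    proof eventually_elim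
      case (elim a)
      show ?case
      proof
        assume "u a \<in> Xsym"
        then have "inverse a *\<^sub>R (u a - q a) \<in> Xsym"
          using qX[OF elim(2)] X(1) by (simp add: subspace_diff subspace_scale)
        then show False using elim by (simp add: u_def)
      qed
    qed
  qed
  then have asym: "\<exists>\<^sub>F a in at 0. u a \<notin> Xsym" by (simp add: eventually_frequently)
  define \<delta> where "\<delta> = min \<delta>1 (min \<delta>2 \<delta>3)"
  have \<delta>: "\<delta> > 0" "\<delta> \<le> \<delta>1" "\<delta> \<le> \<delta>2" "\<delta> \<le> \<delta>3" using \<delta>1 \<delta>2 \<delta>3(1) by (auto simp: \<delta>_def)
  have sub1: "{l0 - \<delta><..<l0 + \<delta>} \<subseteq> {l0 - \<delta>1<..<l0 + \<delta>1}" using \<delta>(2) by auto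
  have sub2: "{-\<delta><..<\<delta>} \<subseteq> S" using \<delta>(3) by (auto simp: S_def)
  obtain K where iso: "isomorphism_between (ext_space Xsym) (ext_space Ysym) (Dext ell (l0, u0, \<phi>0)) K"
    using SB_imp_isomorphism[OF SB ell] by blast
  have K: "K > 0" using iso by (simp add: isomorphism_between_def)
  \<comment> \<open>On \<open>(0, 0, z)\<close> with \<open>ell z = 0\<close> the linearised system
    reduces to its third component, so its lower bound restricts to one for
    \<open>D_u F l0 u0\<close> on the kernel of \<open>ell\<close>.\<close>
  have lower: "norm z \<le> K * norm (D_u F l0 u0 z)" if "ell z = 0" for z
  proof -
    have "(0, 0, z) \<in> ext_space Xsym" using X(1) by (simp add: subspace_0)
    then have "norm (0::real, 0::'x, z) \<le> K * norm (Dext ell (l0, u0, \<phi>0) (0, 0, z))"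
      using iso unfolding isomorphism_between_def by blast
    then show ?thesis using that by (simp add: Dext_apply norm_Pair)
  qed
  have "0 < \<rho> / 3" using \<rho> by simp
  then obtain r where r: "0 < r" "\<And>l u v. \<bar>l - l0\<bar> \<le> r \<Longrightarrow> norm (u - u0) \<le> r \<Longrightarrow> norm (v - u0) \<le> r \<Longrightarrow>
    F (l, u) = 0 \<Longrightarrow> F (l, v) = 0 \<Longrightarrow> u \<noteq> v \<Longrightarrow>
    ell (v - u) \<noteq> 0 \<and> norm ((v - u) /\<^sub>R ell (v - u) - \<phi>0) \<le> \<rho> / 3"
    using solution_pair_direction[OF K lower ell L\<phi>] by blast
  \<comment> \<open>The radius \<open>r\<close> makes differences of solutions nearly parallel to
    \<open>\<phi>0\<close>. A third of \<rho> for each of the three components stays inside the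
    uniqueness ball. The last bound keeps \<open>ell (v - p l)\<close> inside the parameter interval
    of the second branch, as both solutions are within \<eta> of \<open>u0\<close>.\<close>
  define \<eta> where "\<eta> = min (min r (\<rho> / 3)) (\<delta> / (2 * (norm ell + 1)))"
  have pos: "0 < norm ell + 1" by (simp add: add_nonneg_pos)
  have \<eta>: "\<eta> > 0" "\<eta> \<le> r" "\<eta> \<le> \<rho> / 3" "2 * (norm ell + 1) * \<eta> \<le> \<delta>"
  proof -
    show "\<eta> > 0" using r(1) \<rho> \<delta>(1) pos by (simp add: \<eta>_def)
    have "\<eta> \<le> \<delta> / (2 * (norm ell + 1))" by (simp add: \<eta>_def)
    then show "2 * (norm ell + 1) * \<eta> \<le> \<delta>"
      using pos by (simp add: pos_le_divide_eq mult.commute)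
    show "\<eta> \<le> \<rho> / 3" unfolding \<eta>_def by (rule min.coboundedI1[OF min.cobounded2])
  qed (simp add: \<eta>_def)
  have "continuous_on {l0 - \<delta>1<..<l0 + \<delta>1} (\<lambda>s. (\<lambda>(s, t::real). p s) (s, 0))"
    by (rule continuous_on_compose2[OF Ck_on_continuous[OF p(1)[of 0]]]) (auto intro!: continuous_intros)
  then have "isCont p l0" using \<delta>1 by (simp add: continuous_on_eq_continuous_at)
  then obtain \<sigma> where \<sigma>: "\<sigma> > 0" "\<And>l. \<bar>l - l0\<bar> < \<sigma> \<Longrightarrow> norm (p l - u0) < \<eta>"
    using \<eta>(1) p(2) unfolding continuous_at_eps_delta by (force simp: dist_norm)
  define \<sigma>' where "\<sigma>' = min (min \<sigma> \<delta>) \<eta>"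
  have \<sigma>': "\<sigma>' > 0" "\<sigma>' \<le> \<sigma>" "\<sigma>' \<le> \<delta>" "\<sigma>' \<le> \<eta>" using \<sigma>(1) \<delta>(1) \<eta>(1) by (auto simp: \<sigma>'_def)
  \<comment> \<open>The parameter range is small enough for \<open>p l\<close> to stay within \<eta>
    of \<open>u0\<close>, so that every solution in \<open>U\<close> can be compared with the
    symmetric one for the same parameter.\<close>
  define U where "U = ball l0 \<sigma>' \<times> ball u0 \<eta>"
  have branch: "(l, v) \<in> (\<lambda>l. (l, p l)) ` {l0 - \<delta><..<l0 + \<delta>} \<union> (\<lambda>a. (h a, u a)) ` {-\<delta><..<\<delta>}"
    if U: "(l, v) \<in> U" and F0: "F (l, v) = 0" for l v
  proof -
    have l: "\<bar>l - l0\<bar> < \<sigma>'" and v: "norm (v - u0) < \<eta>"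
      using U by (auto simp: U_def dist_norm norm_minus_commute abs_minus_commute)
    have lin: "l \<in> {l0 - \<delta><..<l0 + \<delta>}" using l \<sigma>'(3) by auto
    then have pl: "p l \<in> Xsym" "F (l, p l) = 0" using p(3) sub1 by auto
    have pn: "norm (p l - u0) < \<eta>" using \<sigma>(2) l \<sigma>'(2) by simp
    show ?thesis
    proof (cases "v = p l")
      case True
      then show ?thesis using lin by blast
    next
      case False
      \<comment> \<open>The only possible parameter on the second branch:
        \<open>v = p l + a *\<^sub>R y\<close> together with the normalisation
        \<open>ell y = 1\<close> forces this value.\<close>
      define a where "a = ell (v - p l)"
      define y where "y = (v - p l) /\<^sub>R a"
      have a: "a \<noteq> 0" and y: "norm (y - \<phi>0) \<le> \<rho> / 3"
        using r(2)[of l "p l" v] l v pn \<eta>(2) \<sigma>'(4) F0 pl(2) False by (auto simp: a_def y_def)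
      have "\<bar>a\<bar> \<le> norm ell * norm (v - p l)" unfolding a_def using norm_blinfun[of ell "v - p l"] by simp
      also have "\<dots> \<le> (norm ell + 1) * norm (v - p l)" by (rule mult_right_mono) auto
      also have "\<dots> < (norm ell + 1) * (2 * \<eta>)"
        using v pn norm_triangle_ineq4[of "v - u0" "p l - u0"] pos by (intro mult_strict_left_mono) auto
      also have "\<dots> \<le> \<delta>" using \<eta>(4) by (simp only: mult.assoc mult.left_commute)
      finally have a\<delta>: "a \<in> {-\<delta><..<\<delta>}" by auto
      have vy: "v = p l + a *\<^sub>R y" using a by (simp add: y_def)
      have "ell y = 1" using a by (simp add: y_def blinfun.scaleR_right a_def[symmetric])
      then have "desing ell (a, l, p l, y) = 0"
        unfolding desing_eq_zero_iff[OF a] vy[symmetric] using pl(2) F0 by simp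
      moreover have "(l, p l, y) \<in> cball (l0, u0, \<phi>0) \<rho>"
      proof -
        have "norm ((l, p l, y) - (l0, u0, \<phi>0)) \<le> norm (l - l0) + (norm (p l - u0) + norm (y - \<phi>0))"
          using norm_Pair_le[of "l - l0" "(p l - u0, y - \<phi>0)"] norm_Pair_le[of "p l - u0" "y - \<phi>0"] by simp
        also have "\<dots> \<le> \<rho> / 3 + (\<rho> / 3 + \<rho> / 3)"
          using l pn y \<eta>(3) \<sigma>'(4) by (intro add_mono) auto
        finally show ?thesis
          unfolding mem_cball dist_norm norm_minus_commute[of "(l0, u0, \<phi>0)"] by simp
      qed
      ultimately have lw: "(l, p l, y) = w a"
        using uniq[of a "(l, p l, y)"] a\<delta> \<delta>(3) pl(1) by auto
      have "(l, v) = (h a, u a)" unfolding u_def h_def q_def f_def lw[symmetric] using vy by simp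
      then show ?thesis using a\<delta> by blast
    qed
  qed
  have "solution_branches F Xsym l0 u0 p h u"
    unfolding solution_branches_def
  proof (intro exI[of _ \<delta>] conjI)
    show "smooth_on {l0 - \<delta><..<l0 + \<delta>} p"
      by (rule smooth_on_Ck_on[OF open_greaterThanLessThan Ck_on_subset[OF p(1) sub1]])
    show "smooth_on {-\<delta><..<\<delta>} h" "smooth_on {-\<delta><..<\<delta>} u"
      by (rule smooth_on_Ck_on[OF open_greaterThanLessThan Ck_on_subset[OF Ck_w(1) sub2]],
          rule smooth_on_Ck_on[OF open_greaterThanLessThan Ck_on_subset[OF Ck_u sub2]])
    show "\<forall>l\<in>{l0 - \<delta><..<l0 + \<delta>}. p l \<in> Xsym \<and> F (l, p l) = 0" using p(3) sub1 by blast
    show "\<forall>a\<in>{-\<delta><..<\<delta>}. F (h a, u a) = 0 \<and> vector_derivative (\<lambda>a. (h a, u a)) (at a) \<noteq> 0"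
      using Fu velocity sub2 \<delta>(4) by fastforce
    have "open U" "(l0, u0) \<in> U" using \<sigma>'(1) \<eta>(1) by (auto simp: U_def open_Times)
    moreover have "{z \<in> U. F z = 0} =
        U \<inter> ((\<lambda>l. (l, p l)) ` {l0 - \<delta><..<l0 + \<delta>} \<union> (\<lambda>a. (h a, u a)) ` {-\<delta><..<\<delta>})" (is "_ = U \<inter> ?B")
    proof
      show "{z \<in> U. F z = 0} \<subseteq> U \<inter> ?B" using branch by force
      show "U \<inter> ?B \<subseteq> {z \<in> U. F z = 0}" using Fu p(3) sub1 sub2 by auto
    qed
    ultimately show "\<exists>U. open U \<and> (l0, u0) \<in> U \<and> {z \<in> U. F z = 0} =
        U \<inter> ((\<lambda>l. (l, p l)) ` {l0 - \<delta><..<l0 + \<delta>} \<union> (\<lambda>a. (h a, u a)) ` {-\<delta><..<\<delta>})"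
      by blast
  qed (use \<delta>(1) p(2) at0 asym in auto)
  then show ?thesis by blast
qed

end

section \<open>Equivalence of symmetry-breaking bifurcation and nondegeneracy\<close>

theorem theorem2p5:
  fixes F :: "real \<times> 'x::banach \<Rightarrow> 'y::banach"
    and Xsym :: "'x set" and Ysym :: "'y set"
  assumes "smooth_on UNIV F"
    and "subspace Xsym" and "closed Xsym"
    and "subspace Ysym" and "closed Ysym"
    and "\<And>l u. u \<in> Xsym \<Longrightarrow> F (l, u) \<in> Ysym"
    and "\<And>l u. u \<in> Xsym \<Longrightarrow> fredholm_with_index UNIV UNIV (D_u F l u) 0"
    and "\<And>l u. u \<in> Xsym \<Longrightarrow> fredholm_with_index Xsym Ysym (D_u F l u) 0"
  shows "(\<forall>l0 u0 \<phi>0 (ell :: 'x \<Rightarrow>\<^sub>L real).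
            SB F Xsym Ysym l0 u0 \<phi>0 \<and> blinfun_apply ell \<phi>0 = 1 \<longrightarrow>
            nondegenerate_zero (ext_space Xsym) (ext_space Ysym) (extended_system F ell) (l0, u0, \<phi>0) \<and>
            (l0, u0, \<phi>0) isolated_in {z \<in> ext_space Xsym. extended_system F ell z = 0})
       \<and> (\<forall>l0 u0 \<phi>0 (ell :: 'x \<Rightarrow>\<^sub>L real).
            \<phi>0 \<notin> Xsym \<and>
            nondegenerate_zero (ext_space Xsym) (ext_space Ysym) (extended_system F ell) (l0, u0, \<phi>0) \<longrightarrow>
            SB F Xsym Ysym l0 u0 \<phi>0)
       \<and> (\<forall>l0 u0 \<phi>0 (ell :: 'x \<Rightarrow>\<^sub>L real).
            blinfun_apply ell \<phi>0 = 1 \<longrightarrow>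
            (transcritical_bifurcation F Xsym Ysym l0 u0 \<phi>0 \<or>
             pitchfork_bifurcation F Xsym Ysym l0 u0 \<phi>0 \<longleftrightarrow>
             nondegenerate_zero (ext_space Xsym) (ext_space Ysym) (extended_system F ell) (l0, u0, \<phi>0) \<and>
             \<phi>0 \<notin> Xsym))
       \<and> (\<forall>l0 u0.
            (\<exists>\<phi>0. transcritical_bifurcation F Xsym Ysym l0 u0 \<phi>0 \<or>
                  pitchfork_bifurcation F Xsym Ysym l0 u0 \<phi>0) \<longleftrightarrow>
            (\<exists>\<phi>0 (ell :: 'x \<Rightarrow>\<^sub>L real).
               nondegenerate_zero (ext_space Xsym) (ext_space Ysym) (extended_system F ell) (l0, u0, \<phi>0) \<and>
               \<phi>0 \<notin> Xsym))"
proof -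
  obtain DF D2F where "parametrized_operator F DF D2F"
    using smooth_imp_parametrized_operator[OF assms(1)] by blast
  then interpret parametrized_operator F DF D2F .
  note nondeg_iff = nondegenerate_zero_iff[OF assms(2)]
  have a: "nondegenerate_zero (ext_space Xsym) (ext_space Ysym) (extended_system F ell) (l0, u0, \<phi>0) \<and>
      (l0, u0, \<phi>0) isolated_in {z \<in> ext_space Xsym. extended_system F ell z = 0}"
    if SB: "SB F Xsym Ysym l0 u0 \<phi>0" and ell: "blinfun_apply ell \<phi>0 = 1" for l0 u0 \<phi>0 and ell :: "'x \<Rightarrow>\<^sub>L real"
  proof -
    obtain K where K: "isomorphism_between (ext_space Xsym) (ext_space Ysym) (Dext ell (l0, u0, \<phi>0)) K"
      using SB_imp_isomorphism[OF SB ell] by blast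
    have u0: "(l0, u0, \<phi>0) \<in> ext_space Xsym" using SB by (simp add: SB_def SB2_def)
    have "F (l0, u0) = 0" "D_u F l0 u0 \<phi>0 = 0"
      using SB span_base[of \<phi>0 "{\<phi>0}"] by (auto simp: SB_def SB1_def)
    then have zero: "extended_system F ell (l0, u0, \<phi>0) = 0"
      using ell by (simp add: extended_system_def zero_prod_def)
    show ?thesis
      using nondeg_iff u0 zero K isomorphism_between_isolated_zero[OF has_derivative_extended_system zero
          subspace_ext_space[OF assms(2)] u0 K] by blast
  qed
  have b: "SB F Xsym Ysym l0 u0 \<phi>0"
    if \<phi>0: "\<phi>0 \<notin> Xsym" and nondeg: "nondegenerate_zero (ext_space Xsym) (ext_space Ysym) (extended_system F ell) (l0, u0, \<phi>0)"
    for l0 u0 \<phi>0 and ell :: "'x \<Rightarrow>\<^sub>L real"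
  proof -
    obtain K where z: "u0 \<in> Xsym" "extended_system F ell (l0, u0, \<phi>0) = 0"
      and K: "isomorphism_between (ext_space Xsym) (ext_space Ysym) (Dext ell (l0, u0, \<phi>0)) K"
      using nondeg unfolding nondeg_iff by auto
    show ?thesis
      by (rule isomorphism_imp_SB[OF assms(2-6) assms(7)[OF z(1)] assms(8)[OF z(1)] z(1) \<phi>0 z(2) K])
  qed
  \<comment> \<open>Under (SB) the branches exist, and \<open>deriv h 0\<close> either vanishes or
    not; the disjunction of the two types therefore amounts to (SB).\<close>
  have bif: "transcritical_bifurcation F Xsym Ysym l0 u0 \<phi>0 \<or> pitchfork_bifurcation F Xsym Ysym l0 u0 \<phi>0 \<longleftrightarrow>
      SB F Xsym Ysym l0 u0 \<phi>0"
    if "blinfun_apply ell \<phi>0 = 1" for l0 u0 \<phi>0 and ell :: "'x \<Rightarrow>\<^sub>L real"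
    using SB_imp_solution_branches[OF _ that]
    unfolding transcritical_bifurcation_def pitchfork_bifurcation_def by blast
  have SB_functional: "\<exists>ell :: 'x \<Rightarrow>\<^sub>L real. ell \<phi>0 = 1" if SB: "SB F Xsym Ysym l0 u0 \<phi>0" for l0 u0 \<phi>0
  proof -
    obtain \<psi> :: "'y \<Rightarrow>\<^sub>L real" where \<psi>: "range (blinfun_apply (D_u F l0 u0)) = {y. \<psi> y = 0}"
      using SB by (auto simp: SB_def SB1_def)
    obtain \<xi> where \<xi>: "D_lu F l0 u0 \<phi>0 + D_uu F l0 u0 \<phi>0 \<xi> \<notin> range (blinfun_apply (D_u F l0 u0))"
      using SB by (auto simp: SB_def SB3_def)
    \<comment> \<open>The nondegeneracy condition itself supplies the functional, so Hahn--Banach is not needed.\<close>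
    define m :: "'x \<Rightarrow>\<^sub>L real" where
      "m = \<psi> o\<^sub>L (D_lu F l0 u0 + (blinfun.prod_left \<xi> o\<^sub>L D_uu F l0 u0))"
    have "m \<phi>0 \<noteq> 0" using \<xi> \<psi> by (auto simp: m_def blinfun.add_left)
    then show ?thesis by (intro exI[of _ "inverse (m \<phi>0) *\<^sub>R m"]) (simp add: blinfun.scaleR_left)
  qed
  have ell: "blinfun_apply ell \<phi>0 = 1"
    if "nondegenerate_zero (ext_space Xsym) (ext_space Ysym) (extended_system F ell) (l0, u0, \<phi>0)" for l0 u0 \<phi>0 and ell :: "'x \<Rightarrow>\<^sub>L real"
    using that by (auto simp: nondegenerate_zero_def extended_system_def zero_prod_def)
  have notin: "\<phi>0 \<notin> Xsym" if "SB F Xsym Ysym l0 u0 \<phi>0" for l0 u0 \<phi>0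
    using that by (simp add: SB_def SB2_def)
  have iff: "transcritical_bifurcation F Xsym Ysym l0 u0 \<phi>0 \<or> pitchfork_bifurcation F Xsym Ysym l0 u0 \<phi>0 \<longleftrightarrow>
      nondegenerate_zero (ext_space Xsym) (ext_space Ysym) (extended_system F ell) (l0, u0, \<phi>0) \<and> \<phi>0 \<notin> Xsym"
    if "blinfun_apply ell \<phi>0 = 1" for l0 u0 \<phi>0 and ell :: "'x \<Rightarrow>\<^sub>L real"
    unfolding bif[OF that] using a[OF _ that] b notin by blast
  have bif_SB: "SB F Xsym Ysym l0 u0 \<phi>0"
    if "transcritical_bifurcation F Xsym Ysym l0 u0 \<phi>0 \<or> pitchfork_bifurcation F Xsym Ysym l0 u0 \<phi>0" for l0 u0 \<phi>0
    using that by (auto simp: transcritical_bifurcation_def pitchfork_bifurcation_def)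
  have "(\<exists>\<phi>0. transcritical_bifurcation F Xsym Ysym l0 u0 \<phi>0 \<or> pitchfork_bifurcation F Xsym Ysym l0 u0 \<phi>0) \<longleftrightarrow>
      (\<exists>\<phi>0 (ell :: 'x \<Rightarrow>\<^sub>L real).
        nondegenerate_zero (ext_space Xsym) (ext_space Ysym) (extended_system F ell) (l0, u0, \<phi>0) \<and> \<phi>0 \<notin> Xsym)" for l0 u0
    \<comment> \<open>With \<open>ell\<close> quantified as well, a normalised functional is needed
      in both directions: (SB) produces one, and at a zero of the extended system the first
      component already gives \<open>ell \<phi>0 = 1\<close>.\<close>
    using iff ell SB_functional bif_SB by metis
  then show ?thesis using a b iff by blast
qed

end
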